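(* Every statement about finite sets provable in $\mathsf{ZC}^-$ holds in $\mathsf{THS}$: precisely, for every sentence $\varphi$ of the language of set theory, if $\mathsf{ZC}^-$ proves that $\varphi$ holds in the universe of hereditarily finite sets, then $\mathsf{THS}$ proves $\varphi$ relativized to the universe $\mathbb{H}$ of all sets.
   Context: $\mathsf{ZC}^-$ is Zermelo set theory with the axiom of choice and without the axiom of regularity. $\mathsf{THS}$ is a first-order theory in the language with the single binary predicate $\in$; its objects are classes. A set is a class that is a member of some class; $\mathbb{H}$ is the class of all sets. Set formulas are formulas with quantifiers only over sets and with no class variables/constants. Axioms: (Ext) classes with the same set-elements are equal; (Class) for any formula $\Phi$ and classes $X_1,\dots,X_n$ there is $Y$ with $y\in Y\leftrightarrow\Phi(y,\vec X)$ for all sets $y$; (Set) $\emptyset$ and $x\cup\{y\}$ are sets for sets $x,y$; (Ind) for set formulas $\varphi$: $\varphi(\emptyset)\wedge\forall x\forall y(\varphi(x)\wedge\varphi(y)\to\varphi(x\cup\{y\}))\to\forall x\varphi(x)$. A class $X$ is small iff every subclass of $X$ is a set; thin iff every subset of $X$ is small. (Thin) every thin class is a subclass of some set; (Comp) for every thin $X$ and set $u\subseteq\bigcup X$ there is a set $x\subseteq X$ with $u\subseteq\bigcup x$; (Exp) for every thin $X$ there is a thin $P$ such that for every set $y$ there is $p\in P$ with $y\cap X=p\cap X$; (Choice) if $\mathrm{dom}(X)$ is thin there is a function $F\subseteq X$ with $\mathrm{dom}F=\mathrm{dom}X$; $\mathbb{SN}$ is the smallest class containing $\emptyset$ closed under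 $n\mapsto n\cup\{n\}$; (DC) for any formula $\Phi$: if $\forall X\exists Y\Phi(X,Y)$ then for every $X_0$ there is $Z$ with $Z``\{\emptyset\}=X_0$ and $\Phi(Z``\{n\},Z``\{n\cup\{n\}\})$ for all $n\in\mathbb{SN}$, where $X``A=\{b:\exists a\in A\,\langle a,b\rangle\in X\}$; $\mathbb{S}$ is the smallest class containing $\emptyset$ closed under $(a,b)\mapsto a\cup\{b\}$; (T) for set formulas $\varphi$ and $t_1,\dots,t_n\in\mathbb{S}$: $\exists x\varphi(x,\vec t)\to\exists x\in\mathbb{S}\,\varphi(x,\vec t)$. *)

theory Defs
  imports Main
begin

section \<open>First-order logic with equality in the language of set theory\<close>

text \<open>
  Variables are de Bruijn indices: in \<open>\<^bold>\<forall> p\<close> the bound variable is index 0 of \<open>p\<close>, and the variable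
  with index \<open>k\<close> outside the quantifier has index \<open>Suc k\<close> inside. There are no function symbols, so
  terms are variables.
\<close>

datatype fm =
    Falsum  (\<open>\<^bold>\<bottom>\<close>)
  | Mem nat nat  (infix \<open>\<^bold>\<in>\<close> 60)
  | Eql nat nat  (infix \<open>\<^bold>=\<close> 60)
  | Imp fm fm  (infixr \<open>\<^bold>\<longrightarrow>\<close> 55)
  | Forall fm  (\<open>\<^bold>\<forall> _\<close> [59] 59)

definition Neg :: "fm \<Rightarrow> fm"  (\<open>\<^bold>\<not> _\<close> [59] 59)
  where "\<^bold>\<not> p = (p \<^bold>\<longrightarrow> \<^bold>\<bottom>)"

definition Or :: "fm \<Rightarrow> fm \<Rightarrow> fm"  (infixr \<open>\<^bold>\<or>\<close> 56)
  where "p \<^bold>\<or> q = (\<^bold>\<not> p \<^bold>\<longrightarrow> q)"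

definition And :: "fm \<Rightarrow> fm \<Rightarrow> fm"  (infixr \<open>\<^bold>\<and>\<close> 57)
  where "p \<^bold>\<and> q = \<^bold>\<not> (p \<^bold>\<longrightarrow> \<^bold>\<not> q)"

definition Iff :: "fm \<Rightarrow> fm \<Rightarrow> fm"  (infix \<open>\<^bold>\<longleftrightarrow>\<close> 54)
  where "(p \<^bold>\<longleftrightarrow> q) = ((p \<^bold>\<longrightarrow> q) \<^bold>\<and> (q \<^bold>\<longrightarrow> p))"

definition Exists :: "fm \<Rightarrow> fm"  (\<open>\<^bold>\<exists> _\<close> [59] 59)
  where "\<^bold>\<exists> p = \<^bold>\<not> (\<^bold>\<forall> (\<^bold>\<not> p))"

primrec fv :: "fm \<Rightarrow> nat set" where
  "fv \<^bold>\<bottom> = {}"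
| "fv (i \<^bold>\<in> j) = {i, j}"
| "fv (i \<^bold>= j) = {i, j}"
| "fv (p \<^bold>\<longrightarrow> q) = fv p \<union> fv q"
| "fv (\<^bold>\<forall> p) = {i. Suc i \<in> fv p}"

definition sentence :: "fm \<Rightarrow> bool"
  where "sentence p \<longleftrightarrow> fv p = {}"

text \<open>Capture-free simultaneous substitution of variables for variables.\<close>

primrec ren :: "(nat \<Rightarrow> nat) \<Rightarrow> fm \<Rightarrow> fm" where
  "ren f \<^bold>\<bottom> = \<^bold>\<bottom>"
| "ren f (i \<^bold>\<in> j) = f i \<^bold>\<in> f j"
| "ren f (i \<^bold>= j) = f i \<^bold>= f j"
| "ren f (p \<^bold>\<longrightarrow> q) = (ren f p \<^bold>\<longrightarrow> ren f q)"
| "ren f (\<^bold>\<forall> p) = \<^bold>\<forall> (ren (case_nat 0 (\<lambda>k. Suc (f k))) p)"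

text \<open>
  \<open>inst1 d i p\<close> substitutes variable \<open>i\<close> for variable 0 of \<open>p\<close>, and \<open>inst2 d i j p\<close> substitutes \<open>i, j\<close>
  for variables 0, 1. The remaining variables of \<open>p\<close> are its parameters; they are renumbered
  consecutively from \<open>d\<close>, which is the number of quantifiers standing between the parameters and
  the place where the instance occurs.
\<close>

definition inst1 :: "nat \<Rightarrow> nat \<Rightarrow> fm \<Rightarrow> fm"
  where "inst1 d i = ren (case_nat i (\<lambda>k. k + d))"

definition inst2 :: "nat \<Rightarrow> nat \<Rightarrow> nat \<Rightarrow> fm \<Rightarrow> fm"
  where "inst2 d i j = ren (case_nat i (case_nat j (\<lambda>k. k + d)))"

text \<open>
  Classical natural deduction. In \<open>AllI\<close> the hypotheses are shifted, which makes variable 0 fresh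
  for them.
\<close>

inductive proves :: "fm set \<Rightarrow> fm \<Rightarrow> bool"  (infix \<open>\<turnstile>\<close> 50) where
  Assm: "p \<in> \<Gamma> \<Longrightarrow> \<Gamma> \<turnstile> p"
| ImpI: "insert p \<Gamma> \<turnstile> q \<Longrightarrow> \<Gamma> \<turnstile> p \<^bold>\<longrightarrow> q"
| ImpE: "\<Gamma> \<turnstile> p \<^bold>\<longrightarrow> q \<Longrightarrow> \<Gamma> \<turnstile> p \<Longrightarrow> \<Gamma> \<turnstile> q"
| Classical: "insert (\<^bold>\<not> p) \<Gamma> \<turnstile> \<^bold>\<bottom> \<Longrightarrow> \<Gamma> \<turnstile> p"
| AllI: "ren Suc ` \<Gamma> \<turnstile> p \<Longrightarrow> \<Gamma> \<turnstile> \<^bold>\<forall> p"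
| AllE: "\<Gamma> \<turnstile> \<^bold>\<forall> p \<Longrightarrow> \<Gamma> \<turnstile> inst1 0 i p"
| EqI: "\<Gamma> \<turnstile> i \<^bold>= i"
| EqE: "\<Gamma> \<turnstile> i \<^bold>= j \<Longrightarrow> \<Gamma> \<turnstile> inst1 0 i p \<Longrightarrow> \<Gamma> \<turnstile> inst1 0 j p"

text \<open>
  A class \<open>{v. G}\<close> defined without parameters is given by the function \<open>G\<close> that maps an index \<open>i\<close>
  to the formula saying that variable \<open>i\<close> belongs to it. In \<open>all_in G p\<close> the formula \<open>G 0\<close> stands
  inside the quantifier; so \<open>x \<in> y\<close> as a bound is \<open>\<lambda>i. i \<^bold>\<in> Suc y\<close>.
\<close>

definition all_in :: "(nat \<Rightarrow> fm) \<Rightarrow> fm \<Rightarrow> fm"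
  where "all_in G p = \<^bold>\<forall> (G 0 \<^bold>\<longrightarrow> p)"

definition ex_in :: "(nat \<Rightarrow> fm) \<Rightarrow> fm \<Rightarrow> fm"
  where "ex_in G p = \<^bold>\<exists> (G 0 \<^bold>\<and> p)"

primrec relativize :: "(nat \<Rightarrow> fm) \<Rightarrow> fm \<Rightarrow> fm" where
  "relativize G \<^bold>\<bottom> = \<^bold>\<bottom>"
| "relativize G (i \<^bold>\<in> j) = i \<^bold>\<in> j"
| "relativize G (i \<^bold>= j) = i \<^bold>= j"
| "relativize G (p \<^bold>\<longrightarrow> q) = (relativize G p \<^bold>\<longrightarrow> relativize G q)"
| "relativize G (\<^bold>\<forall> p) = all_in G (relativize G p)"

definition closures :: "fm \<Rightarrow> fm set"
  where "closures p = {(Forall ^^ n) p | n. fv p \<subseteq> {..<n}}"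

definition closures_in :: "(nat \<Rightarrow> fm) \<Rightarrow> fm \<Rightarrow> fm set"
  where "closures_in G p = {(all_in G ^^ n) p | n. fv p \<subseteq> {..<n}}"


section \<open>Set-theoretic notions\<close>

text \<open>Numerals added to an index account for the quantifiers crossed.\<close>

definition empty_fm :: "nat \<Rightarrow> fm"
  where "empty_fm x = \<^bold>\<forall> (\<^bold>\<not> (0 \<^bold>\<in> x+1))"

definition subset_fm :: "nat \<Rightarrow> nat \<Rightarrow> fm"
  where "subset_fm x y = \<^bold>\<forall> (0 \<^bold>\<in> x+1 \<^bold>\<longrightarrow> 0 \<^bold>\<in> y+1)"

text \<open>\<open>z = x \<union> {y}\<close>\<close>

definition adjoin_fm :: "nat \<Rightarrow> nat \<Rightarrow> nat \<Rightarrow> fm"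
  where "adjoin_fm z x y = \<^bold>\<forall> (0 \<^bold>\<in> z+1 \<^bold>\<longleftrightarrow> 0 \<^bold>\<in> x+1 \<^bold>\<or> 0 \<^bold>= y+1)"

text \<open>\<open>z = {x, y}\<close>\<close>

definition upair_fm :: "nat \<Rightarrow> nat \<Rightarrow> nat \<Rightarrow> fm"
  where "upair_fm z x y = \<^bold>\<forall> (0 \<^bold>\<in> z+1 \<^bold>\<longleftrightarrow> 0 \<^bold>= x+1 \<^bold>\<or> 0 \<^bold>= y+1)"

text \<open>\<open>z = {{x}, {x, y}}\<close>\<close>

definition opair_fm :: "nat \<Rightarrow> nat \<Rightarrow> nat \<Rightarrow> fm"
  where "opair_fm z x y =
    \<^bold>\<exists> (\<^bold>\<exists> (upair_fm 1 (x+2) (x+2) \<^bold>\<and> upair_fm 0 (x+2) (y+2) \<^bold>\<and> upair_fm (z+2) 1 0))"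

text \<open>\<open>\<langle>x, y\<rangle> \<in> r\<close>\<close>

definition opair_in_fm :: "nat \<Rightarrow> nat \<Rightarrow> nat \<Rightarrow> fm"
  where "opair_in_fm x y r = \<^bold>\<exists> (opair_fm 0 (x+1) (y+1) \<^bold>\<and> 0 \<^bold>\<in> r+1)"

definition function_fm :: "nat \<Rightarrow> fm"
  where "function_fm f =
    (all_in (\<lambda>z. z \<^bold>\<in> f+1) (\<^bold>\<exists> (\<^bold>\<exists> (opair_fm 2 1 0))) \<^bold>\<and>
     \<^bold>\<forall> (\<^bold>\<forall> (\<^bold>\<forall> (opair_in_fm 2 1 (f+3) \<^bold>\<and> opair_in_fm 2 0 (f+3) \<^bold>\<longrightarrow> 1 \<^bold>= 0))))"

definition injective_fm :: "nat \<Rightarrow> fm"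
  where "injective_fm f =
    \<^bold>\<forall> (\<^bold>\<forall> (\<^bold>\<forall> (opair_in_fm 2 0 (f+3) \<^bold>\<and> opair_in_fm 1 0 (f+3) \<^bold>\<longrightarrow> 2 \<^bold>= 1)))"

definition dom_fm :: "nat \<Rightarrow> nat \<Rightarrow> fm"
  where "dom_fm d r = \<^bold>\<forall> (0 \<^bold>\<in> d+1 \<^bold>\<longleftrightarrow> \<^bold>\<exists> (opair_in_fm 1 0 (r+2)))"

definition range_fm :: "nat \<Rightarrow> nat \<Rightarrow> fm"
  where "range_fm d r = \<^bold>\<forall> (0 \<^bold>\<in> d+1 \<^bold>\<longleftrightarrow> \<^bold>\<exists> (opair_in_fm 0 1 (r+2)))"

definition bijection_fm :: "nat \<Rightarrow> nat \<Rightarrow> nat \<Rightarrow> fm"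
  where "bijection_fm f x y =
    (function_fm f \<^bold>\<and> injective_fm f \<^bold>\<and> dom_fm x f \<^bold>\<and> range_fm y f)"

definition inductive_fm :: "nat \<Rightarrow> fm"
  where "inductive_fm x =
    (ex_in (\<lambda>e. e \<^bold>\<in> x+1) (empty_fm 0) \<^bold>\<and>
     all_in (\<lambda>m. m \<^bold>\<in> x+1) (ex_in (\<lambda>s. s \<^bold>\<in> x+2) (adjoin_fm 0 1 1)))"

text \<open>
  Read in Zermelo set theory, this says that \<open>n\<close> is in the set \<open>\<omega>\<close>; read in a theory of classes, it
  says that \<open>n\<close> is in the smallest class containing \<open>\<emptyset>\<close> and closed under \<open>n \<mapsto> n \<union> {n}\<close>.
\<close>

definition nat_fm :: "nat \<Rightarrow> fm"
  where "nat_fm n = all_in inductive_fm (n+1 \<^bold>\<in> 0)"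

definition finite_fm :: "nat \<Rightarrow> fm"
  where "finite_fm x = ex_in nat_fm (\<^bold>\<exists> (bijection_fm 0 1 (x+2)))"

definition transitive_fm :: "nat \<Rightarrow> fm"
  where "transitive_fm t = all_in (\<lambda>y. y \<^bold>\<in> t+1) (subset_fm 0 (t+1))"

text \<open>Every nonempty subset \<open>a\<close> of \<open>t\<close> has an element disjoint from \<open>a\<close>.\<close>

definition wellfounded_fm :: "nat \<Rightarrow> fm"
  where "wellfounded_fm t =
    \<^bold>\<forall> (subset_fm 0 (t+1) \<^bold>\<and> \<^bold>\<not> (empty_fm 0) \<^bold>\<longrightarrow>
       ex_in (\<lambda>y. y \<^bold>\<in> 1) (\<^bold>\<not> (ex_in (\<lambda>z. z \<^bold>\<in> 1) (0 \<^bold>\<in> 2))))"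

text \<open>
  \<open>x\<close> is an element of a finite transitive well-founded set, i.e. of \<open>V\<^sub>\<omega>\<close>. The formula does not
  presuppose transitive closures or the set \<open>V\<^sub>\<omega>\<close>, which Zermelo set theory does not provide;
  well-foundedness has to be demanded because regularity is not an axiom.
\<close>

definition hf_fm :: "nat \<Rightarrow> fm"
  where "hf_fm x =
    \<^bold>\<exists> (x+1 \<^bold>\<in> 0 \<^bold>\<and> transitive_fm 0 \<^bold>\<and> wellfounded_fm 0 \<^bold>\<and> finite_fm 0)"


section \<open>Zermelo set theory with choice and without regularity\<close>

definition Z_extensionality :: fm
  where "Z_extensionality = \<^bold>\<forall> (\<^bold>\<forall> (\<^bold>\<forall> (0 \<^bold>\<in> 2 \<^bold>\<longleftrightarrow> 0 \<^bold>\<in> 1) \<^bold>\<longrightarrow> 1 \<^bold>= 0))"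

definition Z_empty :: fm
  where "Z_empty = \<^bold>\<exists> (empty_fm 0)"

definition Z_pairing :: fm
  where "Z_pairing = \<^bold>\<forall> (\<^bold>\<forall> (\<^bold>\<exists> (upair_fm 0 2 1)))"

definition Z_union :: fm
  where "Z_union = \<^bold>\<forall> (\<^bold>\<exists> (\<^bold>\<forall> (0 \<^bold>\<in> 1 \<^bold>\<longleftrightarrow> \<^bold>\<exists> (0 \<^bold>\<in> 3 \<^bold>\<and> 1 \<^bold>\<in> 0))))"

definition Z_power :: fm
  where "Z_power = \<^bold>\<forall> (\<^bold>\<exists> (\<^bold>\<forall> (0 \<^bold>\<in> 1 \<^bold>\<longleftrightarrow> subset_fm 0 2)))"

definition Z_infinity :: fm
  where "Z_infinity = \<^bold>\<exists> (inductive_fm 0)"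

definition Z_separation :: "fm \<Rightarrow> fm"
  where "Z_separation p = \<^bold>\<forall> (\<^bold>\<exists> (\<^bold>\<forall> (0 \<^bold>\<in> 1 \<^bold>\<longleftrightarrow> 0 \<^bold>\<in> 2 \<^bold>\<and> inst1 3 0 p)))"

text \<open>Every set \<open>x\<close> of nonempty, pairwise disjoint sets has a set meeting each of them in one point.\<close>

definition Z_choice :: fm
  where "Z_choice =
    \<^bold>\<forall> (all_in (\<lambda>y. y \<^bold>\<in> 1) (\<^bold>\<not> (empty_fm 0)) \<^bold>\<and>
       all_in (\<lambda>y. y \<^bold>\<in> 1) (all_in (\<lambda>z. z \<^bold>\<in> 2)
         (\<^bold>\<not> (1 \<^bold>= 0) \<^bold>\<longrightarrow> \<^bold>\<not> (\<^bold>\<exists> (0 \<^bold>\<in> 2 \<^bold>\<and> 0 \<^bold>\<in> 1)))) \<^bold>\<longrightarrow>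
       \<^bold>\<exists> (all_in (\<lambda>y. y \<^bold>\<in> 2) (\<^bold>\<exists> (\<^bold>\<forall> (0 \<^bold>\<in> 2 \<^bold>\<and> 0 \<^bold>\<in> 3 \<^bold>\<longleftrightarrow> 0 \<^bold>= 1)))))"

definition ZC_minus :: "fm set"
  where "ZC_minus =
    {Z_extensionality, Z_empty, Z_pairing, Z_union, Z_power, Z_infinity, Z_choice} \<union>
    (\<Union>p. closures (Z_separation p))"


section \<open>The theory of hyperfinite sets\<close>

text \<open>The variables range over classes; \<open>set_fm\<close> defines the class \<open>\<H>\<close> of all sets.\<close>

definition set_fm :: "nat \<Rightarrow> fm"
  where "set_fm x = \<^bold>\<exists> (x+1 \<^bold>\<in> 0)"

definition small_fm :: "nat \<Rightarrow> fm"
  where "small_fm x = \<^bold>\<forall> (subset_fm 0 (x+1) \<^bold>\<longrightarrow> set_fm 0)"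

definition thin_fm :: "nat \<Rightarrow> fm"
  where "thin_fm x = all_in set_fm (subset_fm 0 (x+1) \<^bold>\<longrightarrow> small_fm 0)"

text \<open>\<open>u \<subseteq> \<Union>x\<close>\<close>

definition covers_fm :: "nat \<Rightarrow> nat \<Rightarrow> fm"
  where "covers_fm x u = all_in (\<lambda>z. z \<^bold>\<in> u+1) (ex_in (\<lambda>y. y \<^bold>\<in> x+2) (1 \<^bold>\<in> 0))"

text \<open>\<open>b = x `` a\<close>, and \<open>b = x `` {n}\<close>\<close>

definition image_fm :: "nat \<Rightarrow> nat \<Rightarrow> nat \<Rightarrow> fm"
  where "image_fm b x a =
    \<^bold>\<forall> (0 \<^bold>\<in> b+1 \<^bold>\<longleftrightarrow> ex_in (\<lambda>c. c \<^bold>\<in> a+2) (opair_in_fm 0 1 (x+2)))"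

definition image_singleton_fm :: "nat \<Rightarrow> nat \<Rightarrow> nat \<Rightarrow> fm"
  where "image_singleton_fm b x n = \<^bold>\<exists> (upair_fm 0 (n+1) (n+1) \<^bold>\<and> image_fm (b+1) (x+1) 0)"

text \<open>\<open>\<emptyset> \<in> x\<close>, and \<open>x\<close> is closed under \<open>(a, b) \<mapsto> a \<union> {b}\<close>.\<close>

definition adjoin_closed_fm :: "nat \<Rightarrow> fm"
  where "adjoin_closed_fm x =
    (ex_in (\<lambda>e. e \<^bold>\<in> x+1) (empty_fm 0) \<^bold>\<and>
     all_in (\<lambda>a. a \<^bold>\<in> x+1) (all_in (\<lambda>b. b \<^bold>\<in> x+2) (ex_in (\<lambda>c. c \<^bold>\<in> x+3) (adjoin_fm 0 2 1))))"

text \<open>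
  Membership in the smallest adjunction-closed class \<open>\<S>\<close>. The class \<open>\<S>\<N>\<close>, the smallest class
  containing \<open>\<emptyset>\<close> and closed under \<open>n \<mapsto> n \<union> {n}\<close>, is given by \<open>nat_fm\<close>.
\<close>

definition standard_fm :: "nat \<Rightarrow> fm"
  where "standard_fm x = all_in adjoin_closed_fm (x+1 \<^bold>\<in> 0)"

definition THS_Ext :: fm
  where "THS_Ext = \<^bold>\<forall> (\<^bold>\<forall> (all_in set_fm (0 \<^bold>\<in> 2 \<^bold>\<longleftrightarrow> 0 \<^bold>\<in> 1) \<^bold>\<longrightarrow> 1 \<^bold>= 0))"

definition THS_Class :: "fm \<Rightarrow> fm"
  where "THS_Class p = \<^bold>\<exists> (all_in set_fm (0 \<^bold>\<in> 1 \<^bold>\<longleftrightarrow> inst1 2 0 p))"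

definition THS_Set_empty :: fm
  where "THS_Set_empty = ex_in set_fm (empty_fm 0)"

definition THS_Set_adjoin :: fm
  where "THS_Set_adjoin =
    all_in set_fm (all_in set_fm (ex_in set_fm (adjoin_fm 0 2 1)))"

text \<open>
  The set formulas are the formulas \<open>relativize set_fm p\<close> with free variables restricted to sets; in
  the schemas \<open>THS_Ind\<close> and \<open>THS_T\<close> the parameters are restricted when the universal closure is
  formed in \<open>THS\<close> below.
\<close>

definition THS_Ind :: "fm \<Rightarrow> fm"
  where "THS_Ind p = (let q = relativize set_fm p in
    all_in set_fm (empty_fm 0 \<^bold>\<longrightarrow> inst1 1 0 q) \<^bold>\<and>
    all_in set_fm (all_in set_fm (inst1 2 1 q \<^bold>\<and> inst1 2 0 q \<^bold>\<longrightarrow>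
      all_in set_fm (adjoin_fm 0 2 1 \<^bold>\<longrightarrow> inst1 3 0 q))) \<^bold>\<longrightarrow>
    all_in set_fm (inst1 1 0 q))"

definition THS_Thin :: fm
  where "THS_Thin = all_in thin_fm (ex_in set_fm (subset_fm 1 0))"

definition THS_Comp :: fm
  where "THS_Comp =
    all_in thin_fm (all_in set_fm (covers_fm 1 0 \<^bold>\<longrightarrow>
      ex_in set_fm (subset_fm 0 2 \<^bold>\<and> covers_fm 0 1)))"

definition THS_Exp :: fm
  where "THS_Exp =
    all_in thin_fm (ex_in thin_fm (all_in set_fm (ex_in (\<lambda>p. p \<^bold>\<in> 2)
      (\<^bold>\<forall> (0 \<^bold>\<in> 2 \<^bold>\<and> 0 \<^bold>\<in> 4 \<^bold>\<longleftrightarrow> 0 \<^bold>\<in> 1 \<^bold>\<and> 0 \<^bold>\<in> 4)))))"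

definition THS_Choice :: fm
  where "THS_Choice =
    \<^bold>\<forall> (\<^bold>\<forall> (dom_fm 0 1 \<^bold>\<and> thin_fm 0 \<^bold>\<longrightarrow>
      \<^bold>\<exists> (function_fm 0 \<^bold>\<and> subset_fm 0 2 \<^bold>\<and> dom_fm 1 0)))"

text \<open>In \<open>THS_DC p\<close>, variables 0 and 1 of \<open>p\<close> are the \<open>X\<close> and \<open>Y\<close> of \<open>\<Phi>(X, Y)\<close>.\<close>

definition THS_DC :: "fm \<Rightarrow> fm"
  where "THS_DC p =
    (\<^bold>\<forall> (\<^bold>\<exists> (inst2 2 1 0 p)) \<^bold>\<longrightarrow>
     \<^bold>\<forall> (\<^bold>\<exists> (
       \<^bold>\<exists> (empty_fm 0 \<^bold>\<and> image_singleton_fm 2 1 0) \<^bold>\<and>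
       all_in nat_fm (\<^bold>\<exists> (adjoin_fm 0 1 1 \<^bold>\<and>
         \<^bold>\<exists> (\<^bold>\<exists> (image_singleton_fm 1 4 3 \<^bold>\<and> image_singleton_fm 0 4 2 \<^bold>\<and> inst2 6 1 0 p)))))))"

definition THS_T :: "fm \<Rightarrow> fm"
  where "THS_T p = (let q = relativize set_fm p in ex_in set_fm q \<^bold>\<longrightarrow> ex_in standard_fm q)"

definition THS :: "fm set"
  where "THS =
    {THS_Ext, THS_Set_empty, THS_Set_adjoin, THS_Thin, THS_Comp, THS_Exp, THS_Choice} \<union>
    (\<Union>p. closures (THS_Class p)) \<union>
    (\<Union>p. closures_in set_fm (THS_Ind p)) \<union>
    (\<Union>p. closures (THS_DC p)) \<union>
    (\<Union>p. closures_in standard_fm (THS_T p))"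

end

theory Submission
  imports Defs "HOL-Library.Countable"
begin

text \<open>
  By soundness and completeness the claim is about models. In a model of THS the axiom (T) makes
  the class \<open>S\<close> of standard sets an elementary submodel of the class of all sets, so
  it suffices to extend \<open>S\<close> to a model of Zermelo set theory with choice whose hereditarily
  finite sets are exactly the elements of \<open>S\<close>.

  The class \<open>S\<close> is thin. Starting from \<open>T\<^sub>0 = S\<close>, dependent choice gives an increasing sequence of
  thin classes, indexed by the standard numbers, in which \<open>T\<^sub>n\<^sub>+\<^sub>1\<close> has exactly one element with
  trace \<open>A\<close> on \<open>T\<^sub>n\<close> for each subclass \<open>A\<close> of \<open>T\<^sub>n\<close>, and the new elements belong neither to old nor to
  new ones. The union of the sequence, with the true membership relation, is the required model; it
  plays the role of \<open>V\<^sub>\<omega>\<^sub>+\<^sub>\<omega>\<close>.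

  Exponentiation supplies a thin class \<open>P\<close> of codes of the subclasses of \<open>T\<close>, but not unique ones.
  By compactness there is a set \<open>t\<close> containing \<open>T\<close> and disjoint from every symmetric difference of two
  elements of \<open>P\<close> with the same trace on \<open>T\<close>; then \<open>p \<inter> t\<close>, for \<open>p\<close> in \<open>P\<close>, depends on \<open>p \<inter> T\<close> only.
\<close>


section \<open>Semantics and soundness\<close>

text \<open>An element of the model is a true set that may also have members outside the model, and
  only its trace on the model counts there. Extensionality is therefore not inherited; it has to be
  arranged level by level. This is why each trace is taken by one element only, and why codes that
  agree on the old level must first be made to agree on \<open>t\<close>. Every new element receives
  the code \<open>v\<close> of \<open>t\<close> as an additional member: as the old level lies
  inside \<open>t\<close>, foundation then forbids that a new element belongs to an old or to a new
  one.

  Separation and power sets come from impredicative class comprehension: satisfaction in the union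
  is definable with class quantifiers, and every subclass of a level has a code on the next one.
  Thinness of \<open>S\<close> rests on the fact that a set of standard sets is standard, proved
  with levels of the cumulative hierarchy. No further element of the model becomes hereditarily
  finite, because a class function maps a small set onto a set, and so a trace of standard sets
  enumerated from a standard number is the extension of a standard set.\<close>

definition scons :: "'a \<Rightarrow> (nat \<Rightarrow> 'a) \<Rightarrow> nat \<Rightarrow> 'a"  (infixr \<open>##\<close> 65)
  where "x ## e = case_nat x e"

lemma scons_simps [simp]:
  "(x ## e) 0 = x"
  "(x ## e) (Suc n) = e n"
  "(x ## e) 1 = e 0"
  "(x ## e) (n + 1) = e n"
  "(x ## e) (numeral k) = e (pred_numeral k)"
  "(x ## e) (n + numeral k) = e (n + pred_numeral k)"
  by (auto simp: scons_def numeral_eq_Suc split: nat.splits)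

definition envs :: "'a set \<Rightarrow> (nat \<Rightarrow> 'a) set"
  where "envs W = {e. \<forall>n. e n \<in> W}"

lemma envsD: "e \<in> envs W \<Longrightarrow> e n \<in> W"
  by (simp add: envs_def)

lemma envs_scons [simp]: "x ## e \<in> envs W \<longleftrightarrow> x \<in> W \<and> e \<in> envs W"
  by (auto simp: envs_def scons_def split: nat.splits)

lemma envs_shift: "e \<in> envs W \<Longrightarrow> (\<lambda>n. e (f n)) \<in> envs W"
  by (simp add: envs_def)

lemma envs_mono: "e \<in> envs V \<Longrightarrow> V \<subseteq> W \<Longrightarrow> e \<in> envs W"
  by (auto simp: envs_def)

primrec sat :: "'a set \<Rightarrow> ('a \<Rightarrow> 'a \<Rightarrow> bool) \<Rightarrow> (nat \<Rightarrow> 'a) \<Rightarrow> fm \<Rightarrow> bool" where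
  "sat W E e \<^bold>\<bottom> = False"
| "sat W E e (i \<^bold>\<in> j) = E (e i) (e j)"
| "sat W E e (i \<^bold>= j) = (e i = e j)"
| "sat W E e (p \<^bold>\<longrightarrow> q) = (sat W E e p \<longrightarrow> sat W E e q)"
| "sat W E e (\<^bold>\<forall> p) = (\<forall>x\<in>W. sat W E (x ## e) p)"

lemma sat_connectives [simp]:
  "sat W E e (\<^bold>\<not> p) = (\<not> sat W E e p)"
  "sat W E e (p \<^bold>\<or> q) = (sat W E e p \<or> sat W E e q)"
  "sat W E e (p \<^bold>\<and> q) = (sat W E e p \<and> sat W E e q)"
  "sat W E e (p \<^bold>\<longleftrightarrow> q) = (sat W E e p \<longleftrightarrow> sat W E e q)"
  "sat W E e (\<^bold>\<exists> p) = (\<exists>x\<in>W. sat W E (x ## e) p)"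
  "sat W E e (all_in G p) = (\<forall>x\<in>W. sat W E (x ## e) (G 0) \<longrightarrow> sat W E (x ## e) p)"
  "sat W E e (ex_in G p) = (\<exists>x\<in>W. sat W E (x ## e) (G 0) \<and> sat W E (x ## e) p)"
  by (auto simp: Neg_def Or_def And_def Iff_def Exists_def all_in_def ex_in_def)

text \<open>A closed rule set for \<open>simp only\<close>: it evaluates satisfaction but leaves the
  resulting quantifiers in the shape that later rewriting and the stated equivalences
  expect.\<close>

lemmas sem_simps = sat.simps sat_connectives scons_simps pred_numeral_simps BitM.simps numeral_One
  One_nat_def add_0 add_0_right add_Suc_right

lemma sat_cong: "\<forall>i\<in>fv p. e i = e' i \<Longrightarrow> sat W E e p = sat W E e' p"
proof (induction p arbitrary: e e')
  case (Forall p)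
  have "sat W E (x ## e) p = sat W E (x ## e') p" for x
    using Forall.prems by (intro Forall.IH) (auto simp: scons_def split: nat.splits)
  then show ?case by simp
next
  case (Imp p q)
  have "sat W E e p = sat W E e' p" "sat W E e q = sat W E e' q"
    using Imp.prems by (intro Imp.IH; simp)+
  then show ?case by simp
qed simp_all

lemma sat_ren: "sat W E e (ren f p) = sat W E (\<lambda>n. e (f n)) p"
proof (induction p arbitrary: e f)
  case (Forall p)
  have *: "(\<lambda>n. (x ## e) (case_nat 0 (\<lambda>k. Suc (f k)) n)) = x ## (\<lambda>n. e (f n))" for x
    by (auto simp: scons_def fun_eq_iff split: nat.splits)
  show ?case by (simp add: Forall.IH *)
qed auto

lemma sat_inst1 [simp]: "sat W E e (inst1 d i p) = sat W E (e i ## (\<lambda>k. e (k + d))) p"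
proof -
  have "(\<lambda>n. e (case_nat i (\<lambda>k. k + d) n)) = e i ## (\<lambda>k. e (k + d))"
    by (auto simp: scons_def fun_eq_iff split: nat.splits)
  then show ?thesis by (simp add: inst1_def sat_ren)
qed

lemma sat_inst2 [simp]:
  "sat W E e (inst2 d i j p) = sat W E (e i ## e j ## (\<lambda>k. e (k + d))) p"
proof -
  have "(\<lambda>n. e (case_nat i (case_nat j (\<lambda>k. k + d)) n)) = e i ## e j ## (\<lambda>k. e (k + d))"
    by (auto simp: scons_def fun_eq_iff split: nat.splits)
  then show ?thesis by (simp add: inst2_def sat_ren)
qed

lemma soundness:
  "\<Gamma> \<turnstile> p \<Longrightarrow> e \<in> envs W \<Longrightarrow> (\<And>q. q \<in> \<Gamma> \<Longrightarrow> sat W E e q) \<Longrightarrow> sat W E e p"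
proof (induction arbitrary: e rule: proves.induct)
  case (AllI \<Gamma> p)
  have "sat W E (x ## e) p" if "x \<in> W" for x
    using AllI.prems that by (intro AllI.IH) (auto simp: sat_ren)
  then show ?case by simp
next
  case (ImpI p \<Gamma> q)
  show ?case
  proof (simp, intro impI)
    assume "sat W E e p"
    then have "sat W E e r" if "r \<in> insert p \<Gamma>" for r using that ImpI.prems(2) by blast
    then show "sat W E e q" using ImpI.IH[OF ImpI.prems(1)] by blast
  qed
next
  case (Classical p \<Gamma>)
  show ?case
  proof (rule ccontr)
    assume "\<not> sat W E e p"
    then have "sat W E e \<^bold>\<bottom>" by (intro Classical.IH) (auto simp: Classical.prems)
    then show False by simp
  qed
next
  case (EqE \<Gamma> i j p)
  have "sat W E e (i \<^bold>= j)" by (rule EqE.IH(1)[OF EqE.prems])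
  moreover have "sat W E e (inst1 0 i p)" by (rule EqE.IH(2)[OF EqE.prems])
  ultimately show ?case by simp
next
  case (AllE \<Gamma> p i)
  have "sat W E e (\<^bold>\<forall> p)" by (rule AllE.IH[OF AllE.prems])
  then show ?case using AllE.prems(1) by (simp add: envsD)
next
  case (ImpE \<Gamma> p q)
  have "sat W E e (p \<^bold>\<longrightarrow> q)" by (rule ImpE.IH(1)[OF ImpE.prems])
  moreover have "sat W E e p" by (rule ImpE.IH(2)[OF ImpE.prems])
  ultimately show ?case by simp
next
  case (Assm p \<Gamma>)
  show ?case by (rule Assm.prems(2)[OF Assm.hyps])
next
  case (EqI \<Gamma> i)
  show ?case by simp
qed

text \<open>Serves twice: for \<open>H\<close> inside the class structure (\<open>set_fm\<close>),
  and for \<open>S\<close> inside the hierarchy (\<open>hf_fm\<close>).\<close>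

lemma sat_relativize:
  assumes "V \<subseteq> W" and "\<And>e i. e \<in> envs W \<Longrightarrow> sat W E e (G i) \<longleftrightarrow> e i \<in> V"
  shows "e \<in> envs V \<Longrightarrow> sat W E e (relativize G p) = sat V E e p"
proof (induction p arbitrary: e)
  case (Forall p)
  have e: "e \<in> envs W" using Forall.prems assms(1) by (rule envs_mono)
  have "sat W E (x ## e) (G 0) \<longleftrightarrow> x \<in> V" if "x \<in> W" for x
    using assms(2)[of "x ## e" 0] that e by simp
  moreover have "sat W E (x ## e) (relativize G p) = sat V E (x ## e) p" if "x \<in> V" for x
    using Forall.IH[of "x ## e"] Forall.prems that by simp
  ultimately show ?case using assms(1) by (simp, blast)
qed simp_all

lemma fv_relativize: "fv (G 0) \<subseteq> {0} \<Longrightarrow> fv (relativize G p) \<subseteq> fv p"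
  by (induction p) (auto simp: all_in_def)

lemma finite_fv [simp]: "finite (fv p)"
proof (induction p)
  case (Forall p)
  have "fv (\<^bold>\<forall> p) \<subseteq> (\<lambda>i. i - 1) ` fv p" by force
  then show ?case using Forall finite_surj by blast
qed auto

lemma fv_bounded: "\<exists>n. fv p \<subseteq> {..<n}"
  using finite_nat_set_iff_bounded[of "fv p"] by auto

text \<open>The innermost quantifier of the prefix binds index 0, so peeling it off removes
  \<open>f 0\<close> and shifts the remaining values; hence the induction generalizes over
  \<open>f\<close>.\<close>

lemma sat_all_in_iter:
  assumes "\<And>e i. e \<in> envs W \<Longrightarrow> sat W E e (G i) \<longleftrightarrow> e i \<in> V"
  shows "sat W E e ((all_in G ^^ n) p) \<Longrightarrow> e \<in> envs W \<Longrightarrow> f \<in> envs W \<Longrightarrow> (\<And>i. i < n \<Longrightarrow> f i \<in> V) \<Longrightarrow>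
    sat W E (\<lambda>i. if i < n then f i else e (i - n)) p"
proof (induction n arbitrary: p f)
  case (Suc n)
  let ?e = "\<lambda>i. if i < n then f (Suc i) else e (i - n)"
  have "sat W E ?e (all_in G p)"
    using Suc.IH[of "all_in G p" "\<lambda>i. f (Suc i)"] Suc.prems
    by (simp add: funpow_swap1 envs_shift[of f W Suc])
  moreover have "?e \<in> envs W" using Suc.prems by (auto simp: envs_def)
  ultimately have "sat W E (f 0 ## ?e) p"
    using Suc.prems assms[of "f 0 ## ?e" 0] by (auto simp: envsD)
  moreover have "f 0 ## ?e = (\<lambda>i. if i < Suc n then f i else e (i - Suc n))"
    by (auto simp: scons_def fun_eq_iff split: nat.splits)
  ultimately show ?case by simp
qed simp

text \<open>A closure holds at the single assignment \<open>e\<close>, yet yields the matrix at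
  every assignment \<open>f\<close> into \<open>V\<close>: choose a prefix long enough to bind all
  free variables, instantiate it with \<open>f\<close>, and note that values beyond the prefix do
  not matter.\<close>

lemma sat_closures_inD:
  assumes "\<And>q. q \<in> closures_in G p \<Longrightarrow> sat W E e q" "e \<in> envs W" "f \<in> envs V" "V \<subseteq> W"
    and "\<And>e i. e \<in> envs W \<Longrightarrow> sat W E e (G i) \<longleftrightarrow> e i \<in> V"
  shows "sat W E f p"
proof -
  obtain n where n: "fv p \<subseteq> {..<n}" using fv_bounded by blast
  have "sat W E e ((all_in G ^^ n) p)"
    using assms(1) n by (auto simp: closures_in_def)
  then have "sat W E (\<lambda>i. if i < n then f i else e (i - n)) p"
    using assms by (intro sat_all_in_iter[of W E G V]) (auto intro: envs_mono simp: envsD)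
  moreover have "sat W E (\<lambda>i. if i < n then f i else e (i - n)) p = sat W E f p"
    using n by (intro sat_cong) auto
  ultimately show ?thesis by simp
qed

text \<open>Unrestricted closures are treated as closures restricted to the class of all
  \<open>x\<close> with \<open>x = x\<close>, so that both kinds of axiom schema use the same
  instantiation lemma.\<close>

lemma Forall_iter: "sat W E e ((Forall ^^ n) p) = sat W E e ((all_in (\<lambda>i. i \<^bold>= i) ^^ n) p)"
  by (induction n arbitrary: e) auto

lemma sat_closuresD:
  assumes "\<And>q. q \<in> closures p \<Longrightarrow> sat W E e q" "e \<in> envs W" "f \<in> envs W"
  shows "sat W E f p"
proof (rule sat_closures_inD[of "\<lambda>i. i \<^bold>= i" p W E e])
  show "sat W E e q" if q: "q \<in> closures_in (\<lambda>i. i \<^bold>= i) p" for q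
  proof -
    obtain n where "q = (all_in (\<lambda>i. i \<^bold>= i) ^^ n) p" "fv p \<subseteq> {..<n}"
      using q unfolding closures_in_def by blast
    moreover from this have "(Forall ^^ n) p \<in> closures p" by (auto simp: closures_def)
    ultimately show ?thesis using assms(1) Forall_iter by metis
  qed
qed (use assms in \<open>auto simp: envsD\<close>)

lemma sat_closuresI:
  assumes "\<And>f. f \<in> envs W \<Longrightarrow> sat W E f p" "e \<in> envs W" "q \<in> closures p"
  shows "sat W E e q"
proof -
  have "sat W E e ((Forall ^^ n) p)" for n
    using assms(2) by (induction n arbitrary: e) (use assms(1) in auto)
  then show ?thesis using assms(3) by (auto simp: closures_def)
qed


section \<open>Completeness\<close>

lemma ren_cong: "\<forall>i\<in>fv p. f i = g i \<Longrightarrow> ren f p = ren g p"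
proof (induction p arbitrary: f g)
  case (Forall p)
  have "ren (case_nat 0 (\<lambda>k. Suc (f k))) p = ren (case_nat 0 (\<lambda>k. Suc (g k))) p"
    using Forall.prems by (intro Forall.IH) (auto split: nat.splits)
  then show ?case by simp
qed auto

lemma ren_ren: "ren f (ren g p) = ren (\<lambda>n. f (g n)) p"
proof (induction p arbitrary: f g)
  case (Forall p)
  have *: "(\<lambda>n. case_nat 0 (\<lambda>k. Suc (f k)) (case_nat 0 (\<lambda>k. Suc (g k)) n))
      = case_nat 0 (\<lambda>k. Suc (f (g k)))"
    by (auto simp: fun_eq_iff split: nat.splits)
  show ?case by (simp add: Forall.IH *)
qed auto

lemma ren_id: "ren (\<lambda>n. n) p = p"
proof (induction p)
  case (Forall p)
  have "case_nat 0 Suc = (\<lambda>n. n)" by (auto simp: fun_eq_iff split: nat.splits)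
  then show ?case using Forall by simp
qed auto

lemma fv_ren: "fv (ren f p) = f ` fv p"
proof (induction p arbitrary: f)
  case (Forall p)
  show ?case (is "?L = ?R")
  proof
    show "?L \<subseteq> ?R" by (auto simp: Forall.IH split: nat.splits)
    show "?R \<subseteq> ?L"
    proof
      fix i assume "i \<in> ?R"
      then obtain m where "i = f m" "Suc m \<in> fv p" by auto
      then have "Suc i \<in> case_nat 0 (\<lambda>k. Suc (f k)) ` fv p" by (intro image_eqI[of _ _ "Suc m"]) auto
      then show "i \<in> ?L" by (simp add: Forall.IH)
    qed
  qed
qed auto

lemma ren_Neg [simp]: "ren f (\<^bold>\<not> p) = \<^bold>\<not> (ren f p)"
  by (simp add: Neg_def)

lemma ren_inst1: "ren f (inst1 0 i p) = inst1 0 (f i) (ren (case_nat 0 (\<lambda>k. Suc (f k))) p)"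
  unfolding inst1_def ren_ren by (intro ren_cong) (auto split: nat.splits)

lemma inst1_lift: "inst1 0 k (ren (case_nat 0 (\<lambda>k. Suc (f k))) p) = ren (k ## f) p"
  unfolding inst1_def ren_ren scons_def by (intro ren_cong) (auto split: nat.splits)

section \<open>Structural properties of derivations\<close>

lemma proves_mono: "\<Gamma> \<turnstile> p \<Longrightarrow> \<Gamma> \<subseteq> \<Delta> \<Longrightarrow> \<Delta> \<turnstile> p"
proof (induction arbitrary: \<Delta> rule: proves.induct)
  case (ImpI p \<Gamma> q) then show ?case by (meson insert_mono proves.ImpI)
next
  case (Classical p \<Gamma>) then show ?case by (meson insert_mono proves.Classical)
next
  case (AllI \<Gamma> p) then show ?case by (meson image_mono proves.AllI)
next
  case (ImpE \<Gamma> p q) then show ?case by (meson proves.ImpE)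
next
  case (EqE \<Gamma> i j p) then show ?case by (meson proves.EqE)
qed (auto intro: proves.Assm proves.AllE proves.EqI)

lemma proves_finite: "\<Gamma> \<turnstile> p \<Longrightarrow> \<exists>\<Delta>. finite \<Delta> \<and> \<Delta> \<subseteq> \<Gamma> \<and> \<Delta> \<turnstile> p"
proof (induction rule: proves.induct)
  case (Assm p \<Gamma>) then show ?case by (intro exI[of _ "{p}"]) (auto intro: proves.Assm)
next
  case (ImpI p \<Gamma> q)
  then obtain \<Delta> where D: "finite \<Delta>" "\<Delta> \<subseteq> insert p \<Gamma>" "\<Delta> \<turnstile> q" by blast
  have "insert p (\<Delta> - {p}) \<turnstile> q" by (rule proves_mono[OF D(3)]) auto
  then have "\<Delta> - {p} \<turnstile> p \<^bold>\<longrightarrow> q" by (rule proves.ImpI)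
  then show ?case using D by (intro exI[of _ "\<Delta> - {p}"]) auto
next
  case (ImpE \<Gamma> p q)
  then obtain \<Delta> \<Delta>' where D: "finite \<Delta>" "\<Delta> \<subseteq> \<Gamma>" "\<Delta> \<turnstile> p \<^bold>\<longrightarrow> q" "finite \<Delta>'" "\<Delta>' \<subseteq> \<Gamma>" "\<Delta>' \<turnstile> p"
    by blast
  have "\<Delta> \<union> \<Delta>' \<turnstile> q"
    by (rule proves.ImpE[OF proves_mono[OF D(3)] proves_mono[OF D(6)]]) auto
  then show ?case using D by (intro exI[of _ "\<Delta> \<union> \<Delta>'"]) auto
next
  case (Classical p \<Gamma>)
  then obtain \<Delta> where D: "finite \<Delta>" "\<Delta> \<subseteq> insert (\<^bold>\<not> p) \<Gamma>" "\<Delta> \<turnstile> \<^bold>\<bottom>" by blast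
  have "insert (\<^bold>\<not> p) (\<Delta> - {\<^bold>\<not> p}) \<turnstile> \<^bold>\<bottom>" by (rule proves_mono[OF D(3)]) auto
  then have "\<Delta> - {\<^bold>\<not> p} \<turnstile> p" by (rule proves.Classical)
  then show ?case using D by (intro exI[of _ "\<Delta> - {\<^bold>\<not> p}"]) auto
next
  case (AllI \<Gamma> p)
  then obtain \<Delta> where "finite \<Delta>" "\<Delta> \<subseteq> ren Suc ` \<Gamma>" "\<Delta> \<turnstile> p" by blast
  then show ?case by (metis finite_subset_image proves.AllI)
next
  case (AllE \<Gamma> p i) then show ?case by (meson proves.AllE)
next
  case (EqI \<Gamma> i) then show ?case by (meson empty_subsetI finite.emptyI proves.EqI)
next
  case (EqE \<Gamma> i j p)
  then obtain \<Delta> \<Delta>' where D: "finite \<Delta>" "\<Delta> \<subseteq> \<Gamma>" "\<Delta> \<turnstile> i \<^bold>= j" "finite \<Delta>'" "\<Delta>' \<subseteq> \<Gamma>" "\<Delta>' \<turnstile> inst1 0 i p"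
    by blast
  have "\<Delta> \<union> \<Delta>' \<turnstile> inst1 0 j p"
    by (rule proves.EqE[OF proves_mono[OF D(3)] proves_mono[OF D(6)]]) auto
  then show ?case using D by (intro exI[of _ "\<Delta> \<union> \<Delta>'"]) auto
qed

lemma proves_ren: "\<Gamma> \<turnstile> p \<Longrightarrow> ren f ` \<Gamma> \<turnstile> ren f p"
proof (induction arbitrary: f rule: proves.induct)
  case (ImpI p \<Gamma> q) then show ?case by (simp add: proves.ImpI)
next
  case (ImpE \<Gamma> p q) then show ?case by (metis proves.ImpE ren.simps(4))
next
  case (Classical p \<Gamma>)
  then show ?case by (metis image_insert proves.Classical ren.simps(1) ren_Neg)
next
  case (AllI \<Gamma> p)
  have "ren (case_nat 0 (\<lambda>k. Suc (f k))) ` ren Suc ` \<Gamma> = ren Suc ` ren f ` \<Gamma>"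
    by (auto simp: image_image ren_ren)
  then show ?case using AllI.IH[of "case_nat 0 (\<lambda>k. Suc (f k))"] by (simp add: proves.AllI)
next
  case (AllE \<Gamma> p i) then show ?case by (simp add: ren_inst1 proves.AllE)
next
  case (EqI \<Gamma> i) then show ?case by (simp add: proves.EqI)
next
  case (EqE \<Gamma> i j p)
  then show ?case by (metis proves.EqE ren.simps(3) ren_inst1)
qed (auto intro: proves.Assm)

text \<open>The rule \<open>AllI\<close> shifts the hypotheses instead of asking for a fresh
  variable. Renaming the given derivation by \<open>?f\<close>, which sends \<open>k\<close> to 0
  and every other index up by one, acts on the hypotheses as the shift and turns the instance at
  \<open>k\<close> back into \<open>q\<close>.\<close>

lemma proves_AllI_fresh:
  assumes "\<Gamma> \<turnstile> inst1 0 k q" "k \<notin> \<Union> (fv ` \<Gamma>)" "k \<notin> fv (\<^bold>\<forall> q)"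
  shows "\<Gamma> \<turnstile> \<^bold>\<forall> q"
proof (rule proves.AllI)
  let ?f = "\<lambda>n. if n = k then 0 else Suc n"
  have "ren ?f ` \<Gamma> \<turnstile> ren ?f (inst1 0 k q)" using assms(1) by (rule proves_ren)
  moreover have "ren ?f p = ren Suc p" if "p \<in> \<Gamma>" for p
    using assms(2) that by (intro ren_cong) auto
  moreover have "ren ?f (inst1 0 k q) = ren (\<lambda>n. n) q"
    unfolding inst1_def ren_ren using assms(3) by (intro ren_cong) (auto split: nat.splits)
  ultimately show "ren Suc ` \<Gamma> \<turnstile> q" by (simp add: ren_id cong: image_cong)
qed

section \<open>Maximal consistent sets with witnesses\<close>

definition consistent :: "fm set \<Rightarrow> bool"
  where "consistent \<Gamma> \<longleftrightarrow> \<not> \<Gamma> \<turnstile> \<^bold>\<bottom>"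

lemma proves_cut: "\<Gamma> \<turnstile> p \<Longrightarrow> insert p \<Gamma> \<turnstile> q \<Longrightarrow> \<Gamma> \<turnstile> q"
  by (meson proves.ImpE proves.ImpI)

lemma proves_ex_falso: "\<Gamma> \<turnstile> \<^bold>\<bottom> \<Longrightarrow> \<Gamma> \<turnstile> p"
  by (meson proves.Classical proves_mono subset_insertI)

lemma proves_NegE: "\<Gamma> \<turnstile> \<^bold>\<not> p \<Longrightarrow> \<Gamma> \<turnstile> p \<Longrightarrow> \<Gamma> \<turnstile> \<^bold>\<bottom>"
  unfolding Neg_def by (rule proves.ImpE)

lemma proves_NegI: "insert p \<Gamma> \<turnstile> \<^bold>\<bottom> \<Longrightarrow> \<Gamma> \<turnstile> \<^bold>\<not> p"
  unfolding Neg_def by (rule proves.ImpI)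

lemma consistent_witness:
  assumes "consistent \<Gamma>" "\<^bold>\<not> (\<^bold>\<forall> q) \<in> \<Gamma>" "k \<notin> \<Union> (fv ` \<Gamma>)"
  shows "consistent (insert (\<^bold>\<not> (inst1 0 k q)) \<Gamma>)"
proof (rule ccontr)
  assume "\<not> ?thesis"
  then have "\<Gamma> \<turnstile> inst1 0 k q" unfolding consistent_def by (simp add: proves.Classical)
  moreover have "k \<notin> fv (\<^bold>\<forall> q)" using assms(2,3) by (force simp: Neg_def)
  ultimately have "\<Gamma> \<turnstile> \<^bold>\<forall> q" using assms(3) by (intro proves_AllI_fresh)
  then show False
    using assms(1,2) proves_NegE proves.Assm unfolding consistent_def by blast
qed

instance fm :: countable by countable_datatype

definition add_witness :: "fm \<Rightarrow> fm set \<Rightarrow> fm set"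
  where "add_witness p \<Gamma> =
    (if \<exists>q. p = \<^bold>\<not> (\<^bold>\<forall> q)
     then insert (\<^bold>\<not> (inst1 0 (SOME k. k \<notin> \<Union> (fv ` \<Gamma>)) (THE q. p = \<^bold>\<not> (\<^bold>\<forall> q)))) \<Gamma> else \<Gamma>)"

primrec henkin :: "fm set \<Rightarrow> nat \<Rightarrow> fm set" where
  "henkin \<Gamma> 0 = \<Gamma>"
| "henkin \<Gamma> (Suc n) = (if consistent (insert (from_nat n) (henkin \<Gamma> n))
     then add_witness (from_nat n) (insert (from_nat n) (henkin \<Gamma> n)) else henkin \<Gamma> n)"

text \<open>The language has no constants, so variables act as Henkin witnesses. Each stage adds
  finitely many formulas, and this invariant guarantees a variable that is still fresh.\<close>

definition coinfinite_fv :: "fm set \<Rightarrow> bool"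
  where "coinfinite_fv \<Gamma> \<longleftrightarrow> infinite (- \<Union> (fv ` \<Gamma>))"

lemma coinfinite_insert: "coinfinite_fv \<Gamma> \<Longrightarrow> coinfinite_fv (insert p \<Gamma>)"
proof -
  have "- \<Union> (fv ` insert p \<Gamma>) = (- \<Union> (fv ` \<Gamma>)) - fv p" by auto
  then show "coinfinite_fv \<Gamma> \<Longrightarrow> coinfinite_fv (insert p \<Gamma>)"
    unfolding coinfinite_fv_def by (simp only:) (simp add: Diff_infinite_finite)
qed

lemma fresh_some: "coinfinite_fv \<Gamma> \<Longrightarrow> (SOME k. k \<notin> \<Union> (fv ` \<Gamma>)) \<notin> \<Union> (fv ` \<Gamma>)"
  by (rule someI_ex) (metis ComplD coinfinite_fv_def finite.emptyI ex_in_conv)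

lemma henkin_invariant:
  assumes "consistent \<Gamma>" "coinfinite_fv \<Gamma>"
  shows "consistent (henkin \<Gamma> n) \<and> coinfinite_fv (henkin \<Gamma> n)"
proof (induction n)
  case (Suc n)
  let ?D = "insert (from_nat n) (henkin \<Gamma> n)"
  have co: "coinfinite_fv ?D" using Suc by (simp add: coinfinite_insert)
  show ?case
  proof (cases "consistent ?D \<and> (\<exists>q. (from_nat n :: fm) = \<^bold>\<not> (\<^bold>\<forall> q))")
    case True
    then obtain q where q: "(from_nat n :: fm) = \<^bold>\<not> (\<^bold>\<forall> q)" by blast
    let ?k = "SOME k. k \<notin> \<Union> (fv ` ?D)"
    have "consistent (insert (\<^bold>\<not> (inst1 0 ?k q)) ?D)"
      using True q fresh_some[OF co] by (intro consistent_witness) auto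
    moreover have "henkin \<Gamma> (Suc n) = insert (\<^bold>\<not> (inst1 0 ?k q)) ?D"
      using True q by (simp add: add_witness_def Neg_def)
    ultimately show ?thesis using coinfinite_insert[OF co] by simp
  qed (use Suc co in \<open>auto simp: add_witness_def\<close>)
qed (use assms in auto)

lemma henkin_Suc: "henkin \<Gamma> n \<subseteq> henkin \<Gamma> (Suc n)"
  by (auto simp: add_witness_def)

lemma henkin_mono: "m \<le> n \<Longrightarrow> henkin \<Gamma> m \<subseteq> henkin \<Gamma> n"
  using henkin_Suc by (rule lift_Suc_mono_le)

lemma henkin_limit:
  assumes "consistent \<Gamma>" "coinfinite_fv \<Gamma>"
  defines "\<Delta> \<equiv> (\<Union>n. henkin \<Gamma> n)"
  shows "consistent \<Delta>" "p \<in> \<Delta> \<or> \<^bold>\<not> p \<in> \<Delta>"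
    and "\<^bold>\<not> (\<^bold>\<forall> q) \<in> \<Delta> \<Longrightarrow> \<exists>k. \<^bold>\<not> (inst1 0 k q) \<in> \<Delta>"
proof -
  note inv = henkin_invariant[OF assms(1,2)]
  show cons: "consistent \<Delta>"
  proof (rule ccontr)
    assume "\<not> consistent \<Delta>"
    then obtain D where D: "finite D" "D \<subseteq> \<Delta>" "D \<turnstile> \<^bold>\<bottom>"
      unfolding consistent_def using proves_finite by blast
    have "\<exists>n. D \<subseteq> henkin \<Gamma> n" using D(1,2)
    proof (induction)
      case (insert x F)
      then obtain m n where "F \<subseteq> henkin \<Gamma> m" "x \<in> henkin \<Gamma> n" by (auto simp: \<Delta>_def)
      then have "insert x F \<subseteq> henkin \<Gamma> (max m n)"
        using henkin_mono[of m "max m n" \<Gamma>] henkin_mono[of n "max m n" \<Gamma>] by auto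
      then show ?case by blast
    qed auto
    then show False using inv D(3) proves_mono unfolding consistent_def by blast
  qed
  have sub: "henkin \<Gamma> n \<subseteq> \<Delta>" for n by (auto simp: \<Delta>_def)
  \<comment> \<open>A formula is considered at the stage given by its own number. If it is
    consistent with the limit, it is consistent with that stage and is added there.\<close>
  have in_step: "p \<in> henkin \<Gamma> (Suc (to_nat p))" if "consistent (insert p \<Delta>)" for p
  proof -
    have "consistent (insert p (henkin \<Gamma> (to_nat p)))"
      using that sub[of "to_nat p"] unfolding consistent_def by (meson insert_mono proves_mono)
    then show ?thesis by (auto simp: add_witness_def)
  qed
  show "p \<in> \<Delta> \<or> \<^bold>\<not> p \<in> \<Delta>"
  proof (cases "consistent (insert p \<Delta>)")
    case True
    then show ?thesis using in_step sub by blast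
  next
    case False
    then have "\<Delta> \<turnstile> \<^bold>\<not> p" by (simp add: consistent_def proves_NegI)
    then have "consistent (insert (\<^bold>\<not> p) \<Delta>)"
      using cons proves_cut unfolding consistent_def by blast
    then show ?thesis using in_step sub by blast
  qed
  show "\<exists>k. \<^bold>\<not> (inst1 0 k q) \<in> \<Delta>" if p: "\<^bold>\<not> (\<^bold>\<forall> q) \<in> \<Delta>"
  proof -
    let ?p = "\<^bold>\<not> (\<^bold>\<forall> q)"
    let ?n = "to_nat ?p"
    have "insert ?p (henkin \<Gamma> ?n) \<subseteq> \<Delta>" using p sub by auto
    then have "consistent (insert ?p (henkin \<Gamma> ?n))"
      using cons unfolding consistent_def by (meson proves_mono)
    then have "\<exists>k. \<^bold>\<not> (inst1 0 k q) \<in> henkin \<Gamma> (Suc ?n)"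
      by (auto simp: add_witness_def Neg_def)
    then show ?thesis using sub by blast
  qed
qed

text \<open>The elements are classes of variables provably equal in \<open>\<Delta>\<close>, which
  is why the universe has type \<open>nat set set\<close>. Membership is defined on these classes
  only, so it holds between elements of \<open>W\<close> alone, as the models of THS considered
  later require.\<close>

lemma henkin_model:
  fixes \<Delta> :: "fm set"
  assumes cons: "consistent \<Delta>" and max: "\<And>p. p \<in> \<Delta> \<or> \<^bold>\<not> p \<in> \<Delta>"
    and wit: "\<And>q. \<^bold>\<not> (\<^bold>\<forall> q) \<in> \<Delta> \<Longrightarrow> \<exists>k. \<^bold>\<not> (inst1 0 k q) \<in> \<Delta>"
  obtains W :: "nat set set" and E e where
    "e \<in> envs W" "\<And>x y. E x y \<Longrightarrow> x \<in> W \<and> y \<in> W" "\<And>p. sat W E e p \<longleftrightarrow> p \<in> \<Delta>"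
proof -
  have ded: "p \<in> \<Delta>" if "\<Delta> \<turnstile> p" for p
    using that max[of p] cons proves_NegE proves.Assm unfolding consistent_def by blast
  have neg: "\<^bold>\<not> p \<in> \<Delta> \<longleftrightarrow> p \<notin> \<Delta>" for p
    using max[of p] cons proves_NegE proves.Assm unfolding consistent_def by blast
  have subst: "inst1 0 j p \<in> \<Delta>" if "i \<^bold>= j \<in> \<Delta>" "inst1 0 i p \<in> \<Delta>" for i j p
    using that by (intro ded) (meson proves.Assm proves.EqE)
  have refl: "i \<^bold>= i \<in> \<Delta>" for i by (intro ded proves.EqI)
  have sym: "j \<^bold>= i \<in> \<Delta>" if "i \<^bold>= j \<in> \<Delta>" for i j
    using subst[OF that, of "0 \<^bold>= Suc i"] refl by (simp add: inst1_def)
  have trans: "i \<^bold>= k \<in> \<Delta>" if "i \<^bold>= j \<in> \<Delta>" "j \<^bold>= k \<in> \<Delta>" for i j k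
    using subst[OF that(2), of "Suc i \<^bold>= 0"] that(1) by (simp add: inst1_def)
  have mem_cong: "i' \<^bold>\<in> j' \<in> \<Delta>" if "i \<^bold>\<in> j \<in> \<Delta>" "i \<^bold>= i' \<in> \<Delta>" "j \<^bold>= j' \<in> \<Delta>" for i j i' j'
    using subst[OF that(2), of "0 \<^bold>\<in> Suc j"] subst[OF that(3), of "Suc i' \<^bold>\<in> 0"] that(1)
    by (simp add: inst1_def)
  define c where "c i = {j. i \<^bold>= j \<in> \<Delta>}" for i
  have c_eq: "c i = c j \<longleftrightarrow> i \<^bold>= j \<in> \<Delta>" for i j
    unfolding c_def using refl sym trans by blast
  define E where "E x y \<longleftrightarrow> (\<exists>i j. x = c i \<and> y = c j \<and> i \<^bold>\<in> j \<in> \<Delta>)" for x y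
  have E_c: "E (c i) (c j) \<longleftrightarrow> i \<^bold>\<in> j \<in> \<Delta>" for i j
    unfolding E_def using c_eq mem_cong sym by metis
  \<comment> \<open>Stated for all renamings \<open>f\<close>: under a quantifier the assignment
    becomes that of \<open>k ## f\<close>, since every element of the universe is the class of some
    variable \<open>k\<close>.\<close>
  have truth: "sat (range c) E (\<lambda>i. c (f i)) p \<longleftrightarrow> ren f p \<in> \<Delta>" for f p
  proof (induction p arbitrary: f)
    case Falsum
    then show ?case using cons proves.Assm unfolding consistent_def by auto
  next
    case (Imp p q)
    have "ren f p \<^bold>\<longrightarrow> ren f q \<in> \<Delta> \<longleftrightarrow> (ren f p \<in> \<Delta> \<longrightarrow> ren f q \<in> \<Delta>)"
    proof
      assume "ren f p \<^bold>\<longrightarrow> ren f q \<in> \<Delta>"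
      then show "ren f p \<in> \<Delta> \<longrightarrow> ren f q \<in> \<Delta>" using ded proves.Assm proves.ImpE by blast
    next
      assume *: "ren f p \<in> \<Delta> \<longrightarrow> ren f q \<in> \<Delta>"
      show "ren f p \<^bold>\<longrightarrow> ren f q \<in> \<Delta>"
      proof (intro ded proves.ImpI)
        show "insert (ren f p) \<Delta> \<turnstile> ren f q"
        proof (cases "ren f q \<in> \<Delta>")
          case False
          then have "\<^bold>\<not> (ren f p) \<in> \<Delta>" using * neg by blast
          then show ?thesis
            by (meson insertCI proves.Assm proves_NegE proves_ex_falso)
        qed (simp add: proves.Assm)
      qed
    qed
    then show ?case using Imp by simp
  next
    case (Forall p)
    have "sat (range c) E (\<lambda>i. c (f i)) (\<^bold>\<forall> p) \<longleftrightarrow> (\<forall>k. sat (range c) E (\<lambda>i. c ((k ## f) i)) p)"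
    proof -
      have "c k ## (\<lambda>i. c (f i)) = (\<lambda>i. c ((k ## f) i))" for k
        by (auto simp: scons_def fun_eq_iff split: nat.splits)
      then show ?thesis by simp
    qed
    also have "\<dots> \<longleftrightarrow> (\<forall>k. inst1 0 k (ren (case_nat 0 (\<lambda>k. Suc (f k))) p) \<in> \<Delta>)"
      by (simp add: Forall.IH inst1_lift)
    also have "\<dots> \<longleftrightarrow> ren f (\<^bold>\<forall> p) \<in> \<Delta>"
    proof
      assume "\<forall>k. inst1 0 k (ren (case_nat 0 (\<lambda>k. Suc (f k))) p) \<in> \<Delta>"
      then show "ren f (\<^bold>\<forall> p) \<in> \<Delta>" using wit neg by (metis ren.simps(5))
    next
      assume "ren f (\<^bold>\<forall> p) \<in> \<Delta>"
      then show "\<forall>k. inst1 0 k (ren (case_nat 0 (\<lambda>k. Suc (f k))) p) \<in> \<Delta>"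
        by (metis ded proves.AllE proves.Assm ren.simps(5))
    qed
    finally show ?case .
  qed (auto simp: E_c c_eq)
  show thesis
  proof (rule that[of c "range c" E])
    show "c \<in> envs (range c)" by (simp add: envs_def)
    show "x \<in> range c \<and> y \<in> range c" if "E x y" for x y using that by (auto simp: E_def)
    show "sat (range c) E c p \<longleftrightarrow> p \<in> \<Delta>" for p using truth[of "\<lambda>i. i" p] by (simp add: ren_id)
  qed
qed

theorem completeness:
  fixes \<Gamma> :: "fm set"
  assumes valid: "\<And>(W :: nat set set) E e. e \<in> envs W \<Longrightarrow> (\<And>x y. E x y \<Longrightarrow> x \<in> W \<and> y \<in> W) \<Longrightarrow>
    (\<And>q. q \<in> \<Gamma> \<Longrightarrow> sat W E e q) \<Longrightarrow> sat W E e p"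
  shows "\<Gamma> \<turnstile> p"
proof (rule ccontr)
  assume not: "\<not> \<Gamma> \<turnstile> p"
  txt \<open>Doubling the variables makes the odd ones available as witnesses.\<close>
  let ?d = "\<lambda>n::nat. 2 * n" and ?h = "\<lambda>n::nat. n div 2"
  let ?G = "insert (\<^bold>\<not> (ren ?d p)) (ren ?d ` \<Gamma>)"
  have undouble: "ren ?h (ren ?d q) = q" for q by (simp add: ren_ren ren_id)
  have "consistent ?G"
  proof (rule ccontr)
    assume "\<not> consistent ?G"
    then have "ren ?d ` \<Gamma> \<turnstile> ren ?d p" by (simp add: consistent_def proves.Classical)
    from proves_ren[OF this, of ?h] show False using not by (simp add: undouble image_image)
  qed
  moreover have "coinfinite_fv (ren ?d ` \<Gamma>)"
  proof -
    have "range (\<lambda>n. Suc (2 * n)) \<subseteq> - \<Union> (fv ` ren ?d ` \<Gamma>)"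
      by (auto simp: fv_ren) presburger
    moreover have "infinite (range (\<lambda>n::nat. Suc (2 * n)))"
      by (simp add: finite_image_iff inj_on_def)
    ultimately show ?thesis unfolding coinfinite_fv_def using finite_subset by blast
  qed
  then have "coinfinite_fv ?G" by (rule coinfinite_insert)
  ultimately have G: "consistent ?G" "coinfinite_fv ?G" by blast+
  have lim: "consistent (\<Union>n. henkin ?G n)"
    "\<And>p. p \<in> (\<Union>n. henkin ?G n) \<or> \<^bold>\<not> p \<in> (\<Union>n. henkin ?G n)"
    "\<And>q. \<^bold>\<not> (\<^bold>\<forall> q) \<in> (\<Union>n. henkin ?G n) \<Longrightarrow> \<exists>k. \<^bold>\<not> (inst1 0 k q) \<in> (\<Union>n. henkin ?G n)"
    by (fact henkin_limit[OF G])+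
  obtain W :: "nat set set" and E e where M:
    "e \<in> envs W" "\<And>x y. E x y \<Longrightarrow> x \<in> W \<and> y \<in> W"
    "\<And>p. sat W E e p \<longleftrightarrow> p \<in> (\<Union>n. henkin ?G n)"
    using henkin_model[OF lim] by metis
  have sub: "?G \<subseteq> (\<Union>n. henkin ?G n)" by (metis UNIV_I UN_upper henkin.simps(1))
  have "sat W E (\<lambda>n. e (2 * n)) q" if "q \<in> \<Gamma>" for q
    using M(3)[of "ren ?d q"] sub that by (auto simp: sat_ren)
  then have "sat W E (\<lambda>n. e (2 * n)) p"
    using M(1,2) by (intro valid) (auto simp: envs_def)
  moreover have "\<not> sat W E (\<lambda>n. e (2 * n)) p"
    using M(3)[of "\<^bold>\<not> (ren ?d p)"] sub by (auto simp: sat_ren)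
  ultimately show False by simp
qed


section \<open>Definability\<close>

text \<open>Interleaving gives parameters and variables infinitely many slots each, so definitions
  can be combined without bounding the number of parameters.\<close>

definition mix :: "(nat \<Rightarrow> 'a) \<Rightarrow> (nat \<Rightarrow> 'a) \<Rightarrow> nat \<Rightarrow> 'a"
  where "mix c e n = (if even n then c (n div 2) else e (n div 2))"

lemma mix_simps [simp]: "mix c e (2 * n) = c n" "mix c e (Suc (2 * n)) = e n"
  by (auto simp: mix_def)

lemma mix_envs: "c \<in> envs W \<Longrightarrow> e \<in> envs W \<Longrightarrow> mix c e \<in> envs W"
  by (auto simp: envs_def mix_def)

definition trm :: "'a set \<Rightarrow> ((nat \<Rightarrow> 'a) \<Rightarrow> 'a) \<Rightarrow> bool"
  where "trm C s \<longleftrightarrow> (\<exists>i. s = (\<lambda>e. e i)) \<or> (\<exists>a\<in>C. s = (\<lambda>e. a))"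

lemma trm_var: "trm C (\<lambda>e. e i)"
  by (auto simp: trm_def)

lemma trm_const: "a \<in> C \<Longrightarrow> trm C (\<lambda>e. a)"
  by (auto simp: trm_def)

lemma trm_shift: "trm C s \<Longrightarrow> trm C (\<lambda>e. s (\<lambda>n. e (Suc n)))"
  unfolding trm_def by auto

lemma trm_in: "trm C s \<Longrightarrow> C \<subseteq> W \<Longrightarrow> e \<in> envs W \<Longrightarrow> s e \<in> W"
  by (auto simp: trm_def envsD)

locale membership =
  fixes E :: "'a \<Rightarrow> 'a \<Rightarrow> bool"
begin

definition ext :: "'a \<Rightarrow> 'a set"
  where "ext y = {x. E x y}"

text \<open>\<open>dfn W C P\<close>: the predicate \<open>P\<close> on assignments is defined over the structure \<open>(W, E)\<close> by a
  formula with parameters from \<open>C\<close>; in \<open>mix c e\<close> the parameters occupy the even indices.\<close>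

definition dfn :: "'a set \<Rightarrow> 'a set \<Rightarrow> ((nat \<Rightarrow> 'a) \<Rightarrow> bool) \<Rightarrow> bool"
  where "dfn W C P \<longleftrightarrow> (\<exists>p. \<exists>c\<in>envs C. \<forall>e\<in>envs W. P e \<longleftrightarrow> sat W E (mix c e) p)"

definition dset :: "'a set \<Rightarrow> 'a set \<Rightarrow> 'a set \<Rightarrow> bool"
  where "dset W C A \<longleftrightarrow> A \<subseteq> W \<and> dfn W C (\<lambda>e. e 0 \<in> A)"

lemma dfn_cong: "dfn W C Q \<Longrightarrow> (\<And>e. e \<in> envs W \<Longrightarrow> P e \<longleftrightarrow> Q e) \<Longrightarrow> dfn W C P"
  unfolding dfn_def by blast

text \<open>Substituting constants enlarges the parameter list, while substituting variables only
  renames indices. Both are done at once by one new parameter assignment and one renaming.\<close>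

lemma dfn_sub:
  assumes "dfn W C P" "\<And>i. trm C (\<sigma> i)" "C \<subseteq> W"
  shows "dfn W C (\<lambda>e. P (\<lambda>i. \<sigma> i e))"
proof -
  obtain p c where p: "c \<in> envs C" "\<And>e. e \<in> envs W \<Longrightarrow> P e \<longleftrightarrow> sat W E (mix c e) p"
    using assms(1) unfolding dfn_def by blast
  have "\<forall>i. \<exists>v. (fst v \<and> \<sigma> i = (\<lambda>e. e (fst (snd v)))) \<or>
      (\<not> fst v \<and> snd (snd v) \<in> C \<and> \<sigma> i = (\<lambda>e. snd (snd v)))"
  proof
    fix i
    show "\<exists>v. (fst v \<and> \<sigma> i = (\<lambda>e. e (fst (snd v)))) \<or>
      (\<not> fst v \<and> snd (snd v) \<in> C \<and> \<sigma> i = (\<lambda>e. snd (snd v)))"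
      using assms(2)[of i] unfolding trm_def
    proof
      assume "\<exists>j. \<sigma> i = (\<lambda>e. e j)"
      then obtain j where "\<sigma> i = (\<lambda>e. e j)" by blast
      then show ?thesis by (intro exI[of _ "(True, j, undefined)"]) simp
    next
      assume "\<exists>a\<in>C. \<sigma> i = (\<lambda>e. a)"
      then obtain a where "a \<in> C" "\<sigma> i = (\<lambda>e. a)" by blast
      then show ?thesis by (intro exI[of _ "(False, 0, a)"]) simp
    qed
  qed
  then obtain v where v: "\<And>i. (fst (v i) \<and> \<sigma> i = (\<lambda>e. e (fst (snd (v i))))) \<or>
      (\<not> fst (v i) \<and> snd (snd (v i)) \<in> C \<and> \<sigma> i = (\<lambda>e. snd (snd (v i))))"
    by metis
  \<comment> \<open>\<open>d\<close> keeps the old parameters at even places and puts the constant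
    substituted for variable \<open>k\<close> at place \<open>2 * k + 1\<close>; the value
    \<open>c 0\<close> fills the places of variables that are replaced by variables. Place
    \<open>n\<close> of \<open>d\<close> is index \<open>2 * n\<close> of \<open>mix d e\<close>,
    which explains \<open>g\<close>.\<close>
  define d where "d = mix c (\<lambda>k. if fst (v k) then c 0 else snd (snd (v k)))"
  define g where "g n = (if even n then 2 * n else
    (if fst (v (n div 2)) then Suc (2 * fst (snd (v (n div 2)))) else 2 * n))" for n
  have d: "d \<in> envs C" unfolding d_def using p(1) v by (intro mix_envs) (auto simp: envs_def)
  have "(\<lambda>n. mix d e (g n)) = mix c (\<lambda>i. \<sigma> i e)" if "e \<in> envs W" for e
  proof
    fix n
    show "mix d e (g n) = mix c (\<lambda>i. \<sigma> i e) n"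
    proof (cases "even n")
      case True
      then show ?thesis by (simp add: g_def d_def) (simp add: mix_def)
    next
      case False
      then obtain k where k: "n = Suc (2 * k)" by (auto elim: oddE)
      show ?thesis
      proof (cases "fst (v k)")
        case True
        then have "\<sigma> k e = e (fst (snd (v k)))" using v[of k] by metis
        then show ?thesis using True by (simp add: g_def k)
      next
        case False
        then have "\<sigma> k e = snd (snd (v k))" using v[of k] by metis
        moreover have "mix d e (2 * n) = d n" by simp
        ultimately show ?thesis using False by (simp add: g_def k d_def)
      qed
    qed
  qed
  moreover have "(\<lambda>i. \<sigma> i e) \<in> envs W" if "e \<in> envs W" for e
    unfolding envs_def using trm_in[OF assms(2,3) that] by simp
  ultimately have "P (\<lambda>i. \<sigma> i e) \<longleftrightarrow> sat W E (mix d e) (ren g p)" if "e \<in> envs W" for e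
    using p(2) that by (simp add: sat_ren)
  then show ?thesis unfolding dfn_def using d by blast
qed

lemma dfn_sub1:
  "dfn W C (\<lambda>e. R (e 0)) \<Longrightarrow> C \<subseteq> W \<Longrightarrow> trm C s \<Longrightarrow> dfn W C (\<lambda>e. R (s e))"
  using dfn_sub[of W C "\<lambda>e. R (e 0)" "\<lambda>_. s"] by simp

lemma dfn_sub2:
  "dfn W C (\<lambda>e. R (e 0) (e (Suc 0))) \<Longrightarrow> C \<subseteq> W \<Longrightarrow> trm C s \<Longrightarrow> trm C t \<Longrightarrow>
    dfn W C (\<lambda>e. R (s e) (t e))"
  using dfn_sub[of W C "\<lambda>e. R (e 0) (e (Suc 0))" "case_nat s (\<lambda>_. t)"] by (simp split: nat.splits)

lemma dfn_sub3:
  "dfn W C (\<lambda>e. R (e 0) (e (Suc 0)) (e (Suc (Suc 0)))) \<Longrightarrow> C \<subseteq> W \<Longrightarrow>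
    trm C s \<Longrightarrow> trm C t \<Longrightarrow> trm C u \<Longrightarrow> dfn W C (\<lambda>e. R (s e) (t e) (u e))"
  using dfn_sub[of W C "\<lambda>e. R (e 0) (e (Suc 0)) (e (Suc (Suc 0)))"
      "case_nat s (case_nat t (\<lambda>_. u))"] by (simp split: nat.splits)

lemma dfn_imp:
  assumes "dfn W C P" "dfn W C Q"
  shows "dfn W C (\<lambda>e. P e \<longrightarrow> Q e)"
proof -
  obtain p c where p: "c \<in> envs C" "\<And>e. e \<in> envs W \<Longrightarrow> P e \<longleftrightarrow> sat W E (mix c e) p"
    using assms(1) unfolding dfn_def by blast
  obtain q d where q: "d \<in> envs C" "\<And>e. e \<in> envs W \<Longrightarrow> Q e \<longleftrightarrow> sat W E (mix d e) q"
    using assms(2) unfolding dfn_def by blast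
  \<comment> \<open>In \<open>mix c d\<close> parameter \<open>k\<close> of \<open>P\<close> stands
    at place \<open>2 * k\<close> and parameter \<open>k\<close> of \<open>Q\<close> at
    \<open>2 * k + 1\<close>. The index \<open>n = 2 * k\<close> thus moves to \<open>2 * n\<close>
    or to \<open>2 * Suc n\<close>; the odd indices, being variables, stay.\<close>
  let ?f = "\<lambda>n. if even n then 2 * n else n"
  let ?g = "\<lambda>n. if even n then 2 * Suc n else n"
  have "(\<lambda>n. mix (mix c d) e (?f n)) = mix c e" for e
    by (auto simp: fun_eq_iff) (auto simp: mix_def)
  moreover have "(\<lambda>n. mix (mix c d) e (?g n)) = mix d e" for e
    by (auto simp: fun_eq_iff simp del: mult_Suc_right) (auto simp: mix_def)
  ultimately have "(P e \<longrightarrow> Q e) \<longleftrightarrow> sat W E (mix (mix c d) e) (ren ?f p \<^bold>\<longrightarrow> ren ?g q)"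
    if "e \<in> envs W" for e
    using p(2) q(2) that by (simp add: sat_ren)
  then show ?thesis unfolding dfn_def using mix_envs[OF p(1) q(1)] by blast
qed

lemma dfn_False: "a \<in> C \<Longrightarrow> dfn W C (\<lambda>e. False)"
  unfolding dfn_def by (intro exI[of _ "\<^bold>\<bottom>"] bexI[of _ "\<lambda>_. a"]) (auto simp: envs_def)

lemma dfn_nonempty: "dfn W C P \<Longrightarrow> \<exists>a. a \<in> C"
  by (auto simp: dfn_def envs_def)

lemma dfn_not:
  assumes "dfn W C P"
  shows "dfn W C (\<lambda>e. \<not> P e)"
proof -
  obtain a where "a \<in> C" using dfn_nonempty[OF assms] by blast
  then have "dfn W C (\<lambda>e. P e \<longrightarrow> False)" by (intro dfn_imp assms dfn_False)
  then show ?thesis by simp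
qed

lemma dfn_disj: "dfn W C P \<Longrightarrow> dfn W C Q \<Longrightarrow> dfn W C (\<lambda>e. P e \<or> Q e)"
  using dfn_imp[OF dfn_not, of W C P Q] by (simp add: disj_imp)

lemma dfn_conj: "dfn W C P \<Longrightarrow> dfn W C Q \<Longrightarrow> dfn W C (\<lambda>e. P e \<and> Q e)"
  using dfn_not[OF dfn_imp[OF _ dfn_not], of W C P Q] by simp

lemma dfn_iff: "dfn W C P \<Longrightarrow> dfn W C Q \<Longrightarrow> dfn W C (\<lambda>e. P e \<longleftrightarrow> Q e)"
  unfolding iff_conv_conj_imp by (intro dfn_conj dfn_imp)

lemma dfn_all:
  assumes "dfn W C (\<lambda>e. Q (e 0) (\<lambda>n. e (Suc n)))"
  shows "dfn W C (\<lambda>e. \<forall>x\<in>W. Q x e)"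
proof -
  obtain p c where p: "c \<in> envs C"
    "\<And>e. e \<in> envs W \<Longrightarrow> Q (e 0) (\<lambda>n. e (Suc n)) \<longleftrightarrow> sat W E (mix c e) p"
    using assms(1) unfolding dfn_def by blast
  \<comment> \<open>The bound value sits at index 0 of \<open>x ## mix c e\<close> but is variable
    0, hence index 1, of \<open>mix c (x ## e)\<close>. Parameters move up by one; the other
    variables change by \<open>- 2 + 1\<close>.\<close>
  let ?g = "\<lambda>n. if even n then Suc n else if n = 1 then 0 else n - 1"
  have *: "(\<lambda>n. (x ## mix c e) (?g n)) = mix c (x ## e)" for x e
  proof
    fix n
    show "(x ## mix c e) (?g n) = mix c (x ## e) n"
    proof (cases "even n")
      case True
      then show ?thesis by (simp add: mix_def)
    next
      case False
      then obtain k where "n = Suc (2 * k)" by (auto elim: oddE)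
      then show ?thesis by (cases k) (auto simp: mix_def)
    qed
  qed
  have "(\<forall>x\<in>W. Q x e) \<longleftrightarrow> sat W E (mix c e) (\<^bold>\<forall> (ren ?g p))" if "e \<in> envs W" for e
    using p(2)[of "x ## e" for x] that by (simp add: sat_ren *)
  then show ?thesis unfolding dfn_def using p(1) by blast
qed

lemma dfn_in:
  assumes "C \<subseteq> W" "trm C s" "trm C t" "C \<noteq> {}"
  shows "dfn W C (\<lambda>e. s e \<in> ext (t e))"
proof (rule dfn_sub2[of W C "\<lambda>x y. x \<in> ext y"])
  show "dfn W C (\<lambda>e. e 0 \<in> ext (e (Suc 0)))"
    using assms(4) unfolding dfn_def ext_def
    by (intro exI[of _ "1 \<^bold>\<in> 3"] bexI[of _ "\<lambda>_. SOME a. a \<in> C"])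
      (auto simp: envs_def mix_def some_in_eq)
qed fact+

lemma dfn_eq:
  assumes "C \<subseteq> W" "trm C s" "trm C t" "C \<noteq> {}"
  shows "dfn W C (\<lambda>e. s e = t e)"
proof (rule dfn_sub2[of W C "\<lambda>x y. x = y"])
  show "dfn W C (\<lambda>e. e 0 = e (Suc 0))"
    using assms(4) unfolding dfn_def
    by (intro exI[of _ "1 \<^bold>= 3"] bexI[of _ "\<lambda>_. SOME a. a \<in> C"])
      (auto simp: envs_def mix_def some_in_eq)
qed fact+

lemma dset_mem: "dset W C A \<Longrightarrow> C \<subseteq> W \<Longrightarrow> trm C s \<Longrightarrow> dfn W C (\<lambda>e. s e \<in> A)"
  using dfn_sub1[of W C "\<lambda>x. x \<in> A" s] by (simp add: dset_def)

lemma dfn_ball: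
  assumes "dset W C A" "dfn W C (\<lambda>e. Q (e 0) (\<lambda>n. e (Suc n)))"
  shows "dfn W C (\<lambda>e. \<forall>x\<in>A. Q x e)"
proof -
  have "dfn W C (\<lambda>e. \<forall>x\<in>W. x \<in> A \<longrightarrow> Q x e)"
  proof (rule dfn_all, rule dfn_imp)
    show "dfn W C (\<lambda>e. e 0 \<in> A)" using assms(1) by (simp add: dset_def)
  qed (rule assms(2))
  moreover have "(\<forall>x\<in>A. Q x e) \<longleftrightarrow> (\<forall>x\<in>W. x \<in> A \<longrightarrow> Q x e)" for e
    using assms(1) unfolding dset_def by blast
  ultimately show ?thesis by simp
qed

lemma dfn_bex:
  assumes "dset W C A" "dfn W C (\<lambda>e. Q (e 0) (\<lambda>n. e (Suc n)))"
  shows "dfn W C (\<lambda>e. \<exists>x\<in>A. Q x e)"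
  using dfn_not[OF dfn_ball[OF assms(1) dfn_not[OF assms(2)]]] by simp

text \<open>Satisfied by \<open>H\<close> and by \<open>U\<close>. Quantifiers over
  \<open>ext y\<close> are then quantifiers of the structure, even when the extension itself is not
  one of its parameters.\<close>

definition lw :: "'a set \<Rightarrow> bool"
  where "lw W \<longleftrightarrow> (\<forall>y. ext y \<subseteq> W)"

lemma dfn_ball_ext:
  assumes "C \<subseteq> W" "trm C t" "C \<noteq> {}" "lw W" "dfn W C (\<lambda>e. Q (e 0) (\<lambda>n. e (Suc n)))"
  shows "dfn W C (\<lambda>e. \<forall>x\<in>ext (t e). Q x e)"
proof -
  have "dfn W C (\<lambda>e. \<forall>x\<in>W. x \<in> ext (t e) \<longrightarrow> Q x e)"
  proof (rule dfn_all, rule dfn_imp)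
    have "trm C (\<lambda>e. t (\<lambda>n. e (Suc n)))" by (rule trm_shift[OF assms(2)])
    then show "dfn W C (\<lambda>e. e 0 \<in> ext (t (\<lambda>n. e (Suc n))))"
      by (intro dfn_in assms(1,3) trm_var)
  qed (rule assms(5))
  moreover have "(\<forall>x\<in>ext (t e). Q x e) \<longleftrightarrow> (\<forall>x\<in>W. x \<in> ext (t e) \<longrightarrow> Q x e)" for e
    using assms(4) unfolding lw_def by blast
  ultimately show ?thesis by simp
qed

lemma dfn_bex_ext:
  assumes "C \<subseteq> W" "trm C t" "C \<noteq> {}" "lw W" "dfn W C (\<lambda>e. Q (e 0) (\<lambda>n. e (Suc n)))"
  shows "dfn W C (\<lambda>e. \<exists>x\<in>ext (t e). Q x e)"
  using dfn_not[OF dfn_ball_ext[OF assms(1-4) dfn_not[OF assms(5)]]] by simp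

lemma dset_UNIV: "C \<noteq> {} \<Longrightarrow> C \<subseteq> W \<Longrightarrow> dset W C W"
proof -
  assume "C \<noteq> {}" "C \<subseteq> W"
  then have "dfn W C (\<lambda>e. e 0 = e 0)" by (intro dfn_eq trm_var)
  then show ?thesis unfolding dset_def by (auto simp: envsD intro: dfn_cong)
qed

text \<open>Satisfaction of one fixed formula in a definable substructure is definable in the large
  structure, by induction on the formula. Separation in the hierarchy and inductions over statements
  about it depend on this.\<close>

lemma dfn_sat:
  assumes "dset V V W"
  shows "(\<And>i. trm V (s i)) \<Longrightarrow> dfn V V (\<lambda>e. sat W E (\<lambda>i. s i e) p)"
proof (induction p arbitrary: s)
  have ne: "V \<noteq> {}" using assms dfn_nonempty unfolding dset_def by blast
  {
    case Falsum
    then show ?case using dfn_False ne by auto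
  next
    case (Mem i j)
    then have "dfn V V (\<lambda>e. s i e \<in> ext (s j e))" using ne by (intro dfn_in) auto
    then show ?case by (simp add: ext_def)
  next
    case (Eql i j)
    then have "dfn V V (\<lambda>e. s i e = s j e)" using ne by (intro dfn_eq) auto
    then show ?case by simp
  next
    case (Imp p q)
    then show ?case by (simp add: dfn_imp)
  next
    case (Forall p)
    let ?s = "case_nat (\<lambda>e. e 0) (\<lambda>i e. s i (\<lambda>n. e (Suc n)))"
    have "trm V (?s i)" for i
      by (cases i) (simp_all add: trm_var trm_shift[OF Forall.prems])
    then have "dfn V V (\<lambda>e. sat W E (\<lambda>i. ?s i e) p)" by (rule Forall.IH)
    moreover have "(\<lambda>i. ?s i e) = e 0 ## (\<lambda>i. s i (\<lambda>n. e (Suc n)))" for e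
      by (auto simp: scons_def fun_eq_iff split: nat.splits)
    ultimately have "dfn V V (\<lambda>e. \<forall>x\<in>W. sat W E (x ## (\<lambda>i. s i e)) p)"
      by (intro dfn_ball assms) simp
    then show ?case by simp
  }
qed

text \<open>A relation between sets given by a set formula can thereby be used in class
  comprehension, once its arguments are restricted to \<open>W\<close>.\<close>

lemma dfn_lift2:
  assumes "dset V V W" "C \<subseteq> W" "dfn W C (\<lambda>e. R (e 0) (e (Suc 0)))"
  shows "dfn V V (\<lambda>e. e 0 \<in> W \<and> e (Suc 0) \<in> W \<and> R (e 0) (e (Suc 0)))"
proof -
  have W: "W \<subseteq> V" using assms(1) by (simp add: dset_def)
  obtain p c where p: "c \<in> envs C" "\<And>e. e \<in> envs W \<Longrightarrow> R (e 0) (e (Suc 0)) \<longleftrightarrow> sat W E (mix c e) p"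
    using assms(3) unfolding dfn_def by blast
  let ?v = "\<lambda>e k. if k = 0 then e 0 else e (Suc 0)"
  let ?s = "\<lambda>i e. mix c (?v e) i"
  have "trm V (?s i)" for i
  proof -
    have "c k \<in> V" for k using p(1) assms(2) W by (auto simp: envs_def)
    then show ?thesis
      by (cases "even i"; cases "i div 2 = 0") (simp_all add: mix_def trm_var trm_const)
  qed
  then have "dfn V V (\<lambda>e. sat W E (mix c (?v e)) p)" by (rule dfn_sat[OF assms(1)])
  then have "dfn V V (\<lambda>e. e 0 \<in> W \<and> e (Suc 0) \<in> W \<and> sat W E (mix c (?v e)) p)"
    by (intro dfn_conj dset_mem assms(1) trm_var) auto
  then show ?thesis
  proof (rule dfn_cong)
    fix e :: "nat \<Rightarrow> 'a"
    have "sat W E (mix c (?v e)) p \<longleftrightarrow> R (e 0) (e (Suc 0))" if "e 0 \<in> W" "e (Suc 0) \<in> W"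
      using p(2)[of "?v e"] that by (simp add: envs_def)
    then show "(e 0 \<in> W \<and> e (Suc 0) \<in> W \<and> R (e 0) (e (Suc 0))) =
      (e 0 \<in> W \<and> e (Suc 0) \<in> W \<and> sat W E (mix c (?v e)) p)" by blast
  qed
qed

lemma dset_ext: "lw W \<Longrightarrow> C \<subseteq> W \<Longrightarrow> a \<in> C \<Longrightarrow> dset W C (ext a)"
  unfolding dset_def by (auto simp: lw_def intro!: dfn_in trm_var trm_const)

lemmas dfn_basic = dfn_in dfn_eq dfn_not dfn_conj dfn_disj dfn_imp dfn_iff dfn_ball dfn_bex
  dfn_ball_ext dfn_bex_ext dset_mem trm_var trm_const

lemma dfn_subset:
  assumes "C \<subseteq> W" "trm C s" "trm C t" "C \<noteq> {}" "lw W"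
  shows "dfn W C (\<lambda>e. ext (s e) \<subseteq> ext (t e))"
proof (rule dfn_sub2[of W C "\<lambda>x y. ext x \<subseteq> ext y"])
  show "dfn W C (\<lambda>e. ext (e 0) \<subseteq> ext (e (Suc 0)))"
    unfolding subset_iff Ball_def[symmetric] using assms by (intro dfn_basic) auto
qed fact+

lemma dfn_empty:
  assumes "C \<subseteq> W" "trm C s" "C \<noteq> {}" "lw W"
  shows "dfn W C (\<lambda>e. ext (s e) = {})"
proof (rule dfn_sub1[of W C "\<lambda>x. ext x = {}"])
  have "dfn W C (\<lambda>e. \<forall>z\<in>ext (e 0). z \<noteq> z)" using assms by (intro dfn_basic) auto
  then show "dfn W C (\<lambda>e. ext (e 0) = {})" by (rule dfn_cong) auto
qed fact+

lemma dfn_insert: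
  assumes "C \<subseteq> W" "trm C s" "trm C t" "trm C u" "C \<noteq> {}" "lw W"
  shows "dfn W C (\<lambda>e. ext (s e) = insert (t e) (ext (u e)))"
proof (rule dfn_sub3[of W C "\<lambda>x y z. ext x = insert y (ext z)"])
  have "dfn W C (\<lambda>e. \<forall>z\<in>W. z \<in> ext (e 0) \<longleftrightarrow> z = e (Suc 0) \<or> z \<in> ext (e (Suc (Suc 0))))"
    using assms dset_UNIV by (intro dfn_basic) auto
  then show "dfn W C (\<lambda>e. ext (e 0) = insert (e (Suc 0)) (ext (e (Suc (Suc 0)))))"
    by (rule dfn_cong) (use assms(6) in \<open>auto simp: lw_def envsD\<close>)
qed fact+

lemma dfn_pair:
  assumes "C \<subseteq> W" "trm C s" "trm C t" "trm C u" "C \<noteq> {}" "lw W"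
  shows "dfn W C (\<lambda>e. ext (s e) = {t e, u e})"
proof (rule dfn_sub3[of W C "\<lambda>x y z. ext x = {y, z}"])
  have "dfn W C (\<lambda>e. \<forall>z\<in>W. z \<in> ext (e 0) \<longleftrightarrow> z = e (Suc 0) \<or> z = e (Suc (Suc 0)))"
    using assms dset_UNIV by (intro dfn_basic) auto
  then show "dfn W C (\<lambda>e. ext (e 0) = {e (Suc 0), e (Suc (Suc 0))})"
    by (rule dfn_cong) (use assms(6) in \<open>auto simp: lw_def envsD\<close>)
qed fact+

lemma dfn_single:
  assumes "C \<subseteq> W" "trm C s" "trm C t" "C \<noteq> {}" "lw W"
  shows "dfn W C (\<lambda>e. ext (s e) = {t e})"
  using dfn_pair[OF assms(1,2,3,3,4,5)] by simp

lemmas dfn_intros0 = dfn_subset dfn_empty dfn_insert dfn_pair dfn_single dfn_basic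

definition H :: "'a set"
  where "H = {x. \<exists>y. E x y}"

lemma ext_H: "x \<in> ext y \<Longrightarrow> x \<in> H"
  by (auto simp: ext_def H_def)

lemma lw_H [simp]: "lw H"
  by (auto simp: lw_def ext_H)

text \<open>The Kuratowski pair as a relation with quantifiers bounded by \<open>ext g\<close>: it
  makes sense for arbitrary classes and is definable over \<open>H\<close> and over
  \<open>U\<close>.\<close>

definition pr :: "'a \<Rightarrow> 'a \<Rightarrow> 'a \<Rightarrow> bool"
  where "pr g x y \<longleftrightarrow> (\<exists>a\<in>ext g. \<exists>b\<in>ext g. ext a = {x} \<and> ext b = {x, y} \<and> ext g = {a, b})"

lemma dfn_pr:
  assumes "C \<subseteq> W" "trm C s" "trm C t" "trm C u" "C \<noteq> {}" "lw W"
  shows "dfn W C (\<lambda>e. pr (s e) (t e) (u e))"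
proof (rule dfn_sub3[of W C pr])
  show "dfn W C (\<lambda>e. pr (e 0) (e (Suc 0)) (e (Suc (Suc 0))))"
    unfolding pr_def using assms by (intro dfn_intros0) auto
qed fact+

lemmas dfn_intros = dfn_pr dfn_intros0

end


section \<open>Models of THS\<close>

context membership
begin

definition isset :: "'a set \<Rightarrow> bool"
  where "isset A \<longleftrightarrow> (\<exists>x\<in>H. ext x = A)"

definition inductive_cls :: "'a set \<Rightarrow> bool"
  where "inductive_cls A \<longleftrightarrow> (\<exists>e\<in>A. ext e = {}) \<and> (\<forall>m\<in>A. \<exists>s\<in>A. ext s = insert m (ext m))"

definition adjoin_cls :: "'a set \<Rightarrow> bool"
  where "adjoin_cls A \<longleftrightarrow> (\<exists>e\<in>A. ext e = {}) \<and>
    (\<forall>a\<in>A. \<forall>b\<in>A. \<exists>c\<in>A. ext c = insert b (ext a))"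

end

locale classes = membership E for E :: "'a \<Rightarrow> 'a \<Rightarrow> bool" +
  fixes U :: "'a set"
begin

definition isclass :: "'a set \<Rightarrow> bool"
  where "isclass A \<longleftrightarrow> (\<exists>X\<in>U. ext X = A)"

definition small :: "'a set \<Rightarrow> bool"
  where "small A \<longleftrightarrow> (\<forall>B\<subseteq>A. isclass B \<longrightarrow> isset B)"

definition thin :: "'a set \<Rightarrow> bool"
  where "thin A \<longleftrightarrow> isclass A \<and> (\<forall>B\<subseteq>A. isset B \<longrightarrow> small B)"

definition SN :: "'a set"
  where "SN = {x\<in>H. \<forall>X\<in>U. inductive_cls (ext X) \<longrightarrow> x \<in> ext X}"

definition S :: "'a set"
  where "S = {x\<in>H. \<forall>X\<in>U. adjoin_cls (ext X) \<longrightarrow> x \<in> ext X}"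

definition dom_cls :: "'a set \<Rightarrow> 'a set"
  where "dom_cls R = {x\<in>H. \<exists>y\<in>H. \<exists>g\<in>R. pr g x y}"

definition section_cls :: "'a set \<Rightarrow> 'a \<Rightarrow> 'a set"
  where "section_cls R n = {y\<in>H. \<exists>g\<in>R. pr g n y}"

end

locale class_structure = classes E U for E :: "'a \<Rightarrow> 'a \<Rightarrow> bool" and U +
  assumes E_U: "E x y \<Longrightarrow> x \<in> U \<and> y \<in> U"
    and cls_ext: "X \<in> U \<Longrightarrow> Y \<in> U \<Longrightarrow> ext X = ext Y \<Longrightarrow> X = Y"
begin

lemma H_U [simp]: "H \<subseteq> U"
  using E_U by (auto simp: H_def)

lemma H_in_U [simp]: "x \<in> H \<Longrightarrow> x \<in> U"
  using H_U by blast

lemma isset_class_iff: "X \<in> U \<Longrightarrow> isset (ext X) \<longleftrightarrow> X \<in> H"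
  unfolding isset_def using cls_ext H_in_U by metis

lemma small_ext_iff: "small (ext x) \<longleftrightarrow> (\<forall>X\<in>U. ext X \<subseteq> ext x \<longrightarrow> X \<in> H)"
  unfolding small_def isclass_def using isset_class_iff by auto

end

lemma (in membership) dfn_formula1:
  assumes "dfn W C (\<lambda>e. P (e 0))"
  obtains q c where "c \<in> envs C" "\<And>x. x \<in> W \<Longrightarrow> P x \<longleftrightarrow> sat W E (x ## c) q"
proof -
  obtain p c where p: "c \<in> envs C" "\<And>e. e \<in> envs W \<Longrightarrow> P (e 0) \<longleftrightarrow> sat W E (mix c e) p"
    using assms unfolding dfn_def by blast
  let ?g = "\<lambda>n. if even n then Suc (n div 2) else 0"
  have "(\<lambda>n. (x ## c) (?g n)) = mix c (\<lambda>_. x)" for x by (auto simp: mix_def fun_eq_iff)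
  then have "P x \<longleftrightarrow> sat W E (x ## c) (ren ?g p)" if "x \<in> W" for x
    using p(2)[of "\<lambda>_. x"] that by (simp add: sat_ren envs_def)
  then show thesis using that p(1) by blast
qed

lemma (in membership) dfn_formula2:
  assumes "dfn W C (\<lambda>e. P (e 0) (e (Suc 0)))"
  obtains q c where "c \<in> envs C" "\<And>x y. x \<in> W \<Longrightarrow> y \<in> W \<Longrightarrow> P x y \<longleftrightarrow> sat W E (x ## y ## c) q"
proof -
  obtain p c where p: "c \<in> envs C"
    "\<And>e. e \<in> envs W \<Longrightarrow> P (e 0) (e (Suc 0)) \<longleftrightarrow> sat W E (mix c e) p"
    using assms unfolding dfn_def by blast
  let ?g = "\<lambda>n. if even n then Suc (Suc (n div 2)) else if n div 2 = 0 then 0 else Suc 0"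
  have "(\<lambda>n. (x ## y ## c) (?g n)) = mix c (\<lambda>k. if k = 0 then x else y)" for x y
    by (auto simp: mix_def fun_eq_iff)
  then have "P x y \<longleftrightarrow> sat W E (x ## y ## c) (ren ?g p)" if "x \<in> W" "y \<in> W" for x y
    using p(2)[of "\<lambda>k. if k = 0 then x else y"] that by (simp add: sat_ren envs_def)
  then show thesis using that p(1) by blast
qed

context class_structure
begin

section \<open>The defined formulas evaluated in a class structure\<close>

lemma pr_H: "pr g x y \<Longrightarrow> x \<in> H \<and> y \<in> H"
  unfolding pr_def using ext_H by blast

lemma ext_eq_iff: "A \<subseteq> U \<Longrightarrow> ext x = A \<longleftrightarrow> (\<forall>z\<in>U. E z x \<longleftrightarrow> z \<in> A)"
  using E_U by (auto simp: ext_def)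

lemma ext_subset_iff: "ext x \<subseteq> A \<longleftrightarrow> (\<forall>z\<in>U. E z x \<longrightarrow> z \<in> A)"
  using E_U by (auto simp: ext_def)

lemma ext_U: "ext x \<subseteq> U"
  using E_U by (auto simp: ext_def)

lemma E_ext: "E x y \<longleftrightarrow> x \<in> ext y"
  by (simp add: ext_def)

lemma bex_U_ext: "(\<exists>x\<in>U. x \<in> ext y \<and> Q x) \<longleftrightarrow> (\<exists>x\<in>ext y. Q x)"
  "(\<exists>x\<in>U. Q x \<and> x \<in> ext y) \<longleftrightarrow> (\<exists>x\<in>ext y. Q x)"
  using ext_U by blast+

lemma ball_U_ext: "(\<forall>x\<in>U. x \<in> ext y \<longrightarrow> Q x) \<longleftrightarrow> (\<forall>x\<in>ext y. Q x)"
  using ext_U by blast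

lemma sat_set_fm: "e \<in> envs U \<Longrightarrow> sat U E e (set_fm x) \<longleftrightarrow> e x \<in> H"
  unfolding set_fm_def H_def using E_U by auto

lemma sat_empty_fm: "sat U E e (empty_fm x) \<longleftrightarrow> ext (e x) = {}"
  unfolding empty_fm_def by (simp add: ext_eq_iff)

lemma sat_subset_fm: "sat U E e (subset_fm x y) \<longleftrightarrow> ext (e x) \<subseteq> ext (e y)"
  unfolding subset_fm_def by (simp add: ext_subset_iff E_ext)

lemma sat_adjoin_fm: "e \<in> envs U \<Longrightarrow> sat U E e (adjoin_fm z x y) \<longleftrightarrow> ext (e z) = insert (e y) (ext (e x))"
  unfolding adjoin_fm_def using ext_U[of "e x"] envsD[of e U y]
  by (subst ext_eq_iff) (auto simp: E_ext)

lemma sat_upair_fm: "e \<in> envs U \<Longrightarrow> sat U E e (upair_fm z x y) \<longleftrightarrow> ext (e z) = {e x, e y}"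
  unfolding upair_fm_def using envsD[of e U]
  by (subst ext_eq_iff) (auto simp: E_ext)

lemma sat_opair_fm: "e \<in> envs U \<Longrightarrow> sat U E e (opair_fm z x y) \<longleftrightarrow> pr (e z) (e x) (e y)"
proof -
  assume e: "e \<in> envs U"
  have "sat U E e (opair_fm z x y) \<longleftrightarrow>
      (\<exists>a\<in>U. \<exists>b\<in>U. ext a = {e x} \<and> ext b = {e x, e y} \<and> ext (e z) = {a, b})"
    unfolding opair_fm_def using e by (simp add: sat_upair_fm)
  then show ?thesis unfolding pr_def using ext_U[of "e z"] by blast
qed

lemma sat_opair_in_fm: "e \<in> envs U \<Longrightarrow>
  sat U E e (opair_in_fm x y r) \<longleftrightarrow> (\<exists>g\<in>ext (e r). pr g (e x) (e y))"
  unfolding opair_in_fm_def by (simp add: sat_opair_fm E_ext bex_U_ext)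

lemma sat_dom_fm: "e \<in> envs U \<Longrightarrow> sat U E e (dom_fm d r) \<longleftrightarrow> ext (e d) = dom_cls (ext (e r))"
proof -
  assume e: "e \<in> envs U"
  have "dom_cls (ext (e r)) \<subseteq> U" by (auto simp: dom_cls_def)
  then have "ext (e d) = dom_cls (ext (e r)) \<longleftrightarrow> (\<forall>x\<in>U. E x (e d) \<longleftrightarrow> x \<in> dom_cls (ext (e r)))"
    by (rule ext_eq_iff)
  moreover have "x \<in> dom_cls (ext (e r)) \<longleftrightarrow> (\<exists>y\<in>U. \<exists>g\<in>ext (e r). pr g x y)" for x
    unfolding dom_cls_def using pr_H H_in_U by blast
  moreover have "sat U E e (dom_fm d r) \<longleftrightarrow>
      (\<forall>x\<in>U. E x (e d) \<longleftrightarrow> (\<exists>y\<in>U. \<exists>g\<in>ext (e r). pr g x y))"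
    unfolding dom_fm_def using e by (simp add: sat_opair_in_fm)
  ultimately show ?thesis by simp
qed

lemma sat_inductive_fm: "e \<in> envs U \<Longrightarrow> sat U E e (inductive_fm x) \<longleftrightarrow> inductive_cls (ext (e x))"
  unfolding inductive_fm_def inductive_cls_def
  by (simp add: sat_empty_fm sat_adjoin_fm E_ext bex_U_ext ball_U_ext)

lemma sat_adjoin_closed_fm:
  "e \<in> envs U \<Longrightarrow> sat U E e (adjoin_closed_fm x) \<longleftrightarrow> adjoin_cls (ext (e x))"
  unfolding adjoin_closed_fm_def adjoin_cls_def
  by (simp add: sat_empty_fm sat_adjoin_fm E_ext bex_U_ext ball_U_ext)

lemma sat_small_fm: "e \<in> envs U \<Longrightarrow> sat U E e (small_fm x) \<longleftrightarrow> small (ext (e x))"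
  unfolding small_fm_def small_ext_iff by (simp add: sat_subset_fm sat_set_fm)

lemma sat_thin_fm: "e \<in> envs U \<Longrightarrow> sat U E e (thin_fm x) \<longleftrightarrow> thin (ext (e x))"
proof -
  assume e: "e \<in> envs U"
  have "sat U E e (thin_fm x) \<longleftrightarrow> (\<forall>B\<in>U. B \<in> H \<longrightarrow> ext B \<subseteq> ext (e x) \<longrightarrow> small (ext B))"
    unfolding thin_fm_def using e by (simp add: sat_subset_fm sat_set_fm sat_small_fm)
  also have "\<dots> \<longleftrightarrow> thin (ext (e x))"
    unfolding thin_def isclass_def isset_def using envsD[OF e] by auto
  finally show ?thesis .
qed

lemma sat_covers_fm: "e \<in> envs U \<Longrightarrow> sat U E e (covers_fm x u) \<longleftrightarrow> ext (e u) \<subseteq> \<Union> (ext ` ext (e x))"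
  unfolding covers_fm_def by (simp add: E_ext bex_U_ext ball_U_ext) blast

text \<open>An implication suffices in this form, since in (DC) the image formulas occur in the
  conclusion. Dually, \<open>SN_nat_fm\<close> goes the other way because \<open>nat_fm\<close>
  occurs there as a guard.\<close>

lemma sat_image_singleton_fm:
  assumes e: "e \<in> envs U" and sat: "sat U E e (image_singleton_fm b x n)"
  shows "ext (e b) = section_cls (ext (e x)) (e n)"
proof -
  have "\<exists>a\<in>U. ext a = {e n} \<and> (\<forall>z\<in>U. z \<in> ext (e b) \<longleftrightarrow> (\<exists>c\<in>ext a. \<exists>g\<in>ext (e x). pr g c z))"
    using sat e unfolding image_singleton_fm_def image_fm_def
    by (simp add: sat_upair_fm sat_opair_in_fm E_ext bex_U_ext)
  then have "z \<in> ext (e b) \<longleftrightarrow> (\<exists>g\<in>ext (e x). pr g (e n) z)" if "z \<in> U" for z using that by auto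
  then show ?thesis unfolding section_cls_def using ext_U ext_H pr_H H_in_U by blast
qed

lemma SN_nat_fm: "e \<in> envs U \<Longrightarrow> e n \<in> SN \<Longrightarrow> sat U E e (nat_fm n)"
  unfolding nat_fm_def SN_def by (simp add: sat_inductive_fm E_ext)

lemma sat_relativize_set: "e \<in> envs H \<Longrightarrow> sat U E e (relativize set_fm p) \<longleftrightarrow> sat H E e p"
  by (rule sat_relativize) (auto simp: sat_set_fm)

end

locale ths =
  fixes E :: "'a \<Rightarrow> 'a \<Rightarrow> bool" and U :: "'a set" and e0 :: "nat \<Rightarrow> 'a"
  assumes E_dom: "\<And>x y. E x y \<Longrightarrow> x \<in> U \<and> y \<in> U"
    and e0: "e0 \<in> envs U"
    and sat_THS: "\<And>q. q \<in> THS \<Longrightarrow> sat U E e0 q"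
begin

sublocale classes E U .

sublocale class_structure E U
proof
  show "x \<in> U \<and> y \<in> U" if "E x y" for x y using E_dom that .
  have H_U: "x \<in> H \<Longrightarrow> x \<in> U" for x using E_dom by (auto simp: H_def)
  have set: "sat U E e (set_fm x) \<longleftrightarrow> e x \<in> H" for e x
    unfolding set_fm_def H_def using E_dom by auto
  have "sat U E e0 THS_Ext" by (rule sat_THS) (simp add: THS_def)
  then have "\<forall>X\<in>U. \<forall>Y\<in>U. (\<forall>z\<in>U. z \<in> H \<longrightarrow> (E z X \<longleftrightarrow> E z Y)) \<longrightarrow> X = Y"
    unfolding THS_Ext_def by (simp add: set)
  then show "X = Y" if "X \<in> U" "Y \<in> U" "ext X = ext Y" for X Y
    using that unfolding ext_def by blast
qed

section \<open>The axioms of THS as statements about extensions and definable predicates\<close>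

lemma cls_comp:
  assumes "dfn U U (\<lambda>e. P (e 0))"
  shows "isclass {x\<in>H. P x}"
proof -
  obtain q c where q: "c \<in> envs U" "\<And>x. x \<in> U \<Longrightarrow> P x \<longleftrightarrow> sat U E (x ## c) q"
    using dfn_formula1[OF assms] by metis
  have "sat U E c (THS_Class q)"
    by (rule sat_closuresD[OF _ e0 q(1)], rule sat_THS) (auto simp: THS_def)
  then have "\<exists>Y\<in>U. \<forall>x\<in>U. x \<in> H \<longrightarrow> (x \<in> ext Y \<longleftrightarrow> sat U E (x ## c) q)"
    unfolding THS_Class_def using q(1) by (simp add: sat_set_fm E_ext)
  then obtain Y where "Y \<in> U" "\<forall>x\<in>U. x \<in> H \<longrightarrow> (x \<in> ext Y \<longleftrightarrow> P x)" using q(2) by auto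
  then have "ext Y = {x\<in>H. P x}" using ext_H H_in_U by blast
  then show ?thesis using \<open>Y \<in> U\<close> unfolding isclass_def by blast
qed

lemma empty_ax: "isset {}"
  and adjoin_ax: "x \<in> H \<Longrightarrow> y \<in> H \<Longrightarrow> isset (insert y (ext x))"
proof -
  have "sat U E e0 THS_Set_empty" by (rule sat_THS) (simp add: THS_def)
  then show "isset {}"
    unfolding THS_Set_empty_def isset_def using e0 by (auto simp: sat_set_fm sat_empty_fm)
  have "sat U E e0 THS_Set_adjoin" by (rule sat_THS) (simp add: THS_def)
  then have "\<forall>x\<in>U. x \<in> H \<longrightarrow> (\<forall>y\<in>U. y \<in> H \<longrightarrow> (\<exists>z\<in>U. z \<in> H \<and> ext z = insert y (ext x)))"
    unfolding THS_Set_adjoin_def using e0 by (simp add: sat_set_fm sat_adjoin_fm)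
  then show "x \<in> H \<Longrightarrow> y \<in> H \<Longrightarrow> isset (insert y (ext x))" unfolding isset_def using H_in_U by blast
qed

lemma S_H [simp]: "S \<subseteq> H"
  by (auto simp: S_def)

text \<open>\<open>standard_fm\<close> does not say that \<open>x\<close> is a set. This is
  automatic, as \<open>H\<close> is itself a class closed under adjunction.\<close>

lemma S_iff: "x \<in> U \<Longrightarrow> x \<in> S \<longleftrightarrow> (\<forall>X\<in>U. adjoin_cls (ext X) \<longrightarrow> x \<in> ext X)"
proof -
  assume "x \<in> U"
  have "U \<noteq> {}" using e0 by (auto simp: envs_def)
  then have "dfn U U (\<lambda>e. e 0 = e 0)" by (intro dfn_eq trm_var) auto
  then have "isclass H" using cls_comp[of "\<lambda>x. x = x"] by simp
  then obtain X where X: "X \<in> U" "ext X = H" unfolding isclass_def by blast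
  have "adjoin_cls H"
    unfolding adjoin_cls_def using empty_ax adjoin_ax unfolding isset_def by blast
  then show ?thesis unfolding S_def using X by auto
qed

lemma sat_standard_fm: "e \<in> envs U \<Longrightarrow> sat U E e (standard_fm x) \<longleftrightarrow> e x \<in> S"
  using S_iff[of "e x"] unfolding standard_fm_def
  by (simp add: sat_adjoin_closed_fm E_ext envsD)

lemma ind_ax:
  assumes "dfn H H (\<lambda>e. P (e 0))" and z: "\<And>x. x \<in> H \<Longrightarrow> ext x = {} \<Longrightarrow> P x"
    and s: "\<And>x y z. x \<in> H \<Longrightarrow> y \<in> H \<Longrightarrow> z \<in> H \<Longrightarrow> P x \<Longrightarrow> P y \<Longrightarrow> ext z = insert y (ext x) \<Longrightarrow> P z"
    and x: "x \<in> H"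
  shows "P x"
proof -
  obtain q c where q: "c \<in> envs H" "\<And>x. x \<in> H \<Longrightarrow> P x \<longleftrightarrow> sat H E (x ## c) q"
    using dfn_formula1[OF assms(1)] by metis
  have c: "c \<in> envs U" using q(1) H_U by (rule envs_mono)
  have Ind: "sat U E c (THS_Ind q)"
    by (rule sat_closures_inD[OF _ e0 q(1) H_U], rule sat_THS) (auto simp: THS_def sat_set_fm)
  have "sat U E c (THS_Ind q) \<longleftrightarrow> ((\<forall>x\<in>U. sat U E (x ## c) (set_fm 0) \<longrightarrow> sat U E (x ## c) (empty_fm 0) \<longrightarrow>
        sat U E (x ## c) (relativize set_fm q)) \<and>
      (\<forall>x\<in>U. sat U E (x ## c) (set_fm 0) \<longrightarrow> (\<forall>y\<in>U. sat U E (y ## x ## c) (set_fm 0) \<longrightarrow>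
        sat U E (x ## c) (relativize set_fm q) \<and> sat U E (y ## c) (relativize set_fm q) \<longrightarrow>
        (\<forall>z\<in>U. sat U E (z ## y ## x ## c) (set_fm 0) \<longrightarrow> sat U E (z ## y ## x ## c) (adjoin_fm 0 2 1) \<longrightarrow>
          sat U E (z ## c) (relativize set_fm q)))) \<longrightarrow>
      (\<forall>x\<in>U. sat U E (x ## c) (set_fm 0) \<longrightarrow> sat U E (x ## c) (relativize set_fm q)))"
    by (simp only: THS_Ind_def Let_def sat_inst1 sem_simps)
  note ind = iffD1[OF this Ind]
  have P: "sat U E (x ## c) (relativize set_fm q) \<longleftrightarrow> P x" if "x \<in> H" for x
    using sat_relativize_set[of "x ## c" q] q that by simp
  have "\<forall>x\<in>U. sat U E (x ## c) (set_fm 0) \<longrightarrow> sat U E (x ## c) (relativize set_fm q)"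
  proof (rule mp[OF ind], intro conjI ballI impI)
    fix x assume "x \<in> U" "sat U E (x ## c) (set_fm 0)" "sat U E (x ## c) (empty_fm 0)"
    then show "sat U E (x ## c) (relativize set_fm q)"
      using z[of x] P[of x] c by (simp add: sat_set_fm sat_empty_fm)
  next
    fix x y z
    assume "x \<in> U" "sat U E (x ## c) (set_fm 0)" "y \<in> U" "sat U E (y ## x ## c) (set_fm 0)"
      and P_xy: "sat U E (x ## c) (relativize set_fm q) \<and> sat U E (y ## c) (relativize set_fm q)"
      and "z \<in> U" "sat U E (z ## y ## x ## c) (set_fm 0)" "sat U E (z ## y ## x ## c) (adjoin_fm 0 2 1)"
    then have "x \<in> H" "y \<in> H" "z \<in> H" "ext z = insert y (ext x)"
      using c by (simp_all add: sat_set_fm sat_adjoin_fm)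
    then show "sat U E (z ## c) (relativize set_fm q)" using s[of x y z] P P_xy by blast
  qed
  then show ?thesis using x P[OF x] c by (simp add: sat_set_fm)
qed

text \<open>The pair \<open>H S\<close> in the hypothesis expresses the restriction in (T):
  quantifiers over all sets, parameters standard.\<close>

lemma transfer_ax:
  assumes "dfn H S (\<lambda>e. P (e 0))" "x \<in> H" "P x"
  shows "\<exists>y\<in>S. P y"
proof -
  obtain q c where q: "c \<in> envs S" "\<And>x. x \<in> H \<Longrightarrow> P x \<longleftrightarrow> sat H E (x ## c) q"
    using dfn_formula1[OF assms(1)] by metis
  have c: "c \<in> envs H" "c \<in> envs U"
    using envs_mono[OF q(1) S_H] envs_mono[OF _ H_U] by blast+
  have "S \<subseteq> U" using S_H H_U by blast
  have "sat U E c (THS_T q)"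
    by (rule sat_closures_inD[OF _ e0 q(1) \<open>S \<subseteq> U\<close>], rule sat_THS) (auto simp: THS_def sat_standard_fm)
  then have "(\<exists>x\<in>U. x \<in> H \<and> sat U E (x ## c) (relativize set_fm q)) \<longrightarrow>
      (\<exists>x\<in>U. x \<in> S \<and> sat U E (x ## c) (relativize set_fm q))"
    unfolding THS_T_def Let_def using c by (simp add: sat_set_fm sat_standard_fm)
  moreover have "sat U E (x ## c) (relativize set_fm q) \<longleftrightarrow> P x" if "x \<in> H" for x
    using sat_relativize_set[of "x ## c" q] q(2) c that by simp
  ultimately show ?thesis using assms(2,3) S_H H_in_U by blast
qed

lemma choice_ax:
  assumes "isclass R" "thin (dom_cls R)"
  shows "\<exists>F\<subseteq>R. isclass F \<and> dom_cls F = dom_cls R \<and>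
        (\<forall>g\<in>F. \<forall>h\<in>F. \<forall>x\<in>H. \<forall>y\<in>H. \<forall>z\<in>H. pr g x y \<longrightarrow> pr h x z \<longrightarrow> y = z)"
proof -
  obtain R' D where R: "R' \<in> U" "ext R' = R" "D \<in> U" "ext D = dom_cls R"
    using assms unfolding thin_def isclass_def by blast
  have "sat U E e0 THS_Choice" by (rule sat_THS) (simp add: THS_def)
  then have "\<forall>R'\<in>U. \<forall>D\<in>U. ext D = dom_cls (ext R') \<and> thin (ext D) \<longrightarrow>
      (\<exists>F\<in>U. sat U E (F ## D ## R' ## e0) (function_fm 0) \<and> ext F \<subseteq> ext R' \<and> ext D = dom_cls (ext F))"
    unfolding THS_Choice_def using e0 by (simp add: sat_dom_fm sat_thin_fm sat_subset_fm)
  then obtain F where F: "F \<in> U" "sat U E (F ## D ## R' ## e0) (function_fm 0)" "ext F \<subseteq> R"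
    "dom_cls (ext F) = dom_cls R"
    using R assms(2) by metis
  have "\<forall>x\<in>U. \<forall>y\<in>U. \<forall>z\<in>U. (\<exists>g\<in>ext F. pr g x y) \<and> (\<exists>g\<in>ext F. pr g x z) \<longrightarrow> y = z"
    using F(1,2) R e0 unfolding function_fm_def by (simp add: sat_opair_in_fm)
  then have "y = z" if "g \<in> ext F" "h \<in> ext F" "pr g x y" "pr h x z" for g h x y z
    using that pr_H H_in_U by blast
  moreover have "isclass (ext F)" using F(1) unfolding isclass_def by blast
  ultimately show ?thesis using F(3,4) by blast
qed

lemma dc_ax:
  assumes "dfn U U (\<lambda>e. \<Phi> (e 0) (e (Suc 0)))" "\<And>X. X \<in> U \<Longrightarrow> \<exists>Y\<in>U. \<Phi> X Y" "X0 \<in> U"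
  shows "\<exists>Z\<in>U. (\<exists>n\<in>U. ext n = {} \<and> section_cls (ext Z) n = ext X0) \<and>
        (\<forall>n\<in>SN. \<exists>m\<in>U. ext m = insert n (ext n) \<and> (\<exists>X\<in>U. \<exists>Y\<in>U. ext X = section_cls (ext Z) n \<and>
           ext Y = section_cls (ext Z) m \<and> \<Phi> X Y))"
proof -
  obtain q c where q: "c \<in> envs U" "\<And>x y. x \<in> U \<Longrightarrow> y \<in> U \<Longrightarrow> \<Phi> x y \<longleftrightarrow> sat U E (x ## y ## c) q"
    using dfn_formula2[OF assms(1)] by metis
  have "sat U E c (THS_DC q)"
    by (rule sat_closuresD[OF _ e0 q(1)], rule sat_THS) (auto simp: THS_def)
  moreover have "sat U E c (\<^bold>\<forall> (\<^bold>\<exists> (inst2 2 1 0 q)))"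
    using assms(2) q by simp
  ultimately have "sat U E c (\<^bold>\<forall> (\<^bold>\<exists> (
       \<^bold>\<exists> (empty_fm 0 \<^bold>\<and> image_singleton_fm 2 1 0) \<^bold>\<and>
       all_in nat_fm (\<^bold>\<exists> (adjoin_fm 0 1 1 \<^bold>\<and>
         \<^bold>\<exists> (\<^bold>\<exists> (image_singleton_fm 1 4 3 \<^bold>\<and> image_singleton_fm 0 4 2 \<^bold>\<and> inst2 6 1 0 q)))))))"
    unfolding THS_DC_def sat.simps by blast
  then obtain Z where Z: "Z \<in> U" and Z0: "sat U E (Z ## X0 ## c) (\<^bold>\<exists> (empty_fm 0 \<^bold>\<and> image_singleton_fm 2 1 0))"
    and Z1: "sat U E (Z ## X0 ## c) (all_in nat_fm (\<^bold>\<exists> (adjoin_fm 0 1 1 \<^bold>\<and>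
         \<^bold>\<exists> (\<^bold>\<exists> (image_singleton_fm 1 4 3 \<^bold>\<and> image_singleton_fm 0 4 2 \<^bold>\<and> inst2 6 1 0 q)))))"
    using assms(3) by (simp only: sat.simps sat_connectives) blast
  have "\<exists>n\<in>U. ext n = {} \<and> section_cls (ext Z) n = ext X0"
  proof -
    obtain n where n: "n \<in> U" "ext n = {}" "sat U E (n ## Z ## X0 ## c) (image_singleton_fm 2 1 0)"
      using Z0 by (auto simp: sat_empty_fm)
    then show ?thesis using sat_image_singleton_fm[OF _ n(3)] Z assms(3) q(1) by auto
  qed
  moreover have "\<exists>m\<in>U. ext m = insert n (ext n) \<and> (\<exists>X\<in>U. \<exists>Y\<in>U. ext X = section_cls (ext Z) n \<and>
           ext Y = section_cls (ext Z) m \<and> \<Phi> X Y)" if n: "n \<in> SN" for n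
  proof -
    have nU: "n \<in> U" using n by (simp add: SN_def)
    have env: "n ## Z ## X0 ## c \<in> envs U" using nU Z assms(3) q(1) by simp
    then have "sat U E (n ## Z ## X0 ## c) (nat_fm 0)" using n by (intro SN_nat_fm) auto
    then have "sat U E (n ## Z ## X0 ## c) (\<^bold>\<exists> (adjoin_fm 0 1 1 \<^bold>\<and>
         \<^bold>\<exists> (\<^bold>\<exists> (image_singleton_fm 1 4 3 \<^bold>\<and> image_singleton_fm 0 4 2 \<^bold>\<and> inst2 6 1 0 q))))"
      using Z1 nU by (simp only: sat_connectives)
    then obtain m X Y where m: "m \<in> U" "X \<in> U" "Y \<in> U"
      and sat: "sat U E (m ## n ## Z ## X0 ## c) (adjoin_fm 0 1 1)"
        "sat U E (Y ## X ## m ## n ## Z ## X0 ## c) (image_singleton_fm 1 4 3)"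
        "sat U E (Y ## X ## m ## n ## Z ## X0 ## c) (image_singleton_fm 0 4 2)"
        "sat U E (Y ## X ## m ## n ## Z ## X0 ## c) (inst2 6 1 0 q)"
      by (simp only: sat_connectives) blast
    have "ext m = insert n (ext n)" using sat(1) m env by (simp add: sat_adjoin_fm)
    moreover have "ext X = section_cls (ext Z) n"
      using sat_image_singleton_fm[OF _ sat(2)] m env by simp
    moreover have "ext Y = section_cls (ext Z) m"
      using sat_image_singleton_fm[OF _ sat(3)] m env by simp
    moreover have "\<Phi> X Y" using sat(4) q(2) m by simp
    ultimately show ?thesis using m by blast
  qed
  ultimately show ?thesis using Z by blast
qed

lemma thin_ax:
  assumes A: "thin A"
  shows "\<exists>v\<in>H. A \<subseteq> ext v"
proof -
  obtain A' where A': "A' \<in> U" "ext A' = A" using A unfolding thin_def isclass_def by blast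
  have "sat U E e0 THS_Thin" by (rule sat_THS) (simp add: THS_def)
  then have "\<forall>A\<in>U. thin (ext A) \<longrightarrow> (\<exists>v\<in>U. v \<in> H \<and> ext A \<subseteq> ext v)"
    unfolding THS_Thin_def using e0 by (simp add: sat_thin_fm sat_set_fm sat_subset_fm)
  then show ?thesis using A A' by blast
qed

lemma comp_ax:
  assumes A: "thin A" and u: "isset u" "u \<subseteq> \<Union> (ext ` A)"
  shows "\<exists>w\<subseteq>A. isset w \<and> u \<subseteq> \<Union> (ext ` w)"
proof -
  obtain A' where A': "A' \<in> U" "ext A' = A" using A unfolding thin_def isclass_def by blast
  obtain u' where u': "u' \<in> H" "ext u' = u" using u unfolding isset_def by blast
  have "sat U E e0 THS_Comp" by (rule sat_THS) (simp add: THS_def)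
  then have "\<forall>A\<in>U. thin (ext A) \<longrightarrow> (\<forall>u\<in>U. u \<in> H \<longrightarrow> ext u \<subseteq> \<Union> (ext ` ext A) \<longrightarrow>
      (\<exists>w\<in>U. w \<in> H \<and> ext w \<subseteq> ext A \<and> ext u \<subseteq> \<Union> (ext ` ext w)))"
    unfolding THS_Comp_def using e0 by (simp add: sat_thin_fm sat_set_fm sat_subset_fm sat_covers_fm)
  then obtain w where "w \<in> H" "ext w \<subseteq> A" "u \<subseteq> \<Union> (ext ` ext w)"
    using A A' u u' H_in_U by metis
  then show ?thesis unfolding isset_def by blast
qed

lemma exp_ax:
  assumes A: "thin A"
  shows "\<exists>P. thin P \<and> (\<forall>y\<in>H. \<exists>p\<in>P. ext y \<inter> A = ext p \<inter> A)"
proof -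
  obtain A' where A': "A' \<in> U" "ext A' = A" using A unfolding thin_def isclass_def by blast
  have "sat U E e0 THS_Exp" by (rule sat_THS) (simp add: THS_def)
  then have "\<forall>A\<in>U. thin (ext A) \<longrightarrow> (\<exists>P\<in>U. thin (ext P) \<and> (\<forall>y\<in>U. y \<in> H \<longrightarrow>
      (\<exists>p\<in>ext P. \<forall>z\<in>U. z \<in> ext y \<and> z \<in> ext A \<longleftrightarrow> z \<in> ext p \<and> z \<in> ext A)))"
    unfolding THS_Exp_def using e0 by (simp add: sat_thin_fm sat_set_fm E_ext bex_U_ext)
  then obtain P where P: "thin (ext P)" "\<forall>y\<in>U. y \<in> H \<longrightarrow>
      (\<exists>p\<in>ext P. \<forall>z\<in>U. z \<in> ext y \<and> z \<in> A \<longleftrightarrow> z \<in> ext p \<and> z \<in> A)"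
    using A A' by metis
  have "\<exists>p\<in>ext P. ext y \<inter> A = ext p \<inter> A" if "y \<in> H" for y
  proof -
    obtain p where "p \<in> ext P" "\<forall>z\<in>U. z \<in> ext y \<and> z \<in> A \<longleftrightarrow> z \<in> ext p \<and> z \<in> A"
      using P(2) \<open>y \<in> H\<close> H_in_U by blast
    then show ?thesis using ext_U by blast
  qed
  then show ?thesis using P(1) by blast
qed


section \<open>Hyperfinite sets\<close>

lemma lw_U [simp]: "lw U"
  unfolding lw_def using H_U ext_H by blast

lemma H_nonempty [simp]: "H \<noteq> {}"
  using empty_ax by (auto simp: isset_def)

lemma U_nonempty [simp]: "U \<noteq> {}"
  using H_nonempty H_U by blast

text \<open>The set with a given extension. The description is meaningful only when \<open>A\<close>
  satisfies \<open>isset\<close>, so existence is shown before \<open>cd\<close> is used; as a term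
  it does not occur in definable predicates except as a constant.\<close>

definition cd :: "'a set \<Rightarrow> 'a"
  where "cd A = (THE x. x \<in> H \<and> ext x = A)"

lemma H_ext: "x \<in> H \<Longrightarrow> y \<in> H \<Longrightarrow> ext x = ext y \<Longrightarrow> x = y"
  by (intro cls_ext) auto

lemma cd: assumes "isset A" shows cd_H [simp]: "cd A \<in> H" and ext_cd [simp]: "ext (cd A) = A"
proof -
  obtain x where "x \<in> H \<and> ext x = A" using assms by (auto simp: isset_def)
  moreover from this have "y = x" if "y \<in> H \<and> ext y = A" for y using that H_ext by blast
  ultimately have "cd A \<in> H \<and> ext (cd A) = A" unfolding cd_def by (rule theI)
  then show "cd A \<in> H" "ext (cd A) = A" by blast+
qed

lemma isset_ext [simp]: "x \<in> H \<Longrightarrow> isset (ext x)"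
  by (auto simp: isset_def)

lemma cd_ext [simp]: "x \<in> H \<Longrightarrow> cd (ext x) = x"
  by (rule H_ext) simp_all

text \<open>Brings a claim of set existence into the shape of a formula, to which induction for
  definable predicates applies. The closure properties below all follow this pattern.\<close>

lemma isset_iff: "(\<exists>y\<in>H. \<forall>z\<in>H. z \<in> ext y \<longleftrightarrow> P z) \<longleftrightarrow> isset {z\<in>H. P z}"
proof
  assume "\<exists>y\<in>H. \<forall>z\<in>H. z \<in> ext y \<longleftrightarrow> P z"
  then obtain y where "y \<in> H" "\<forall>z\<in>H. z \<in> ext y \<longleftrightarrow> P z" by blast
  then have "ext y = {z\<in>H. P z}" using ext_H by blast
  then show "isset {z\<in>H. P z}" using \<open>y \<in> H\<close> isset_def by blast
qed (auto simp: isset_def)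

lemma isset_H: "isset A \<Longrightarrow> A \<subseteq> H"
  by (auto simp: isset_def ext_H)

lemma isclass_H: "isclass A \<Longrightarrow> A \<subseteq> H"
  by (auto simp: isclass_def ext_H)

lemma isset_isclass: "isset A \<Longrightarrow> isclass A"
  by (auto simp: isset_def isclass_def intro: H_in_U)

lemma isclass_ext [simp]: "x \<in> U \<Longrightarrow> isclass (ext x)"
  by (auto simp: isclass_def)

lemma dset_isclass [simp]: "isclass A \<Longrightarrow> dset U U A"
  using dset_ext[of U U] by (auto simp: isclass_def)

lemma dset_isset [simp]: "isset A \<Longrightarrow> dset H H A"
  using dset_ext[of H H] by (auto simp: isset_def)

lemma dset_isset' [simp]: "isset A \<Longrightarrow> dset U U A"
  by (simp add: isset_isclass)

lemma dset_U [simp]: "dset U U U" "dset H H H"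
  by (simp_all add: dset_UNIV)

lemma isclass_HU [simp]: "isclass H"
  using cls_comp[of "\<lambda>x. x = x"] dfn_eq[OF _ trm_var trm_var, of U U 0 0] by simp

lemma isclass_Collect:
  assumes "isclass A" "dfn U U (\<lambda>e. P (e 0))"
  shows "isclass {x\<in>A. P x}"
proof -
  have "{x\<in>A. P x} = {x\<in>H. x \<in> A \<and> P x}" using isclass_H[OF assms(1)] by blast
  moreover have "dfn U U (\<lambda>e. e 0 \<in> A \<and> P (e 0))"
    using assms by (intro dfn_conj dset_mem trm_var) auto
  ultimately show ?thesis using cls_comp[of "\<lambda>x. x \<in> A \<and> P x"] by simp
qed

lemma isset_empty [simp]: "isset {}" by (rule empty_ax)

lemma isset_insert [simp]: "isset A \<Longrightarrow> y \<in> H \<Longrightarrow> isset (insert y A)"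
  using adjoin_ax unfolding isset_def by metis

text \<open>As in (Ind), the hypothesis is available for the inserted element too. The principle
  therefore contains induction along membership as well as induction on the number of
  elements.\<close>

lemma set_induct [consumes 2, case_names empty insert]:
  assumes "dfn H H (\<lambda>e. P (e 0))" "isset A" "P (cd {})"
    and "\<And>A y. isset A \<Longrightarrow> y \<in> H \<Longrightarrow> P (cd A) \<Longrightarrow> P y \<Longrightarrow> P (cd (insert y A))"
  shows "P (cd A)"
proof (rule ind_ax[OF assms(1)])
  show "P x" if "x \<in> H" "ext x = {}" for x
    using assms(3) that cd_ext by metis
  show "P z" if "x \<in> H" "y \<in> H" "z \<in> H" "P x" "P y" "ext z = insert y (ext x)" for x y z
    using assms(4)[of "ext x" y] that cd_ext by fastforce
qed (use assms(2) in auto)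

lemma dfn_inst: "dfn W C (\<lambda>e. P (e 0)) \<Longrightarrow> C \<subseteq> W \<Longrightarrow> trm C s \<Longrightarrow> dfn W C (\<lambda>e. P (s e))"
  by (rule dfn_sub1)

section \<open>Separation, union, replacement and power set by induction\<close>

lemma isset_Collect:
  assumes "isset A" "dfn H H (\<lambda>e. P (e 0))"
  shows "isset {x\<in>A. P x}"
proof -
  note P = dfn_inst[OF assms(2)]
  define Q where "Q x \<longleftrightarrow> (\<exists>y\<in>H. \<forall>z\<in>H. z \<in> ext y \<longleftrightarrow> z \<in> ext x \<and> P z)" for x
  have Q: "Q (cd A) \<longleftrightarrow> isset {x\<in>A. P x}" if "isset A" for A
  proof -
    have "{z\<in>H. z \<in> A \<and> P z} = {x\<in>A. P x}" using isset_H[OF that] by blast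
    then show ?thesis unfolding Q_def isset_iff using that by simp
  qed
  have "Q (cd A)"
  proof (induction rule: set_induct[OF _ assms(1)])
    show "dfn H H (\<lambda>e. Q (e 0))" unfolding Q_def by (intro dfn_intros P) auto
  next
    case 2
    then show ?case by (simp add: Q)
  next
    case (3 A y)
    then have "isset {x\<in>A. P x}" by (simp add: Q)
    moreover have "{x\<in>insert y A. P x} = (if P y then insert y {x\<in>A. P x} else {x\<in>A. P x})" by auto
    ultimately show ?case using 3 by (simp add: Q)
  qed
  then show ?thesis using Q assms(1) by simp
qed

lemma isset_Un [simp]:
  assumes "isset A" "isset B"
  shows "isset (A \<union> B)"
proof -
  define Q where "Q x \<longleftrightarrow> (\<exists>y\<in>H. \<forall>z\<in>H. z \<in> ext y \<longleftrightarrow> z \<in> A \<or> z \<in> ext x)" for x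
  have Q: "Q (cd B) \<longleftrightarrow> isset (A \<union> B)" if "isset B" for B
  proof -
    have "{z\<in>H. z \<in> A \<or> z \<in> B} = A \<union> B" using isset_H that assms(1) by blast
    then show ?thesis unfolding Q_def isset_iff using that by simp
  qed
  have "Q (cd B)"
  proof (induction rule: set_induct[OF _ assms(2)])
    show "dfn H H (\<lambda>e. Q (e 0))" unfolding Q_def using assms(1) by (intro dfn_intros) auto
  qed (use assms(1) in \<open>simp_all add: Q\<close>)
  then show ?thesis using Q assms(2) by simp
qed

lemma isset_Union [simp]:
  assumes "isset A"
  shows "isset (\<Union> (ext ` A))"
proof -
  define Q where "Q x \<longleftrightarrow> (\<exists>y\<in>H. \<forall>z\<in>H. z \<in> ext y \<longleftrightarrow> (\<exists>w\<in>ext x. z \<in> ext w))" for x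
  have Q: "Q (cd B) \<longleftrightarrow> isset (\<Union> (ext ` B))" if "isset B" for B
  proof -
    have "{z\<in>H. \<exists>w\<in>B. z \<in> ext w} = \<Union> (ext ` B)" using ext_H by blast
    then show ?thesis unfolding Q_def isset_iff using that by simp
  qed
  have "Q (cd A)"
  proof (induction rule: set_induct[OF _ assms])
    show "dfn H H (\<lambda>e. Q (e 0))" unfolding Q_def by (intro dfn_intros) auto
  qed (simp_all add: Q)
  then show ?thesis using Q assms by simp
qed

lemma isset_replacement:
  assumes "isset A" "dfn H H (\<lambda>e. R (e 0) (e (Suc 0)))"
    and "\<And>x. x \<in> A \<Longrightarrow> f x \<in> H" "\<And>x y. x \<in> A \<Longrightarrow> y \<in> H \<Longrightarrow> R x y \<longleftrightarrow> y = f x"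
  shows "isset (f ` A)"
proof -
  have R: "dfn H H (\<lambda>e. R (s e) (t e))" if "trm H s" "trm H t" for s t
    using dfn_sub2[OF assms(2) _ that] by simp
  \<comment> \<open>The guard restricts the claim to subsets of \<open>A\<close>: the relation
    \<open>R\<close> is known to be functional only there, whereas the induction passes through
    arbitrary sets.\<close>
  define Q where "Q x \<longleftrightarrow> (ext x \<subseteq> ext (cd A) \<longrightarrow> (\<exists>y\<in>H. \<forall>z\<in>H. z \<in> ext y \<longleftrightarrow> (\<exists>w\<in>ext x. R w z)))" for x
  have Q: "Q (cd B) \<longleftrightarrow> (B \<subseteq> A \<longrightarrow> isset (f ` B))" if "isset B" for B
  proof -
    have "{z\<in>H. \<exists>w\<in>B. R w z} = f ` B" if "B \<subseteq> A"
      using assms(3,4) that by (auto simp: image_iff) (metis subsetD)+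
    then show ?thesis unfolding Q_def isset_iff using that assms(1) by auto
  qed
  have "Q (cd A)"
  proof (induction rule: set_induct[OF _ assms(1)])
    show "dfn H H (\<lambda>e. Q (e 0))" unfolding Q_def using assms(1) by (intro dfn_intros R) auto
  qed (simp_all add: Q assms(3))
  then show ?thesis using Q assms by simp
qed

definition Pow_set :: "'a set \<Rightarrow> 'a set"
  where "Pow_set A = {y\<in>H. ext y \<subseteq> A}"

lemma Pow_set_insert: "isset A \<Longrightarrow> a \<in> H \<Longrightarrow>
  Pow_set (insert a A) = Pow_set A \<union> (\<lambda>y. cd (insert a (ext y))) ` Pow_set A"
proof (intro equalityI subsetI)
  fix y assume a: "isset A" "a \<in> H" and y: "y \<in> Pow_set (insert a A)"
  then have yH: "y \<in> H" "ext y \<subseteq> insert a A" by (auto simp: Pow_set_def)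
  show "y \<in> Pow_set A \<union> (\<lambda>y. cd (insert a (ext y))) ` Pow_set A"
  proof (cases "a \<in> ext y")
    case True
    have "isset {z\<in>ext y. z \<noteq> a}" using yH a by (intro isset_Collect dfn_intros) auto
    then have "cd {z\<in>ext y. z \<noteq> a} \<in> Pow_set A" using yH by (auto simp: Pow_set_def)
    moreover have "insert a {z\<in>ext y. z \<noteq> a} = ext y" using True by blast
    ultimately show ?thesis
      using \<open>isset {z\<in>ext y. z \<noteq> a}\<close> yH by (intro UnI2 image_eqI[of _ _ "cd {z\<in>ext y. z \<noteq> a}"]) auto
  qed (use yH in \<open>auto simp: Pow_set_def\<close>)
qed (auto simp: Pow_set_def)

lemma isset_Pow [simp]:
  assumes "isset A"
  shows "isset (Pow_set A)"
proof -
  define Q where "Q x \<longleftrightarrow> (\<exists>y\<in>H. \<forall>z\<in>H. z \<in> ext y \<longleftrightarrow> ext z \<subseteq> ext x)" for x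
  have Q: "Q (cd B) \<longleftrightarrow> isset (Pow_set B)" if "isset B" for B
    unfolding Q_def isset_iff Pow_set_def using that by simp
  have "Q (cd A)"
  proof (induction rule: set_induct[OF _ assms])
    show "dfn H H (\<lambda>e. Q (e 0))" unfolding Q_def by (intro dfn_intros) auto
  next
    case 2
    have "Pow_set {} = {cd {}}" using H_ext by (auto simp: Pow_set_def)
    then show ?case by (simp add: Q)
  next
    case (3 A a)
    have "isset ((\<lambda>y. cd (insert a (ext y))) ` Pow_set A)"
    proof (rule isset_replacement[where R = "\<lambda>x y. ext y = insert a (ext x)"])
      show "dfn H H (\<lambda>e. ext (e (Suc 0)) = insert a (ext (e 0)))" using 3 by (intro dfn_intros) auto
      show "(ext y = insert a (ext x)) = (y = cd (insert a (ext x)))"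
        if "x \<in> Pow_set A" "y \<in> H" for x y
      proof -
        have "isset (insert a (ext x))" using that 3(2) by (simp add: Pow_set_def)
        then show ?thesis using ext_cd cd_ext[OF that(2)] by metis
      qed
    qed (use 3 Q in \<open>auto simp: Pow_set_def\<close>)
    then show ?case using 3 by (simp add: Q Pow_set_insert)
  qed
  then show ?thesis using Q assms by simp
qed

text \<open>The induction is run on "\<open>P\<close> holds for \<open>x\<close> and for all its
  elements". When \<open>y\<close> is inserted into \<open>A\<close>, the elements of
  \<open>A\<close> are covered by the second half of the hypothesis for \<open>A\<close> and
  \<open>y\<close> by the first half of the hypothesis for \<open>y\<close>.\<close>

lemma mem_induct:
  assumes "dfn H H (\<lambda>e. P (e 0))" "\<And>x. x \<in> H \<Longrightarrow> (\<And>y. y \<in> ext x \<Longrightarrow> P y) \<Longrightarrow> P x" "x \<in> H"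
  shows "P x"
proof -
  note P = dfn_inst[OF assms(1)]
  define Q where "Q x \<longleftrightarrow> P x \<and> (\<forall>y\<in>ext x. P y)" for x
  have "Q (cd (ext x))"
  proof (induction rule: set_induct[OF _ isset_ext[OF assms(3)]])
    show "dfn H H (\<lambda>e. Q (e 0))" unfolding Q_def by (intro dfn_intros P) auto
  next
    case 2
    show ?case unfolding Q_def using assms(2)[of "cd {}"] by simp
  next
    case (3 A y)
    then have "P z" if "z \<in> insert y A" for z using that by (auto simp: Q_def)
    then show ?case unfolding Q_def using assms(2)[of "cd (insert y A)"] 3 by simp
  qed
  then show ?thesis using assms(3) by (simp add: Q_def)
qed

text \<open>Membership induction on: if \<open>x\<close> is in \<open>A\<close> then
  \<open>A\<close> has a minimal element. Either \<open>x\<close> itself is minimal or one of its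
  members is in \<open>A\<close>.\<close>

lemma foundation:
  assumes "isset A" "A \<noteq> {}"
  shows "\<exists>m\<in>A. ext m \<inter> A = {}"
proof -
  define Q where "Q x \<longleftrightarrow> (x \<in> A \<longrightarrow> (\<exists>m\<in>A. \<forall>z\<in>ext m. z \<notin> A))" for x
  have "Q x" if "x \<in> H" for x
  proof (rule mem_induct[OF _ _ that])
    show "dfn H H (\<lambda>e. Q (e 0))" unfolding Q_def using assms(1) by (intro dfn_intros) auto
    show "Q x" if "\<And>y. y \<in> ext x \<Longrightarrow> Q y" for x using that unfolding Q_def by blast
  qed
  moreover obtain x where "x \<in> A" "x \<in> H" using assms isset_H by blast
  ultimately obtain m where "m \<in> A" "\<forall>z\<in>ext m. z \<notin> A" unfolding Q_def by blast
  then show ?thesis by blast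
qed

lemma no_2cycle: "x \<in> ext y \<Longrightarrow> y \<in> ext x \<Longrightarrow> False"
  using foundation[of "{x, y}"] ext_H[of x y] ext_H[of y x] by auto

lemma no_1cycle: "x \<in> ext x \<Longrightarrow> False"
  using no_2cycle .

lemma no_3cycle: "x \<in> ext y \<Longrightarrow> y \<in> ext z \<Longrightarrow> z \<in> ext x \<Longrightarrow> False"
proof -
  assume *: "x \<in> ext y" "y \<in> ext z" "z \<in> ext x"
  then have "isset {x, y, z}" using ext_H by simp
  then show False using foundation[of "{x, y, z}"] * by blast
qed

section \<open>The class of standard sets\<close>

lemma S_class [simp]: "isclass S"
proof -
  have "isclass {x\<in>H. \<forall>X\<in>U. adjoin_cls (ext X) \<longrightarrow> x \<in> ext X}"
    unfolding adjoin_cls_def by (intro isclass_Collect dfn_intros) auto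
  then show ?thesis by (simp add: S_def)
qed

lemma S_least: "isclass A \<Longrightarrow> adjoin_cls A \<Longrightarrow> S \<subseteq> A"
  unfolding isclass_def S_def by auto

lemma S_empty [simp]: "cd {} \<in> S"
  unfolding S_def adjoin_cls_def by (auto, metis cd_ext ext_H)

lemma S_insert [simp]:
  assumes "a \<in> S" "b \<in> S" shows "cd (insert b (ext a)) \<in> S"
proof -
  have H: "a \<in> H" "b \<in> H" using assms S_H by blast+
  have "cd (insert b (ext a)) \<in> ext X" if X: "X \<in> U" "adjoin_cls (ext X)" for X
  proof -
    have "a \<in> ext X" "b \<in> ext X" using assms X by (auto simp: S_def)
    then obtain c where "c \<in> ext X" "ext c = insert b (ext a)"
      using X(2) unfolding adjoin_cls_def by blast
    then show ?thesis by (metis cd_ext ext_H)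
  qed
  then show ?thesis using H by (simp add: S_def)
qed

text \<open>Minimality of \<open>S\<close> is minimality among classes. In contrast to (Ind), the
  predicate may therefore contain class quantifiers and nonstandard parameters.\<close>

lemma S_induct [consumes 1, case_names dfn empty insert]:
  assumes "x \<in> S" "dfn U U (\<lambda>e. P (e 0))" "P (cd {})"
    "\<And>a b. a \<in> S \<Longrightarrow> b \<in> S \<Longrightarrow> P a \<Longrightarrow> P b \<Longrightarrow> P (cd (insert b (ext a)))"
  shows "P x"
proof -
  have "S \<subseteq> {x\<in>S. P x}"
  proof (rule S_least)
    show "isclass {x\<in>S. P x}" by (rule isclass_Collect[OF S_class assms(2)])
    have "ext (cd (insert b (ext a))) = insert b (ext a)" if "a \<in> S" "b \<in> S" for a b
      using S_H that by (meson ext_cd isset_ext isset_insert subsetD)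
    then show "adjoin_cls {x\<in>S. P x}" unfolding adjoin_cls_def
    proof (intro conjI ballI)
      show "\<exists>e\<in>{x\<in>S. P x}. ext e = {}" using assms(3) by (intro bexI[of _ "cd {}"]) auto
      show "\<exists>c\<in>{x\<in>S. P x}. ext c = insert b (ext a)" if "a \<in> {x\<in>S. P x}" "b \<in> {x\<in>S. P x}" for a b
        using assms(4)[of a b] that \<open>\<And>a b. a \<in> S \<Longrightarrow> b \<in> S \<Longrightarrow> ext (cd (insert b (ext a))) = insert b (ext a)\<close>
        by (intro bexI[of _ "cd (insert b (ext a))"]) simp_all
    qed
  qed
  then show ?thesis using assms(1) by blast
qed

lemma S_trans: "x \<in> S \<Longrightarrow> ext x \<subseteq> S"
proof (induction rule: S_induct)
  case dfn
  show ?case unfolding subset_iff Ball_def[symmetric] by (intro dfn_intros) auto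
next
  case (insert a b)
  then have "a \<in> H" "b \<in> H" using S_H by blast+
  then show ?case using insert by simp
qed simp

lemma S_memD: "x \<in> S \<Longrightarrow> y \<in> ext x \<Longrightarrow> y \<in> S"
  using S_trans by blast

lemma S_mem_H [simp]: "x \<in> S \<Longrightarrow> x \<in> H"
  using S_H by blast

text \<open>A subclass of the larger set differs by at most \<open>y\<close> from a subclass of
  \<open>A\<close>, which is a set; adjunction restores \<open>y\<close>.\<close>

lemma small_insert:
  assumes "small A" "y \<in> H"
  shows "small (insert y A)"
  unfolding small_def
proof (intro allI impI)
  fix B assume B: "B \<subseteq> insert y A" "isclass B"
  have "isclass {z\<in>B. z \<noteq> y}" using B assms(2) by (intro isclass_Collect dfn_intros) auto
  moreover have "{z\<in>B. z \<noteq> y} \<subseteq> A" using B by blast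
  ultimately have "isset {z\<in>B. z \<noteq> y}" using assms(1) unfolding small_def by blast
  moreover have "B = {z\<in>B. z \<noteq> y} \<or> B = insert y {z\<in>B. z \<noteq> y}" by blast
  ultimately show "isset B" using assms(2) isset_insert by metis
qed

lemma S_small: "x \<in> S \<Longrightarrow> small (ext x)"
proof (induction rule: S_induct)
  case dfn
  show ?case unfolding small_ext_iff by (intro dfn_intros) auto
next
  case empty
  show ?case by (simp add: small_def)
next
  case (insert a b)
  then show ?case by (simp add: small_insert)
qed

definition isPow :: "'a \<Rightarrow> 'a \<Rightarrow> bool"
  where "isPow p x \<longleftrightarrow> (\<forall>y\<in>H. y \<in> ext p \<longleftrightarrow> ext y \<subseteq> ext x)"

lemma isPow_iff: "isPow p x \<longleftrightarrow> ext p = Pow_set (ext x)"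
  unfolding isPow_def Pow_set_def using ext_H by blast

lemma dfn_isPow:
  assumes "C \<subseteq> W" "trm C s" "trm C t" "C \<noteq> {}" "W = H \<or> W = U \<and> C = U"
  shows "dfn W C (\<lambda>e. isPow (s e) (t e))"
proof (rule dfn_sub2[of W C isPow])
  have "dset W C H"
    using assms(5)
  proof
    assume "W = H"
    then show ?thesis using dset_UNIV[OF assms(4,1)] by simp
  qed simp
  then show "dfn W C (\<lambda>e. isPow (e 0) (e (Suc 0)))"
    unfolding isPow_def using assms by (intro dfn_intros) auto
qed fact+

lemma S_nonempty [simp]: "S \<noteq> {}"
  using S_empty by blast

text \<open>The power set exists and is described by a set formula with the standard parameter
  \<open>x\<close>, so (T) yields a standard set of the same description, and extensionality
  identifies the two.\<close>

lemma S_Pow: assumes "x \<in> S" shows "cd (Pow_set (ext x)) \<in> S"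
proof -
  have "\<exists>y\<in>S. isPow y x"
  proof (rule transfer_ax)
    show "dfn H S (\<lambda>e. isPow (e 0) x)" using assms by (intro dfn_isPow trm_var trm_const) auto
    show "cd (Pow_set (ext x)) \<in> H" "isPow (cd (Pow_set (ext x))) x"
      using assms by (simp_all add: isPow_iff)
  qed
  then show ?thesis unfolding isPow_iff by (metis S_mem_H cd_ext)
qed

text \<open>The elements of a level chain are levels \<open>V\<^sub>n\<close> of the cumulative hierarchy. They bound a set of standard
  sets without a theory of ranks.\<close>

definition level_chain :: "'a \<Rightarrow> bool"
  where "level_chain c \<longleftrightarrow> (\<forall>e\<in>ext c. ext e = {} \<or> (\<exists>e'\<in>ext c. isPow e e'))"

text \<open>A membership-minimal nontransitive level \<open>m\<close> is nonempty, so it is the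
  power set of some \<open>e\<close> in the chain. As \<open>e\<close> belongs to \<open>m\<close>,
  it is transitive by minimality, and the power set of a transitive set is transitive.\<close>

lemma level_trans:
  assumes "c \<in> H" "level_chain c" "x \<in> ext c" "y \<in> ext x"
  shows "ext y \<subseteq> ext x"
proof (rule ccontr)
  assume not: "\<not> ext y \<subseteq> ext x"
  define B where "B = {e\<in>ext c. \<exists>y\<in>ext e. \<not> ext y \<subseteq> ext e}"
  have "isset B" unfolding B_def using assms(1) by (intro isset_Collect dfn_intros) auto
  moreover have "B \<noteq> {}" using assms not by (auto simp: B_def)
  ultimately obtain m where m: "m \<in> B" "ext m \<inter> B = {}" using foundation by blast
  obtain e where e: "e \<in> ext c" "ext m = Pow_set (ext e)"
    using m(1) assms(2) by (auto simp: level_chain_def isPow_iff B_def)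
  have "e \<in> ext m" using e ext_H by (auto simp: Pow_set_def)
  then have tr: "ext y \<subseteq> ext e" if "y \<in> ext e" for y using m(2) e(1) that by (auto simp: B_def)
  have "ext y \<subseteq> ext m" if "y \<in> ext m" for y
  proof
    fix z assume "z \<in> ext y"
    then have "z \<in> H" "z \<in> ext e" using that e(2) ext_H by (auto simp: Pow_set_def)
    then show "z \<in> ext m" using tr e(2) by (simp add: Pow_set_def)
  qed
  then show False using m(1) by (auto simp: B_def)
qed

text \<open>Take a minimal level \<open>m\<close> of the first chain that is incomparable with some
  \<open>f\<close> of the second. Neither is empty, so both are power sets of levels
  \<open>m'\<close> and \<open>f'\<close>; these are comparable by minimality of \<open>m\<close>,
  and taking power sets preserves inclusion.\<close>

lemma level_linear:
  assumes "c \<in> H" "level_chain c" "d \<in> H" "level_chain d" "x \<in> ext c" "y \<in> ext d"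
  shows "ext x \<subseteq> ext y \<or> ext y \<subseteq> ext x"
proof (rule ccontr)
  assume not: "\<not> ?thesis"
  define B where "B = {e\<in>ext c. \<exists>y\<in>ext d. \<not> ext e \<subseteq> ext y \<and> \<not> ext y \<subseteq> ext e}"
  have "isset B" unfolding B_def using assms(1,3) by (intro isset_Collect dfn_intros) auto
  moreover have "B \<noteq> {}" using assms not by (auto simp: B_def)
  ultimately obtain m where m: "m \<in> B" "ext m \<inter> B = {}" using foundation by blast
  obtain f where f: "f \<in> ext d" "\<not> ext m \<subseteq> ext f" "\<not> ext f \<subseteq> ext m" using m(1) by (auto simp: B_def)
  obtain m' where m': "m' \<in> ext c" "ext m = Pow_set (ext m')"
    using m(1) assms(2) by (auto simp: level_chain_def isPow_iff B_def)
  obtain f' where f': "f' \<in> ext d" "ext f = Pow_set (ext f')"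
    using f assms(4) by (auto simp: level_chain_def isPow_iff)
  have "m' \<in> ext m" using m' ext_H by (auto simp: Pow_set_def)
  then have "ext m' \<subseteq> ext f' \<or> ext f' \<subseteq> ext m'" using m(2) m'(1) f'(1) by (auto simp: B_def)
  then show False using f(2,3) m'(2) f'(2) by (auto simp: Pow_set_def)
qed

text \<open>Induction on the set: if \<open>A\<close> and \<open>y\<close> lie in levels of two
  chains, the larger level includes \<open>insert y A\<close> by transitivity and linearity. Adding
  its power set to the chain gives a level that has \<open>insert y A\<close> as an element.\<close>

lemma level_cover:
  assumes "x \<in> H"
  shows "\<exists>c\<in>H. level_chain c \<and> (\<exists>e\<in>ext c. x \<in> ext e)"
proof -
  define Q where "Q x \<longleftrightarrow> (\<exists>c\<in>H. level_chain c \<and> (\<exists>e\<in>ext c. x \<in> ext e))" for x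
  have extend: "Q x" if c: "c \<in> H" "level_chain c" "e \<in> ext c" "ext x \<subseteq> ext e" "x \<in> H" for c e x
  proof -
    have e: "e \<in> H" using c ext_H by blast
    let ?p = "cd (Pow_set (ext e))"
    let ?c = "cd (insert ?p (ext c))"
    have "level_chain ?c" using c e unfolding level_chain_def isPow_iff by auto
    moreover have "x \<in> Pow_set (ext e)" using c by (simp add: Pow_set_def)
    then have "x \<in> ext ?p" "?p \<in> ext ?c" "?c \<in> H" using c(1) e by simp_all
    ultimately show ?thesis unfolding Q_def by blast
  qed
  have "Q (cd (ext x))"
  proof (induction rule: set_induct[OF _ isset_ext[OF assms]])
    show "dfn H H (\<lambda>e. Q (e 0))" unfolding Q_def level_chain_def by (intro dfn_intros dfn_isPow) auto
  next
    case 2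
    have "level_chain (cd {cd {}})" by (simp add: level_chain_def)
    then show ?case by (intro extend[of "cd {cd {}}" "cd {}"]) auto
  next
    case (3 A y)
    then obtain c e d f where c: "c \<in> H" "level_chain c" "e \<in> ext c" "cd A \<in> ext e"
      and d: "d \<in> H" "level_chain d" "f \<in> ext d" "y \<in> ext f" unfolding Q_def by blast
    have A: "A \<subseteq> ext e" using level_trans[OF c] 3 by simp
    show ?case
      using level_linear[OF c(1,2) d(1,2) c(3) d(3)]
    proof
      assume "ext e \<subseteq> ext f"
      then show ?thesis using A d 3 by (intro extend[OF d(1-3)]) auto
    next
      assume "ext f \<subseteq> ext e"
      then show ?thesis using A c d 3 by (intro extend[OF c(1-3)]) auto
    qed
  qed
  then show ?thesis using assms by (simp add: Q_def)
qed

text \<open>A nonstandard level lies above all standard sets. If \<open>e\<close> is the power set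
  of a standard \<open>e'\<close>, it is standard by \<open>S_Pow\<close>; otherwise
  \<open>e'\<close> already contains \<open>a\<close> and \<open>b\<close>, and
  \<open>insert b (ext a)\<close> is a subset of it. The contrapositive is what counts: a level that
  misses a standard set is standard.\<close>

lemma level_S:
  assumes "a \<in> S" "c \<in> H" "level_chain c"
  shows "\<forall>e\<in>ext c. e \<in> S \<or> a \<in> ext e"
  using assms(1)
proof (induction rule: S_induct)
  case dfn
  show ?case using assms by (intro dfn_intros) auto
next
  case empty
  show ?case
  proof
    fix e assume e: "e \<in> ext c"
    then have eH: "e \<in> H" using ext_H by blast
    from e assms(3) consider "ext e = {}" | e' where "ext e = Pow_set (ext e')"
      by (auto simp: level_chain_def isPow_iff)
    then show "e \<in> S \<or> cd {} \<in> ext e"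
    proof cases
      case 1
      then have "e = cd {}" using eH cd_ext by metis
      then show ?thesis by simp
    qed (simp add: Pow_set_def)
  qed
next
  case (insert a b)
  show ?case
  proof
    fix e assume e: "e \<in> ext c"
    then have eH: "e \<in> H" using ext_H by blast
    from e assms(3) consider "ext e = {}" | e' where "e' \<in> ext c" "ext e = Pow_set (ext e')"
      by (auto simp: level_chain_def isPow_iff)
    then show "e \<in> S \<or> cd (insert b (ext a)) \<in> ext e"
    proof cases
      case 1
      then have "e = cd {}" using eH cd_ext by metis
      then show ?thesis by simp
    next
      case 2
      show ?thesis
      proof (cases "e' \<in> S")
        case True
        then show ?thesis using S_Pow[OF True] 2 cd_ext[OF eH] by simp
      next
        case False
        then have "a \<in> ext e'" "b \<in> ext e'" using insert 2 by auto
        then have "insert b (ext a) \<subseteq> ext e'" using level_trans[OF assms(2,3) 2(1)] by blast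
        then show ?thesis using insert 2 by (simp add: Pow_set_def)
      qed
    qed
  qed
qed

lemma small_subset: "small A \<Longrightarrow> B \<subseteq> A \<Longrightarrow> small B"
  unfolding small_def by blast

text \<open>Choose a minimal level \<open>m\<close> that includes \<open>u\<close>. If it is the
  power set of \<open>e'\<close>, then \<open>e'\<close> does not include \<open>u\<close> and so
  misses a standard set; hence \<open>e'\<close> is standard, and so is \<open>m\<close>. Being an
  element of the standard power set of \<open>m\<close>, the set coded by \<open>u\<close> is
  standard.\<close>

lemma S_cd:
  assumes u: "isset u" "u \<subseteq> S"
  shows "cd u \<in> S"
proof -
  obtain c e where c: "c \<in> H" "level_chain c" and e: "e \<in> ext c" "cd u \<in> ext e"
    using level_cover[of "cd u"] u by auto
  define B where "B = {e\<in>ext c. u \<subseteq> ext e}"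
  have "isset {e\<in>ext c. ext (cd u) \<subseteq> ext e}" using c u by (intro isset_Collect dfn_intros) auto
  then have "isset B" using u by (simp add: B_def)
  moreover have "e \<in> B" using e level_trans[OF c e] u by (simp add: B_def)
  ultimately obtain m where m: "m \<in> B" "ext m \<inter> B = {}" using foundation by blast
  then have mH: "m \<in> H" using ext_H by (auto simp: B_def)
  have "m \<in> S"
  proof (cases "ext m = {}")
    case True
    then have "m = cd {}" using mH cd_ext by metis
    then show ?thesis by simp
  next
    case False
    then obtain e' where e': "e' \<in> ext c" "ext m = Pow_set (ext e')"
      using m(1) c(2) False unfolding B_def level_chain_def isPow_iff by blast
    have "e' \<in> ext m" using e' ext_H by (auto simp: Pow_set_def)
    then have "\<not> u \<subseteq> ext e'" using m(2) e' by (auto simp: B_def)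
    then obtain a where "a \<in> S" "a \<notin> ext e'" using u by blast
    then have "e' \<in> S" using level_S[OF _ c] e' by blast
    then show ?thesis using S_Pow[of e'] e' cd_ext[OF mH] by simp
  qed
  moreover have "cd u \<in> Pow_set (ext m)" using u m(1) by (simp add: Pow_set_def B_def)
  ultimately show ?thesis using S_memD[OF S_Pow] mH by simp
qed

text \<open>A subset of \<open>S\<close> is the extension of a standard set, and standard sets are
  small.\<close>

lemma S_thin: "thin S"
  unfolding thin_def using S_small[OF S_cd] by simp


section \<open>Thin classes\<close>

lemma cd_inject: "isset A \<Longrightarrow> isset B \<Longrightarrow> cd A = cd B \<longleftrightarrow> A = B"
  using ext_cd by metis

text \<open>Compactness speaks about unions. As \<open>{z}\<close> is an element of every Kuratowski
  pair with first component \<open>z\<close>, a set of singletons is covered by the union of a class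
  of such pairs.\<close>

lemma isset_singletons:
  assumes "isset u" shows "isset ((\<lambda>z. cd {z}) ` u)"
proof (rule isset_replacement[OF assms, where R = "\<lambda>x y. ext y = {x}"])
  show "dfn H H (\<lambda>e. ext (e (Suc 0)) = {e 0})" by (intro dfn_intros) auto
  show "(ext y = {x}) = (y = cd {x})" if "x \<in> u" "y \<in> H" for x y
  proof -
    have "isset {x}" using that(1) isset_H[OF assms] by auto
    then show ?thesis using ext_cd cd_ext[OF that(2)] by metis
  qed
qed (use isset_H[OF assms] in auto)

definition pair :: "'a \<Rightarrow> 'a \<Rightarrow> 'a"
  where "pair x y = cd {cd {x}, cd {x, y}}"

lemma pair_H [simp]: "x \<in> H \<Longrightarrow> y \<in> H \<Longrightarrow> pair x y \<in> H"
  by (simp add: pair_def)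

lemma pr_inject: "pr g x y \<Longrightarrow> pr g x' y' \<Longrightarrow> x = x' \<and> y = y'"
  unfolding pr_def by (auto simp: doubleton_eq_iff)

lemma pr_pair [simp]: "x \<in> H \<Longrightarrow> y \<in> H \<Longrightarrow> pr (pair x y) x y"
  unfolding pr_def pair_def by simp

lemma pr_iff:
  assumes "g \<in> H" "x \<in> H" "y \<in> H"
  shows "pr g x y \<longleftrightarrow> g = pair x y"
proof
  assume "pr g x y"
  then obtain a b where ab: "a \<in> ext g" "b \<in> ext g" "ext a = {x}" "ext b = {x, y}" "ext g = {a, b}"
    unfolding pr_def by blast
  then have "a = cd {x}" "b = cd {x, y}" using cd_ext ext_H by metis+
  then show "g = pair x y" using ab(5) cd_ext[OF assms(1)] by (simp add: pair_def)
qed (use assms in simp)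

lemma thin_isclass [simp]: "thin A \<Longrightarrow> isclass A"
  by (simp add: thin_def)

lemma thin_small: "thin A \<Longrightarrow> B \<subseteq> A \<Longrightarrow> isset B \<Longrightarrow> small B"
  by (simp add: thin_def)

lemma small_isset: "small A \<Longrightarrow> B \<subseteq> A \<Longrightarrow> isclass B \<Longrightarrow> isset B"
  unfolding small_def by blast

lemma thin_subset: "thin A \<Longrightarrow> B \<subseteq> A \<Longrightarrow> isclass B \<Longrightarrow> thin B"
  unfolding thin_def by blast

lemma small_thin: "small A \<Longrightarrow> isset A \<Longrightarrow> thin A"
  unfolding thin_def by (blast intro: small_subset isset_isclass)

lemma thinI:
  assumes "isclass A" "\<And>B C. B \<subseteq> A \<Longrightarrow> isset B \<Longrightarrow> C \<subseteq> B \<Longrightarrow> isclass C \<Longrightarrow> isset C"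
  shows "thin A"
  using assms unfolding thin_def small_def by blast

lemma thin_superset:
  assumes "thin A" obtains v where "isset v" "A \<subseteq> v"
  using thin_ax[OF assms] isset_ext by blast

section \<open>Images, products and unions of thin classes\<close>

text \<open>When \<open>h\<close> has an inverse given by a set formula, no compactness is involved.
  A set inside the image is pulled back by separation, within a set \<open>v\<close> including
  \<open>X\<close>, to a set \<open>d\<close> inside \<open>X\<close>; this \<open>d\<close> is
  small, so the part \<open>D\<close> belonging to \<open>W\<close> is a set, and separation carries
  it forward again.\<close>

lemma thin_inj:
  assumes "thin X" "isclass (h ` X)" "dfn H H (\<lambda>e. R (e 0) (e (Suc 0)))"
    and h: "\<And>x z. x \<in> X \<Longrightarrow> z \<in> H \<Longrightarrow> R (h x) z \<longleftrightarrow> z = x"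
  shows "thin (h ` X)"
proof (rule thinI[OF assms(2)])
  fix w W assume w: "w \<subseteq> h ` X" "isset w" and W: "W \<subseteq> w" "isclass W"
  note R = dfn_sub2[OF assms(3)]
  have "dfn U U (\<lambda>e. e 0 \<in> H \<and> e (Suc 0) \<in> H \<and> R (e 0) (e (Suc 0)))"
    by (rule dfn_lift2[OF _ _ assms(3)]) auto
  then have RU: "dfn U U (\<lambda>e. s e \<in> H \<and> t e \<in> H \<and> R (s e) (t e))" if "trm U s" "trm U t" for s t
    using dfn_sub2[where R = "\<lambda>g x. g \<in> H \<and> x \<in> H \<and> R g x"] that by blast
  obtain v where v: "isset v" "X \<subseteq> v" using thin_superset[OF assms(1)] .
  have vH: "v \<subseteq> H" and WH: "W \<subseteq> H" using isset_H[OF v(1)] isclass_H[OF W(2)] by blast+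
  define d where "d = {x\<in>v. \<exists>g\<in>w. R g x}"
  have d: "isset d" unfolding d_def using v w by (intro isset_Collect dfn_intros R) auto
  have dX: "d \<subseteq> X"
  proof
    fix x assume "x \<in> d"
    then obtain z where "z \<in> X" "R (h z) x" "x \<in> H" using w(1) vH by (auto simp: d_def)
    then show "x \<in> X" using h by blast
  qed
  define D where "D = {x\<in>d. \<exists>g\<in>W. g \<in> H \<and> x \<in> H \<and> R g x}"
  have "isclass D" unfolding D_def using d W by (intro isclass_Collect dfn_bex RU trm_var) (auto simp: isset_isclass)
  then have D: "isset D" using small_isset[OF thin_small[OF assms(1) dX d], of D] by (auto simp: D_def)
  have D_iff: "x \<in> D \<longleftrightarrow> h x \<in> W" if "x \<in> X" for x
  proof
    assume "x \<in> D"
    then obtain g where g: "g \<in> W" "R g x" "x \<in> H" by (auto simp: D_def)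
    then obtain z where "z \<in> X" "g = h z" using w W by blast
    then show "h x \<in> W" using g h by metis
  next
    assume "h x \<in> W"
    moreover have "x \<in> v" "x \<in> H" using that v vH by blast+
    moreover have "R (h x) x" using h that \<open>x \<in> H\<close> by blast
    ultimately show "x \<in> D" using W WH unfolding D_def d_def by blast
  qed
  have "W = {g\<in>w. \<exists>x\<in>D. R g x}"
  proof (intro set_eqI)
    fix g
    show "g \<in> W \<longleftrightarrow> g \<in> {g\<in>w. \<exists>x\<in>D. R g x}"
    proof (cases "g \<in> w")
      case True
      then obtain x where x: "x \<in> X" "g = h x" using w by blast
      then have "R g z \<longleftrightarrow> z = x" if "z \<in> D" for z using h that dX v vH by (auto simp: D_def)
      then show ?thesis using True D_iff x by auto
    qed (use W in auto)
  qed
  then show "isset W" using isset_Collect[of w "\<lambda>g. \<exists>x\<in>D. R g x"] w D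
    by (simp add: dfn_bex R trm_var)
qed

text \<open>The graph is thin by \<open>thin_inj\<close>, since an argument can be read off from its
  pair by a set formula. For a set \<open>u\<close> of values, compactness selects a set
  \<open>w\<close> of pairs covering the singletons of \<open>u\<close>. It gives a set
  \<open>d\<close> of arguments, which is small by thinness of \<open>X\<close>; a subclass of
  \<open>u\<close> then corresponds to a subset of \<open>d\<close> and is recovered by separation
  through \<open>w\<close>.\<close>

lemma thin_image:
  assumes "thin X" "dfn U U (\<lambda>e. R (e 0) (e (Suc 0)))"
    and f: "\<And>x. x \<in> X \<Longrightarrow> f x \<in> H" "\<And>x y. x \<in> X \<Longrightarrow> y \<in> H \<Longrightarrow> R x y \<longleftrightarrow> y = f x"
  shows "thin (f ` X)"
proof (rule thinI)
  note R = dfn_sub2[OF assms(2)]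
  have XH: "X \<subseteq> H" using assms(1) isclass_H by auto
  have "f ` X = {y\<in>H. \<exists>x\<in>X. R x y}" using f by auto
  then show "isclass (f ` X)" using assms(1) by (simp, intro isclass_Collect dfn_intros R) auto
  fix u W assume u: "u \<subseteq> f ` X" "isset u" and W: "W \<subseteq> u" "isclass W"
  \<comment> \<open>The value stands first, so that its singleton is an element of the pair.\<close>
  let ?h = "\<lambda>x. pair (f x) x"
  define G where "G = ?h ` X"
  have G_eq: "G = {g\<in>H. \<exists>x\<in>X. \<exists>y\<in>H. R x y \<and> pr g y x}"
    using f XH by (auto simp: G_def pr_iff image_iff subset_iff)
  have "thin G" unfolding G_def
  proof (rule thin_inj[OF assms(1), where R = "\<lambda>g x. \<exists>y\<in>H. pr g y x"])
    show "isclass (?h ` X)" unfolding G_def[symmetric] G_eq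
      using assms(1) by (intro isclass_Collect dfn_intros R) auto
    show "dfn H H (\<lambda>e. \<exists>y\<in>H. pr (e 0) y (e (Suc 0)))" by (intro dfn_intros) auto
    show "(\<exists>y\<in>H. pr (?h x) y z) \<longleftrightarrow> z = x" if "x \<in> X" for x z
      using pr_pair[of "f x" x] pr_inject f(1)[OF that] XH that by blast
  qed
  define u' where "u' = (\<lambda>z. cd {z}) ` u"
  have uH: "u \<subseteq> H" by (rule isset_H[OF u(2)])
  have us: "isset u'" unfolding u'_def by (rule isset_singletons) fact
  have uG: "u' \<subseteq> \<Union> (ext ` G)"
  proof
    fix s assume "s \<in> u'"
    then obtain x where x: "x \<in> X" "s = cd {f x}" using u by (auto simp: u'_def)
    then have "s \<in> ext (pair (f x) x)" using f XH by (auto simp: pair_def)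
    then show "s \<in> \<Union> (ext ` G)" using x by (auto simp: G_def)
  qed
  obtain w where w: "w \<subseteq> G" "isset w" "u' \<subseteq> \<Union> (ext ` w)"
    using comp_ax[OF \<open>thin G\<close> us uG] by blast
  \<comment> \<open>\<open>{z}\<close> can also be the second element \<open>{f x, x}\<close> of the
    pair; then \<open>f x = x = z\<close>, so the conclusion is the same.\<close>
  have cover: "\<exists>x\<in>X. z = f x \<and> pair (f x) x \<in> w" if z: "z \<in> u" for z
  proof -
    have "cd {z} \<in> \<Union> (ext ` w)" using w z by (auto simp: u'_def)
    then obtain x where x: "x \<in> X" "pair (f x) x \<in> w" "cd {z} \<in> ext (pair (f x) x)"
      using w(1) by (auto simp: G_def)
    have H: "x \<in> H" "f x \<in> H" "z \<in> H" using x XH f z uH by blast+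
    then have "cd {z} = cd {f x} \<or> cd {z} = cd {f x, x}" using x(3) by (simp add: pair_def)
    then have "{z} = {f x} \<or> {z} = {f x, x}"
      using H by (simp add: cd_inject)
    then show ?thesis using x by auto
  qed
  obtain v where v: "isset v" "X \<subseteq> v" using thin_superset[OF assms(1)] .
  define d where "d = {x\<in>v. \<exists>g\<in>w. \<exists>y\<in>H. pr g y x}"
  have d: "isset d" unfolding d_def using v w by (intro isset_Collect dfn_intros) auto
  have dX: "d \<subseteq> X" using w(1) pr_inject unfolding d_def G_eq by blast
  define r where "r = {x\<in>d. \<exists>y\<in>W. R x y}"
  have "isclass r" unfolding r_def using d W by (intro isclass_Collect dfn_intros R) (auto simp: isset_isclass)
  then have r: "isset r" using small_isset[OF thin_small[OF assms(1) dX d], of r] by (auto simp: r_def)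
  have "W = {z\<in>u. \<exists>x\<in>r. \<exists>g\<in>w. pr g z x}"
  proof (intro equalityI subsetI)
    fix z assume z: "z \<in> W"
    then obtain x where x: "x \<in> X" "z = f x" "pair (f x) x \<in> w" using cover W by blast
    then have "pr (pair (f x) x) z x" "z \<in> H" using f XH by auto
    moreover have "x \<in> d" using x v calculation by (auto simp: d_def)
    moreover have "x \<in> r" using x f z calculation by (auto simp: r_def)
    ultimately show "z \<in> {z\<in>u. \<exists>x\<in>r. \<exists>g\<in>w. pr g z x}" using x z W by auto
  next
    fix z assume "z \<in> {z\<in>u. \<exists>x\<in>r. \<exists>g\<in>w. pr g z x}"
    then obtain x g y where x: "z \<in> u" "x \<in> d" "g \<in> w" "pr g z x" "y \<in> W" "R x y"
      by (auto simp: r_def)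
    have "y \<in> H" using x W uH by blast
    then have "y = f x" using x dX f by blast
    obtain x' where "x' \<in> X" "g = pair (f x') x'" using x w by (auto simp: G_def)
    then have "pr g (f x') x'" using f XH by auto
    then have "z = f x" using pr_inject[OF x(4)] by auto
    then show "z \<in> W" using x \<open>y = f x\<close> by simp
  qed
  then show "isset W" using isset_Collect[OF u(2), of "\<lambda>z. \<exists>x\<in>r. \<exists>g\<in>w. pr g z x"] r w
    by (simp add: dfn_bex dfn_pr trm_var)
qed

lemma dfn_cd:
  assumes "isset V" "dfn U U (\<lambda>e. Q (e 0) (e (Suc 0)))"
  shows "dfn U U (\<lambda>e. \<forall>y\<in>H. y \<in> ext (e (Suc 0)) \<longleftrightarrow> y \<in> V \<and> Q (e 0) y)"
  using assms(1) by (intro dfn_intros dfn_sub2[OF assms(2)]) auto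

lemma eq_cd_iff: "isset A \<Longrightarrow> y \<in> H \<Longrightarrow> y = cd A \<longleftrightarrow> ext y = A"
  using ext_cd cd_ext by metis

lemma eq_cd_Collect_iff:
  assumes "isset V" "isset {y\<in>V. Q y}" "s \<in> H"
  shows "(\<forall>y\<in>H. y \<in> ext s \<longleftrightarrow> y \<in> V \<and> Q y) \<longleftrightarrow> s = cd {y\<in>V. Q y}"
proof -
  have "(\<forall>y\<in>H. y \<in> ext s \<longleftrightarrow> y \<in> V \<and> Q y) \<longleftrightarrow> ext s = {y\<in>V. Q y}"
    using ext_H isset_H[OF assms(1)] by blast
  then show ?thesis using eq_cd_iff[OF assms(2,3)] by simp
qed

text \<open>Maps into sets are applied in this form: the bound \<open>V\<close> makes each value a
  set, and the graph is definable by comparing members, although \<open>cd\<close> is not a term of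
  the language.\<close>

lemma thin_image_cd:
  assumes "thin X" "isset V" "dfn U U (\<lambda>e. Q (e 0) (e (Suc 0)))"
    and Q: "\<And>x. x \<in> X \<Longrightarrow> isset {y\<in>V. Q x y}"
  shows "thin ((\<lambda>x. cd {y\<in>V. Q x y}) ` X)"
  by (rule thin_image[OF assms(1) dfn_cd[OF assms(2,3)]]) (simp_all add: Q assms(2) eq_cd_Collect_iff)

text \<open>On a small set, the graph of a class function is thin, and compactness turns it into a set.\<close>

lemma isset_image:
  assumes "small d" "isset d" "dfn U U (\<lambda>e. R (e 0) (e (Suc 0)))"
    and f: "\<And>x. x \<in> d \<Longrightarrow> f x \<in> H" "\<And>x y. x \<in> d \<Longrightarrow> y \<in> H \<Longrightarrow> R x y \<longleftrightarrow> y = f x"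
  shows "isset (f ` d)"
proof -
  have dH: "d \<subseteq> H" by (rule isset_H[OF assms(2)])
  let ?h = "\<lambda>x. pair x (f x)"
  define G where "G = ?h ` d"
  have G_eq: "G = {g\<in>H. \<exists>x\<in>d. \<exists>y\<in>H. R x y \<and> pr g x y}"
    using f dH by (auto simp: G_def pr_iff image_iff subset_iff)
  have "thin G" unfolding G_def
  proof (rule thin_inj[OF small_thin[OF assms(1,2)], where R = "\<lambda>g x. \<exists>y\<in>H. pr g x y"])
    show "isclass (?h ` d)" unfolding G_def[symmetric] G_eq
      using assms(2) by (intro isclass_Collect dfn_intros dfn_sub2[OF assms(3)]) auto
    show "dfn H H (\<lambda>e. \<exists>y\<in>H. pr (e 0) (e (Suc 0)) y)" by (intro dfn_intros) auto
    show "(\<exists>y\<in>H. pr (?h x) z y) \<longleftrightarrow> z = x" if "x \<in> d" for x z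
      using pr_pair[of x "f x"] pr_inject f(1)[OF that] dH that by blast
  qed
  define u where "u = (\<lambda>z. cd {z}) ` d"
  have us: "isset u" unfolding u_def by (rule isset_singletons) fact
  have uG: "u \<subseteq> \<Union> (ext ` G)"
  proof
    fix s assume "s \<in> u"
    then obtain x where x: "x \<in> d" "s = cd {x}" by (auto simp: u_def)
    then have "s \<in> ext (pair x (f x))" using f dH by (auto simp: pair_def)
    then show "s \<in> \<Union> (ext ` G)" using x by (auto simp: G_def)
  qed
  obtain w where w: "w \<subseteq> G" "isset w" "u \<subseteq> \<Union> (ext ` w)"
    using comp_ax[OF \<open>thin G\<close> us uG] by blast
  \<comment> \<open>Only the pair of \<open>z\<close> has the singleton of \<open>z\<close> in it,
    so a subcover cannot omit any pair.\<close>
  have "G \<subseteq> w"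
  proof
    fix g assume "g \<in> G"
    then obtain z where z: "z \<in> d" "g = pair z (f z)" by (auto simp: G_def)
    then have "cd {z} \<in> \<Union> (ext ` w)" using w(3) by (auto simp: u_def)
    then obtain x where x: "x \<in> d" "pair x (f x) \<in> w" "cd {z} \<in> ext (pair x (f x))"
      using w(1) by (auto simp: G_def)
    have H: "x \<in> H" "f x \<in> H" "z \<in> H" using x z dH f by blast+
    then have "cd {z} = cd {x} \<or> cd {z} = cd {x, f x}" using x(3) by (simp add: pair_def)
    then have "{z} = {x} \<or> {z} = {x, f x}"
      using H by (simp add: cd_inject)
    then show "g \<in> w" using x z by auto
  qed
  then have "isset G" using w by (simp add: subset_antisym)
  then have "isset {y\<in>\<Union> (ext ` \<Union> (ext ` G)). \<exists>g\<in>G. \<exists>x\<in>d. pr g x y}"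
    using assms(2) by (intro isset_Collect isset_Union dfn_intros) auto
  moreover have "{y\<in>\<Union> (ext ` \<Union> (ext ` G)). \<exists>g\<in>G. \<exists>x\<in>d. pr g x y} = f ` d"
  proof (intro equalityI subsetI)
    fix y assume "y \<in> {y\<in>\<Union> (ext ` \<Union> (ext ` G)). \<exists>g\<in>G. \<exists>x\<in>d. pr g x y}"
    then obtain x z where "x \<in> d" "z \<in> d" "pr (?h z) x y" by (auto simp: G_def)
    then show "y \<in> f ` d" using pr_inject[OF pr_pair[of z "f z"]] f(1) dH by blast
  next
    fix y assume "y \<in> f ` d"
    then obtain x where x: "x \<in> d" "y = f x" by blast
    then have xy: "x \<in> H" "y \<in> H" using f(1) dH by blast+
    then have "pr (?h x) x y" using x by simp
    moreover have "cd {x, y} \<in> ext (?h x)" "y \<in> ext (cd {x, y})" using x xy by (simp_all add: pair_def)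
    moreover have "?h x \<in> G" using x by (simp add: G_def)
    ultimately show "y \<in> {y\<in>\<Union> (ext ` \<Union> (ext ` G)). \<exists>g\<in>G. \<exists>x\<in>d. pr g x y}" using x(1) by blast
  qed
  ultimately show ?thesis by simp
qed

text \<open>The two projections of a set \<open>u\<close> of pairs are sets, hence small. For a
  subclass \<open>W\<close> of \<open>u\<close> every fibre over \<open>d\<close> is a set because
  \<open>r\<close> is small; the map from points to fibres has a set as its image because
  \<open>d\<close> is small; the union of that image is \<open>W\<close>.\<close>

lemma thin_product:
  assumes "thin X" "thin Y"
  shows "thin {g\<in>H. \<exists>x\<in>X. \<exists>y\<in>Y. pr g x y}" (is "thin ?G")
proof (rule thinI)
  show "isclass ?G" using assms by (intro isclass_Collect dfn_intros) auto
  have XY: "X \<subseteq> H" "Y \<subseteq> H" using assms isclass_H by auto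
  fix u W assume u: "u \<subseteq> ?G" "isset u" and W: "W \<subseteq> u" "isclass W"
  obtain vX where vX: "isset vX" "X \<subseteq> vX" using thin_superset[OF assms(1)] .
  obtain vY where vY: "isset vY" "Y \<subseteq> vY" using thin_superset[OF assms(2)] .
  define d where "d = {x\<in>vX. \<exists>g\<in>u. \<exists>y\<in>H. pr g x y}"
  have d: "isset d" unfolding d_def using vX u by (intro isset_Collect dfn_intros) auto
  have dX: "d \<subseteq> X" using u(1) pr_inject unfolding d_def by blast
  define r where "r = {y\<in>vY. \<exists>g\<in>u. \<exists>x\<in>H. pr g x y}"
  have r: "isset r" unfolding r_def using vY u by (intro isset_Collect dfn_intros) auto
  have rY: "r \<subseteq> Y" using u(1) pr_inject unfolding r_def by blast
  have small: "small d" "small r"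
    using thin_small[OF assms(1) dX d] thin_small[OF assms(2) rY r] by blast+
  define f where "f x = cd {g\<in>u. g \<in> W \<and> (\<exists>y\<in>H. pr g x y)}" for x
  have f: "isset {g\<in>u. g \<in> W \<and> (\<exists>y\<in>H. pr g x y)}" if x: "x \<in> d" for x
  proof -
    define F where "F = {y\<in>r. \<exists>g\<in>W. pr g x y}"
    have xH: "x \<in> H" using x isset_H[OF d] by blast
    have "isclass F" unfolding F_def using r W xH
      by (intro isclass_Collect dfn_intros) (auto intro: isset_isclass)
    then have F: "isset F" using small_isset[OF small(2), of F] by (auto simp: F_def)
    have "{g\<in>u. g \<in> W \<and> (\<exists>y\<in>H. pr g x y)} = {g\<in>u. \<exists>y\<in>F. pr g x y}"
    proof (intro equalityI subsetI)
      fix g assume "g \<in> {g\<in>u. g \<in> W \<and> (\<exists>y\<in>H. pr g x y)}"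
      then obtain y where g: "g \<in> u" "g \<in> W" "pr g x y" by blast
      then have "y \<in> vY" using u(1) vY(2) pr_inject by blast
      then have "y \<in> F" unfolding F_def r_def using g xH by blast
      then show "g \<in> {g\<in>u. \<exists>y\<in>F. pr g x y}" using g by blast
    next
      fix g assume "g \<in> {g\<in>u. \<exists>y\<in>F. pr g x y}"
      then obtain y g' where g: "g \<in> u" "pr g x y" "g' \<in> W" "pr g' x y" unfolding F_def by blast
      moreover have "y \<in> H" using g(2) pr_H by blast
      moreover have "g \<in> H" "g' \<in> H" using g u W by blast+
      ultimately show "g \<in> {g\<in>u. g \<in> W \<and> (\<exists>y\<in>H. pr g x y)}" using xH by (auto simp: pr_iff)
    qed
    then show ?thesis using isset_Collect[OF u(2), of "\<lambda>g. \<exists>y\<in>F. pr g x y"] F xH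
      by (simp add: dfn_bex dfn_pr trm_var trm_const)
  qed
  have "dfn U U (\<lambda>e. e (Suc 0) \<in> W \<and> (\<exists>y\<in>H. pr (e (Suc 0)) (e 0) y))"
    using W by (intro dfn_intros) auto
  from dfn_cd[OF u(2) this] have "isset (f ` d)"
    by (rule isset_image[OF small(1) d]) (simp_all add: f f_def u(2) eq_cd_Collect_iff)
  then have "isset (\<Union> (ext ` f ` d))" by (rule isset_Union)
  moreover have "\<Union> (ext ` f ` d) = W"
  proof -
    have ext_f: "ext (f x) = {g\<in>u. g \<in> W \<and> (\<exists>y\<in>H. pr g x y)}" if "x \<in> d" for x
      using f[OF that] by (simp add: f_def)
    have "\<exists>x\<in>d. \<exists>y\<in>H. pr g x y" if "g \<in> W" for g
      using that W u(1) vX(2) XY unfolding d_def by blast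
    then show ?thesis using ext_f W by fastforce
  qed
  ultimately show "isset W" by simp
qed

text \<open>A set inside the union cannot be split by separation, since \<open>X\<close> and
  \<open>Y\<close> are merely classes. The union is instead the image of a product with the two tags
  \<open>{}\<close> and \<open>{{}}\<close>, where the tag decides which component is returned. This
  requires both classes to be nonempty.\<close>

lemma thin_Un:
  assumes "thin X" "thin Y"
  shows "thin (X \<union> Y)"
proof (cases "X = {} \<or> Y = {}")
  case False
  define a where "a = cd {}"
  define b where "b = cd {a}"
  have ab: "a \<in> H" "b \<in> H" "ext a = {}" "ext b = {a}" by (simp_all add: a_def b_def)
  then have "a \<noteq> b" by auto
  have XY: "X \<subseteq> H" "Y \<subseteq> H" using assms isclass_H by auto
  have "small {a, b}" using ab(1,2) by (intro small_insert) (auto simp: small_def)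
  then have "thin {a, b}" using ab by (intro small_thin) auto
  define G where "G = {h\<in>H. \<exists>x\<in>X. \<exists>y\<in>Y. pr h x y}"
  define D where "D = {g\<in>H. \<exists>c\<in>{a, b}. \<exists>h\<in>G. pr g c h}"
  have G: "thin G" unfolding G_def by (rule thin_product[OF assms])
  have D: "thin D" unfolding D_def by (rule thin_product[OF \<open>thin {a, b}\<close> G])
  define R where "R g z \<longleftrightarrow> (\<exists>h\<in>G. \<exists>x\<in>X. \<exists>y\<in>Y. pr h x y \<and> (pr g a h \<and> z = x \<or> pr g b h \<and> z = y))" for g z
  define f where "f g = (THE z. R g z)" for g
  have R: "R g z \<longleftrightarrow> z = (if c = a then x else y)"
    if "c \<in> {a, b}" "h \<in> G" "x \<in> X" "y \<in> Y" "pr h x y" "pr g c h" for g c h x y z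
  proof
    assume "R g z"
    then show "z = (if c = a then x else y)"
      unfolding R_def using that pr_inject \<open>a \<noteq> b\<close> by (auto split: if_splits) blast+
  next
    assume "z = (if c = a then x else y)"
    then show "R g z" unfolding R_def using that by (auto split: if_splits)
  qed
  have f: "f g = (if c = a then x else y)"
    if "c \<in> {a, b}" "h \<in> G" "x \<in> X" "y \<in> Y" "pr h x y" "pr g c h" for g c h x y
    unfolding f_def R[OF that] by simp
  have "thin (f ` D)"
  proof (rule thin_image[OF D])
    show "dfn U U (\<lambda>e. R (e 0) (e (Suc 0)))"
      unfolding R_def using G assms ab by (intro dfn_intros) auto
    fix g assume "g \<in> D"
    then obtain c h x y where g: "c \<in> {a, b}" "h \<in> G" "x \<in> X" "y \<in> Y" "pr h x y" "pr g c h"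
      unfolding D_def G_def by blast
    show "f g \<in> H" using f[OF g] g XY by auto
    show "R g z \<longleftrightarrow> z = f g" for z using R[OF g] f[OF g] by simp
  qed
  moreover have "f ` D = X \<union> Y"
  proof (intro equalityI subsetI)
    fix z assume "z \<in> f ` D"
    then obtain g c h x y where "z = f g" "c \<in> {a, b}" "h \<in> G" "x \<in> X" "y \<in> Y" "pr h x y" "pr g c h"
      unfolding D_def G_def by blast
    then show "z \<in> X \<union> Y" using f by (auto split: if_splits)
  next
    fix z assume "z \<in> X \<union> Y"
    then obtain c x y where z: "c \<in> {a, b}" "x \<in> X" "y \<in> Y" "z = (if c = a then x else y)"
      using False \<open>a \<noteq> b\<close> by fastforce
    then have H: "c \<in> H" "x \<in> H" "y \<in> H" using XY ab by auto
    then have "pr (pair x y) x y" "pr (pair c (pair x y)) c (pair x y)"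
      "pair x y \<in> H" "pair c (pair x y) \<in> H" by simp_all
    moreover from this have h: "pair x y \<in> G" using z unfolding G_def by blast
    ultimately have "pair c (pair x y) \<in> D" unfolding D_def using z(1) by blast
    moreover have "f (pair c (pair x y)) = z" using f[OF z(1) h z(2,3)] H z(4) by simp
    ultimately show "z \<in> f ` D" by blast
  qed
  ultimately show ?thesis by simp
qed (use assms in auto)

section \<open>Separation of thin classes by compactness\<close>

text \<open>Without such a \<open>t\<close>, every subset of \<open>v\<close> omits a point
  \<open>x\<close> of \<open>T\<close> or meets some \<open>d\<close> in \<open>D\<close>. Thus the
  power set of \<open>v\<close> is covered by the sets \<open>b x\<close> of subsets omitting
  \<open>x\<close> and \<open>c d\<close> of subsets meeting \<open>d\<close>. The points
  \<open>x\<close> whose \<open>b x\<close> is chosen by a set subcover form a subset of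
  \<open>T\<close>, which contains all these points and meets no \<open>d\<close>, so it is not
  covered.\<close>

lemma thin_separation:
  assumes T: "thin T" and D: "thin D" and disj: "\<And>d. d \<in> D \<Longrightarrow> ext d \<inter> T = {}"
  shows "\<exists>t. isset t \<and> T \<subseteq> t \<and> (\<forall>d\<in>D. ext d \<inter> t = {})"
proof (rule ccontr)
  assume no: "\<not> ?thesis"
  obtain v where v: "isset v" "T \<subseteq> v" using thin_superset[OF T] .
  have TD: "T \<subseteq> H" "D \<subseteq> H" using T D isclass_H by auto
  define b where "b x = cd {y\<in>Pow_set v. x \<notin> ext y}" for x
  define c where "c d = cd {y\<in>Pow_set v. \<exists>z\<in>ext d. z \<in> ext y}" for d
  have isb: "isset {y\<in>Pow_set v. x \<notin> ext y}" if "x \<in> H" for x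
    using v(1) that by (intro isset_Collect dfn_intros) auto
  have isc: "isset {y\<in>Pow_set v. \<exists>z\<in>ext d. z \<in> ext y}" if "d \<in> H" for d
    using v(1) that by (intro isset_Collect dfn_intros) auto
  have b: "b x \<in> H" "ext (b x) = {y\<in>Pow_set v. x \<notin> ext y}" if "x \<in> H" for x
    using isb[OF that] by (simp_all add: b_def)
  have c: "c d \<in> H" "ext (c d) = {y\<in>Pow_set v. \<exists>z\<in>ext d. z \<in> ext y}" if "d \<in> H" for d
    using isc[OF that] by (simp_all add: c_def)
  \<comment> \<open>A set formula for \<open>s = b x\<close>, needed because \<open>y\<close> below
    is formed by separation.\<close>
  define is_b where "is_b s x \<longleftrightarrow> (\<forall>y\<in>H. y \<in> ext s \<longleftrightarrow> y \<in> Pow_set v \<and> x \<notin> ext y)" for s x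
  have is_b: "is_b s x \<longleftrightarrow> s = b x" if "x \<in> H" "s \<in> H" for s x
    unfolding is_b_def b_def using eq_cd_Collect_iff[OF isset_Pow[OF v(1)] isb] that by simp
  have "thin (b ` T)" unfolding b_def
    using v TD isb by (intro thin_image_cd T dfn_intros) auto
  moreover have "thin (c ` D)" unfolding c_def
    using v TD isc by (intro thin_image_cd D dfn_intros) auto
  ultimately have Y: "thin (b ` T \<union> c ` D)" by (rule thin_Un)
  have "Pow_set v \<subseteq> \<Union> (ext ` (b ` T \<union> c ` D))"
  proof
    fix y assume y: "y \<in> Pow_set v"
    then have "y \<in> H" by (simp add: Pow_set_def)
    then consider x where "x \<in> T" "x \<notin> ext y" | d z where "d \<in> D" "z \<in> ext d" "z \<in> ext y"
      using no isset_ext by blast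
    then show "y \<in> \<Union> (ext ` (b ` T \<union> c ` D))"
    proof cases
      case (1 x)
      then have "y \<in> ext (b x)" using b(2)[of x] y TD by blast
      then show ?thesis using 1 by blast
    next
      case (2 d z)
      then have "y \<in> ext (c d)" using c(2)[of d] y TD by blast
      then show ?thesis using 2 by blast
    qed
  qed
  then obtain w where w: "w \<subseteq> b ` T \<union> c ` D" "isset w" "Pow_set v \<subseteq> \<Union> (ext ` w)"
    using comp_ax[OF Y isset_Pow[OF v(1)]] by blast
  define y where "y = {x\<in>v. \<exists>s\<in>w. is_b s x}"
  have y: "isset y" unfolding y_def is_b_def using v w by (intro isset_Collect dfn_intros) auto
  have empty_mem: "cd {} \<in> ext (b x)" if "x \<in> H" for x
    using b(2)[OF that] by (simp add: Pow_set_def)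
  \<comment> \<open>The chosen sets determine their points: \<open>{x}\<close> distinguishes
    \<open>b x'\<close> from \<open>b x\<close> for different \<open>x'\<close>, and the empty set
    lies in every \<open>b x\<close> but in no \<open>c d\<close>.\<close>
  have yT: "y \<subseteq> T"
  proof
    fix x assume "x \<in> y"
    then obtain s where s: "s \<in> w" "is_b s x" "x \<in> v" by (auto simp: y_def)
    then have H: "x \<in> H" "s \<in> H" using isset_H v w by blast+
    then have sx: "s = b x" using is_b s by blast
    from s w consider x' where "x' \<in> T" "s = b x'" | d where "d \<in> D" "s = c d" by blast
    then show "x \<in> T"
    proof cases
      case (1 x')
      then have "x' \<in> H" using TD by blast
      have "isset {x}" using H by simp
      show ?thesis
      proof (rule ccontr)
        assume "x \<notin> T"
        then have "cd {x} \<in> ext (b x')"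
          using b(2)[OF \<open>x' \<in> H\<close>] 1 \<open>isset {x}\<close> s by (auto simp: Pow_set_def)
        moreover have "cd {x} \<notin> ext (b x)" using b(2)[OF H(1)] \<open>isset {x}\<close> by auto
        ultimately show False using 1 sx by simp
      qed
    next
      case (2 d)
      then have "cd {} \<notin> ext s" using c(2)[of d] TD by auto
      then show ?thesis using sx empty_mem[OF H(1)] by simp
    qed
  qed
  have "cd y \<in> Pow_set v" using y by (auto simp: Pow_set_def y_def)
  then obtain s where s: "s \<in> w" "cd y \<in> ext s" using w(3) by blast
  from s w consider x where "x \<in> T" "s = b x" | d where "d \<in> D" "s = c d" by blast
  then show False
  proof cases
    case (1 x)
    then have H: "x \<in> H" "s \<in> H" using TD s(1) isset_H[OF w(2)] by blast+
    then have "x \<in> y" using 1 s v is_b unfolding y_def by blast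
    moreover have "x \<notin> y" using s(2) 1 b(2)[OF H(1)] y by auto
    ultimately show False by blast
  next
    case (2 d)
    moreover have "d \<in> H" using 2 TD by blast
    ultimately have "ext d \<inter> y \<noteq> {}" using s(2) c(2)[of d] y by auto
    then show False using yT disj[OF 2(1)] by blast
  qed
qed

text \<open>Separate \<open>A\<close> from the singletons of the remaining elements of
  \<open>T\<close>.\<close>

lemma subclass_trace:
  assumes "thin T" "A \<subseteq> T" "isclass A"
  shows "\<exists>t. isset t \<and> t \<inter> T = A"
proof -
  have TH: "T \<subseteq> H" using assms isclass_H by auto
  have "isclass {x\<in>T. x \<notin> A}" using assms by (intro isclass_Collect dfn_intros) auto
  then have TA: "thin {x\<in>T. x \<notin> A}" by (intro thin_subset[OF assms(1)]) auto
  obtain v where v: "isset v" "T \<subseteq> v" using thin_superset[OF assms(1)] .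
  \<comment> \<open>Writes the singleton with a bound \<open>v\<close>, the form demanded by
    \<open>thin_image_cd\<close>.\<close>
  have single: "{y\<in>v. y = x} = {x}" if "x \<in> T" for x using that v by auto
  have "thin ((\<lambda>x. cd {y\<in>v. y = x}) ` {x\<in>T. x \<notin> A})"
    using single TH by (intro thin_image_cd TA v dfn_intros) auto
  moreover have "(\<lambda>x. cd {y\<in>v. y = x}) ` {x\<in>T. x \<notin> A} = (\<lambda>x. cd {x}) ` {x\<in>T. x \<notin> A}"
    using single by (intro image_cong) auto
  moreover have "ext (cd {x}) = {x}" if "x \<in> T" for x using that TH by auto
  ultimately have "\<exists>t. isset t \<and> A \<subseteq> t \<and> (\<forall>d\<in>(\<lambda>x. cd {x}) ` {x\<in>T. x \<notin> A}. ext d \<inter> t = {})"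
    by (intro thin_separation thin_subset[OF assms]) auto
  then obtain t where t: "isset t" "A \<subseteq> t" "\<And>x. x \<in> T \<Longrightarrow> x \<notin> A \<Longrightarrow> ext (cd {x}) \<inter> t = {}"
    by auto
  then have "t \<inter> T = A" using \<open>\<And>x. x \<in> T \<Longrightarrow> ext (cd {x}) = {x}\<close> assms(2) by fastforce
  then show ?thesis using t(1) by blast
qed


section \<open>A cumulative hierarchy of thin classes\<close>

text \<open>Extensionality is required for traces on \<open>T\<close>, because members outside the
  final model do not count there.\<close>

definition good :: "'a set \<Rightarrow> bool"
  where "good T \<longleftrightarrow> thin T \<and> (\<forall>x\<in>T. \<forall>y\<in>T. ext x \<inter> T = ext y \<inter> T \<longrightarrow> x = y)"

definition step :: "'a set \<Rightarrow> 'a set \<Rightarrow> bool"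
  where "step T T' \<longleftrightarrow> T \<subseteq> T' \<and> (\<forall>y\<in>T'. ext y \<inter> T' \<subseteq> T) \<and>
    (\<forall>X\<in>U. ext X \<subseteq> T \<longrightarrow> (\<exists>y\<in>T'. ext y \<inter> T' = ext X))"

lemma good_S: "good S"
  unfolding good_def
proof (intro conjI ballI impI S_thin)
  fix x y assume "x \<in> S" "y \<in> S" "ext x \<inter> S = ext y \<inter> S"
  then show "x = y" using S_trans[of x] S_trans[of y] H_ext[of x y] by (simp add: Int_absorb2)
qed

lemma trace_codes:
  assumes "thin T"
  obtains P t where "thin P" "isset t" "T \<subseteq> t"
    "\<And>A. A \<subseteq> T \<Longrightarrow> isclass A \<Longrightarrow> \<exists>p\<in>P. ext p \<inter> T = A"
    "\<And>p q. p \<in> P \<Longrightarrow> q \<in> P \<Longrightarrow> ext p \<inter> T = ext q \<inter> T \<Longrightarrow> ext p \<inter> t = ext q \<inter> t"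
proof -
  obtain P where P: "thin P" "\<And>y. y \<in> H \<Longrightarrow> \<exists>p\<in>P. ext y \<inter> T = ext p \<inter> T"
    using exp_ax[OF assms] by blast
  have PH: "P \<subseteq> H" using P isclass_H by auto
  \<comment> \<open>(Exp) provides codes for traces of sets only; \<open>subclass_trace\<close>
    shows that every subclass is such a trace.\<close>
  have codes: "\<exists>p\<in>P. ext p \<inter> T = A" if A: "A \<subseteq> T" "isclass A" for A
  proof -
    obtain t where "isset t" "t \<inter> T = A" using subclass_trace[OF assms A] by blast
    then show ?thesis using P(2)[of "cd t"] by auto
  qed
  define G where "G = {g\<in>H. \<exists>p\<in>P. \<exists>q\<in>P. pr g p q}"
  define X where "X = {g\<in>G. \<exists>p\<in>P. \<exists>q\<in>P. pr g p q \<and> (\<forall>z\<in>T. z \<in> ext p \<longleftrightarrow> z \<in> ext q)}"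
  have G: "thin G" unfolding G_def using P by (intro thin_product)
  have "isclass X" unfolding X_def using assms P G by (intro isclass_Collect dfn_intros) auto
  then have X: "thin X" by (intro thin_subset[OF G]) (auto simp: X_def)
  obtain v where v: "isset v" "P \<subseteq> v" using thin_superset[OF P(1)] .
  \<comment> \<open>A common bound for the elements of all codes, so that symmetric differences are
    sets obtained by separation.\<close>
  define V where "V = \<Union> (ext ` v)"
  have V: "isset V" "\<And>p. p \<in> P \<Longrightarrow> ext p \<subseteq> V" using v by (auto simp: V_def)
  define Q where "Q g z \<longleftrightarrow> (\<exists>p\<in>P. \<exists>q\<in>P. pr g p q \<and> (z \<in> ext p \<longleftrightarrow> z \<notin> ext q))" for g z
  have Q: "{z\<in>V. Q g z} = {z\<in>V. z \<in> ext p \<longleftrightarrow> z \<notin> ext q}" if "p \<in> P" "q \<in> P" "pr g p q" for g p q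
    unfolding Q_def using that pr_inject by blast
  have isset_diff: "isset {z\<in>V. z \<in> ext p \<longleftrightarrow> z \<notin> ext q}" if "p \<in> P" "q \<in> P" for p q
    using V(1) that PH by (intro isset_Collect dfn_intros) auto
  define f where "f g = cd {z\<in>V. Q g z}" for g
  have f: "ext (f g) = {z\<in>V. z \<in> ext p \<longleftrightarrow> z \<notin> ext q}" if "p \<in> P" "q \<in> P" "pr g p q" for g p q
    using isset_diff[OF that(1,2)] unfolding f_def Q[OF that] by simp
  have "thin (f ` X)" unfolding f_def
  proof (rule thin_image_cd[OF X V(1)])
    show "dfn U U (\<lambda>e. Q (e 0) (e (Suc 0)))" unfolding Q_def using P(1) by (intro dfn_intros) auto
    show "isset {z\<in>V. Q g z}" if "g \<in> X" for g
      using that Q isset_diff unfolding X_def by fastforce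
  qed
  moreover have "ext d \<inter> T = {}" if "d \<in> f ` X" for d
    using that f unfolding X_def by fastforce
  ultimately obtain t where t: "isset t" "T \<subseteq> t" "\<And>d. d \<in> f ` X \<Longrightarrow> ext d \<inter> t = {}"
    using thin_separation[OF assms, of "f ` X"] by blast
  have same: "ext p \<inter> t = ext q \<inter> t" if pq: "p \<in> P" "q \<in> P" "ext p \<inter> T = ext q \<inter> T" for p q
  proof -
    have H: "p \<in> H" "q \<in> H" using pq PH by blast+
    then have "pair p q \<in> H" "pr (pair p q) p q" by simp_all
    then have "pair p q \<in> X" using pq unfolding X_def G_def by blast
    then have "ext (f (pair p q)) \<inter> t = {}" using t(3) by blast
    then show ?thesis using f[OF pq(1,2) \<open>pr (pair p q) p q\<close>] V(2) pq(1,2) by blast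
  qed
  show thesis by (rule that[OF P(1) t(1,2) codes same])
qed

lemma step_exists:
  assumes "good T"
  shows "\<exists>T'. good T' \<and> step T T'"
proof -
  have T: "thin T" and T_ext: "\<And>x y. x \<in> T \<Longrightarrow> y \<in> T \<Longrightarrow> ext x \<inter> T = ext y \<inter> T \<Longrightarrow> x = y"
    using assms unfolding good_def by blast+
  have TH: "T \<subseteq> H" using T isclass_H by auto
  obtain P t where P: "thin P" and t: "isset t" "T \<subseteq> t"
    and codes: "\<And>A. A \<subseteq> T \<Longrightarrow> isclass A \<Longrightarrow> \<exists>p\<in>P. ext p \<inter> T = A"
    and same: "\<And>p q. p \<in> P \<Longrightarrow> q \<in> P \<Longrightarrow> ext p \<inter> T = ext q \<inter> T \<Longrightarrow> ext p \<inter> t = ext q \<inter> t"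
    by (rule trace_codes[OF T]) blast
  have PH: "P \<subseteq> H" using P isclass_H by auto
  define v where "v = cd t"
  have v: "v \<in> H" "ext v = t" using t by (simp_all add: v_def)
  \<comment> \<open>Only codes whose trace is not already that of an old element give new elements;
    otherwise a trace would be taken twice.\<close>
  define Q where "Q = {p\<in>P. \<forall>y\<in>T. \<not> (\<forall>z\<in>T. z \<in> ext y \<longleftrightarrow> z \<in> ext p)}"
  have "isclass Q" unfolding Q_def using P T by (intro isclass_Collect dfn_intros) auto
  then have Q: "thin Q" by (intro thin_subset[OF P]) (auto simp: Q_def)
  \<comment> \<open>The new element is \<open>p\<close> cut down to \<open>t\<close>, with the
    marker \<open>v\<close> added. Cutting makes it depend on the trace of \<open>p\<close> alone;
    the marker puts \<open>v\<close> into every new element.\<close>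
  define f where "f p = cd {z\<in>insert v t. z = v \<or> z \<in> ext p}" for p
  have isf: "isset {z\<in>insert v t. z = v \<or> z \<in> ext p}" if "p \<in> P" for p
    using that PH t v by (intro isset_Collect dfn_intros) auto
  have f: "f p \<in> H" "ext (f p) = insert v (ext p \<inter> t)" if "p \<in> P" for p
    using isf[OF that] unfolding f_def by auto
  define C where "C = f ` Q"
  have C: "thin C" unfolding C_def f_def
    using isf t v by (intro thin_image_cd Q dfn_intros) (auto simp: Q_def)
  define T' where "T' = T \<union> C"
  have vT: "v \<notin> T" using v(2) t(2) no_1cycle by blast
  have memC: "v \<in> ext c" if "c \<in> C" for c using that f by (auto simp: C_def Q_def)
  \<comment> \<open>A new element inside \<open>t\<close> would be a member of its own member
    \<open>v\<close>. In \<open>ext_T\<close>, a new element \<open>c\<close> inside an old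
    \<open>y\<close> would close the cycle of \<open>v\<close> in \<open>c\<close>, \<open>c\<close>
    in \<open>y\<close>, \<open>y\<close> in \<open>v\<close>.\<close>
  have CT: "c \<notin> t" if "c \<in> C" for c
    using memC[OF that] v(2) no_2cycle by blast
  have ext_T: "ext y \<inter> C = {}" if "y \<in> T" for y
  proof (rule ccontr)
    assume "ext y \<inter> C \<noteq> {}"
    then obtain c where "c \<in> ext y" "v \<in> ext c" using memC by blast
    moreover have "y \<in> ext v" using that t v by blast
    ultimately show False using no_3cycle by blast
  qed
  have ext_C: "ext (f p) \<inter> T' = ext p \<inter> T" if "p \<in> Q" for p
  proof -
    have p: "p \<in> P" "f p \<in> C" using that by (auto simp: Q_def C_def)
    have "v \<notin> C" using memC no_1cycle by blast
    then show ?thesis using f(2)[OF p(1)] vT t(2) unfolding T'_def by (auto dest: CT)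
  qed
  have T'T: "ext y \<inter> T' = ext y \<inter> T" if "y \<in> T'" for y
    using that ext_T[of y] ext_C unfolding T'_def C_def by auto
  have "step T T'" unfolding step_def
  proof (intro conjI ballI impI)
    show "T \<subseteq> T'" by (simp add: T'_def)
    show "ext y \<inter> T' \<subseteq> T" if "y \<in> T'" for y using T'T[OF that] by blast
    fix X assume X: "X \<in> U" "ext X \<subseteq> T"
    then obtain p where p: "p \<in> P" "ext p \<inter> T = ext X" using codes[OF X(2) isclass_ext] by blast
    show "\<exists>y\<in>T'. ext y \<inter> T' = ext X"
    proof (cases "p \<in> Q")
      case True
      then show ?thesis using ext_C[OF True] p by (intro bexI[of _ "f p"]) (auto simp: T'_def C_def)
    next
      case False
      then obtain y where y: "y \<in> T" "\<forall>z\<in>T. z \<in> ext y \<longleftrightarrow> z \<in> ext p" using p by (auto simp: Q_def)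
      then have "ext y \<inter> T' = ext X" using T'T[of y] p by (auto simp: T'_def)
      then show ?thesis using y by (auto simp: T'_def)
    qed
  qed
  moreover have "good T'" unfolding good_def
  proof (intro conjI ballI impI)
    show "thin T'" unfolding T'_def by (rule thin_Un[OF T C])
    have mixed: False if "x \<in> T" "p \<in> Q" "ext x \<inter> T = ext p \<inter> T" for x p
      using that unfolding Q_def by blast
    fix x y assume xy: "x \<in> T'" "y \<in> T'" "ext x \<inter> T' = ext y \<inter> T'"
    then have eq: "ext x \<inter> T = ext y \<inter> T" using T'T by simp
    have C_trace: "\<exists>p\<in>Q. c = f p \<and> ext c \<inter> T = ext p \<inter> T" if "c \<in> C" for c
      using that ext_C T'T[of c] unfolding C_def T'_def by auto
    show "x = y"
    proof (cases "x \<in> T"; cases "y \<in> T")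
      assume "x \<in> T" "y \<in> T"
      then show ?thesis using T_ext eq by blast
    next
      assume "x \<in> T" "y \<notin> T"
      then obtain p where "p \<in> Q" "ext y \<inter> T = ext p \<inter> T" using C_trace[of y] xy by (auto simp: T'_def)
      then show ?thesis using mixed[OF \<open>x \<in> T\<close>, of p] eq by simp
    next
      assume "x \<notin> T" "y \<in> T"
      then obtain p where "p \<in> Q" "ext x \<inter> T = ext p \<inter> T" using C_trace[of x] xy by (auto simp: T'_def)
      then show ?thesis using mixed[OF \<open>y \<in> T\<close>, of p] eq by simp
    next
      assume "x \<notin> T" "y \<notin> T"
      then obtain p q where pq: "p \<in> Q" "x = f p" "q \<in> Q" "y = f q" "ext p \<inter> T = ext q \<inter> T"
        using C_trace[of x] C_trace[of y] xy eq by (auto simp: T'_def)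
      then have "ext p \<inter> t = ext q \<inter> t" "p \<in> P" "q \<in> P" using same by (auto simp: Q_def)
      then have "ext x = ext y" "x \<in> H" "y \<in> H" using f pq by auto
      then show ?thesis by (intro H_ext)
    qed
  qed
  ultimately show ?thesis by blast
qed

section \<open>Standard natural numbers as indices of the levels\<close>

definition suc :: "'a \<Rightarrow> 'a"
  where "suc n = cd (insert n (ext n))"

lemma SN_H: "n \<in> SN \<Longrightarrow> n \<in> H"
  by (simp add: SN_def)

lemma suc_H [simp]: "n \<in> H \<Longrightarrow> suc n \<in> H" "n \<in> H \<Longrightarrow> ext (suc n) = insert n (ext n)"
  by (simp_all add: suc_def)

lemma SN_zero [simp]: "cd {} \<in> SN"
  unfolding SN_def inductive_cls_def by (auto, metis cd_ext ext_H)

lemma SN_suc [simp]: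
  assumes "n \<in> SN" shows "suc n \<in> SN"
proof -
  have "suc n \<in> ext X" if X: "X \<in> U" "inductive_cls (ext X)" for X
  proof -
    have "n \<in> ext X" using assms X by (auto simp: SN_def)
    then obtain c where "c \<in> ext X" "ext c = insert n (ext n)"
      using X(2) unfolding inductive_cls_def by blast
    then show ?thesis unfolding suc_def by (metis cd_ext ext_H)
  qed
  then show ?thesis using SN_H[OF assms] by (simp add: SN_def)
qed

lemma SN_class [simp]: "isclass SN"
proof -
  have "isclass {x\<in>H. \<forall>X\<in>U. inductive_cls (ext X) \<longrightarrow> x \<in> ext X}"
    unfolding inductive_cls_def by (intro isclass_Collect dfn_intros) auto
  then show ?thesis by (simp add: SN_def)
qed

lemma SN_induct [consumes 1, case_names dfn zero suc]:
  assumes "x \<in> SN" "dfn U U (\<lambda>e. P (e 0))" "P (cd {})"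
    "\<And>n. n \<in> SN \<Longrightarrow> P n \<Longrightarrow> P (suc n)"
  shows "P x"
proof -
  have "isclass {x\<in>SN. P x}" by (rule isclass_Collect[OF SN_class assms(2)])
  moreover have "inductive_cls {x\<in>SN. P x}" unfolding inductive_cls_def
  proof (intro conjI ballI)
    show "\<exists>e\<in>{x\<in>SN. P x}. ext e = {}" using assms(3) by (intro bexI[of _ "cd {}"]) auto
    show "\<exists>s\<in>{x\<in>SN. P x}. ext s = insert m (ext m)" if "m \<in> {x\<in>SN. P x}" for m
      using that assms(4) SN_H by (intro bexI[of _ "suc m"]) auto
  qed
  ultimately have "SN \<subseteq> {x\<in>SN. P x}" unfolding isclass_def SN_def by auto
  then show ?thesis using assms(1) by blast
qed

lemma SN_zero_least: "n \<in> SN \<Longrightarrow> n = cd {} \<or> cd {} \<in> ext n"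
proof (induction rule: SN_induct)
  case dfn
  show ?case by (intro dfn_intros) auto
next
  case (suc n)
  then show ?case using SN_H by auto
qed simp

text \<open>The successor is given by its extension rather than by \<open>suc m\<close>, so that the
  statement stays definable for the induction.\<close>

lemma SN_suc_le: "n \<in> SN \<Longrightarrow> \<forall>m\<in>ext n. \<exists>s\<in>H. ext s = insert m (ext m) \<and> (s = n \<or> s \<in> ext n)"
proof (induction rule: SN_induct)
  case dfn
  show ?case by (intro dfn_intros) auto
next
  case (suc n)
  have H: "n \<in> H" using suc SN_H by blast
  show ?case
  proof
    fix m assume "m \<in> ext (suc n)"
    then consider "m = n" | "m \<in> ext n" using H by auto
    then show "\<exists>s\<in>H. ext s = insert m (ext m) \<and> (s = suc n \<or> s \<in> ext (suc n))"
    proof cases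
      case 1
      then show ?thesis using H by (intro bexI[of _ "suc n"]) auto
    next
      case 2
      then show ?thesis using suc.IH H by auto
    qed
  qed
qed simp

lemma SN_linear:
  assumes "m \<in> SN" shows "\<forall>n\<in>SN. m \<in> ext n \<or> m = n \<or> n \<in> ext m"
  using assms
proof (induction rule: SN_induct)
  case dfn
  show ?case by (intro dfn_intros) auto
next
  case zero
  then show ?case using SN_zero_least by auto
next
  case (suc m)
  have H: "m \<in> H" using suc SN_H by blast
  show ?case
  proof
    fix n assume n: "n \<in> SN"
    have "suc m = n \<or> suc m \<in> ext n" if m: "m \<in> ext n"
    proof -
      obtain s where "s \<in> H" "ext s = insert m (ext m)" "s = n \<or> s \<in> ext n"
        using SN_suc_le[OF n] m by blast
      then show ?thesis unfolding suc_def by (metis cd_ext)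
    qed
    then show "suc m \<in> ext n \<or> suc m = n \<or> n \<in> ext (suc m)" using suc.IH n H by auto
  qed
qed

lemma dfn_good: "dfn U U (\<lambda>e. good (ext (e 0)))"
proof (rule dfn_cong[rotated])
  fix e :: "nat \<Rightarrow> 'a"
  assume e: "e \<in> envs U"
  have "thin (ext (e 0)) \<longleftrightarrow> (\<forall>B\<in>U. ext B \<subseteq> ext (e 0) \<longrightarrow> B \<in> H \<longrightarrow> (\<forall>C\<in>U. ext C \<subseteq> ext B \<longrightarrow> C \<in> H))"
    unfolding thin_def small_ext_iff[symmetric] using e by (auto simp: envsD isset_def)
  moreover have "ext x \<inter> T = ext y \<inter> T \<longleftrightarrow> (\<forall>z\<in>T. z \<in> ext x \<longleftrightarrow> z \<in> ext y)" for x y T by blast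
  ultimately show "good (ext (e 0)) = ((\<forall>B\<in>U. ext B \<subseteq> ext (e 0) \<longrightarrow> B \<in> H \<longrightarrow> (\<forall>C\<in>U. ext C \<subseteq> ext B \<longrightarrow> C \<in> H)) \<and>
    (\<forall>x\<in>ext (e 0). \<forall>y\<in>ext (e 0). (\<forall>z\<in>ext (e 0). z \<in> ext x \<longleftrightarrow> z \<in> ext y) \<longrightarrow> x = y))"
    unfolding good_def by simp
qed (intro dfn_intros; simp)

lemma dfn_step: "dfn U U (\<lambda>e. step (ext (e 0)) (ext (e (Suc 0))))"
proof (rule dfn_cong[rotated])
  fix e :: "nat \<Rightarrow> 'a"
  have "ext y \<inter> T = ext X \<longleftrightarrow> (\<forall>z\<in>U. z \<in> ext y \<and> z \<in> T \<longleftrightarrow> z \<in> ext X)" for y T X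
    using ext_U by blast
  then show "step (ext (e 0)) (ext (e (Suc 0))) = (ext (e 0) \<subseteq> ext (e (Suc 0)) \<and>
    (\<forall>y\<in>ext (e (Suc 0)). \<forall>z\<in>ext (e (Suc 0)). z \<in> ext y \<longrightarrow> z \<in> ext (e 0)) \<and>
    (\<forall>X\<in>U. ext X \<subseteq> ext (e 0) \<longrightarrow>
      (\<exists>y\<in>ext (e (Suc 0)). \<forall>z\<in>U. z \<in> ext y \<and> z \<in> ext (e (Suc 0)) \<longleftrightarrow> z \<in> ext X)))"
    unfolding step_def by auto
qed (intro dfn_intros; simp)

lemma isclass_section: "Z \<in> U \<Longrightarrow> n \<in> U \<Longrightarrow> isclass (section_cls (ext Z) n)"
  unfolding section_cls_def by (intro isclass_Collect dfn_intros) auto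

end

text \<open>The locale collects what the union \<open>K\<close> of the levels needs in order to satisfy, with the true
  membership relation, the axioms of Zermelo set theory.\<close>

locale hierarchy = ths +
  fixes K :: "'a set" and \<T> :: "'a set set"
  assumes K_class: "isclass K" and K_Union: "K = \<Union> \<T>" and S_T: "S \<in> \<T>"
    and T_thin: "T \<in> \<T> \<Longrightarrow> thin T"
    and T_directed: "T \<in> \<T> \<Longrightarrow> T' \<in> \<T> \<Longrightarrow> \<exists>T''\<in>\<T>. T \<subseteq> T'' \<and> T' \<subseteq> T''"
    and T_trans: "T \<in> \<T> \<Longrightarrow> y \<in> T \<Longrightarrow> ext y \<inter> K \<subseteq> T"
    and T_code: "T \<in> \<T> \<Longrightarrow> \<exists>T'\<in>\<T>. \<forall>A. A \<subseteq> T \<longrightarrow> isclass A \<longrightarrow> (\<exists>y\<in>T'. ext y \<inter> K = A)"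
    and K_ext: "x \<in> K \<Longrightarrow> y \<in> K \<Longrightarrow> ext x \<inter> K = ext y \<inter> K \<Longrightarrow> x = y"

context ths
begin

lemma hierarchy_exists: "\<exists>K \<T>. hierarchy E U e0 K \<T>"
proof -
  obtain X0 where X0: "X0 \<in> U" "ext X0 = S" using S_class unfolding isclass_def by blast
  \<comment> \<open>(DC) needs a relation with a successor for every class; making it conditional on
    \<open>good\<close> takes care of the classes that are not levels.\<close>
  define \<Phi> where "\<Phi> X Y \<longleftrightarrow> (good (ext X) \<longrightarrow> good (ext Y) \<and> step (ext X) (ext Y))" for X Y
  have "dfn U U (\<lambda>e. \<Phi> (e 0) (e (Suc 0)))"
    unfolding \<Phi>_def by (intro dfn_imp dfn_conj dfn_step dfn_sub1[OF dfn_good] trm_var) auto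
  moreover have "\<exists>Y\<in>U. \<Phi> X Y" if "X \<in> U" for X
  proof (cases "good (ext X)")
    case True
    then obtain T' where "good T'" "step (ext X) T'" using step_exists by blast
    moreover from this have "isclass T'" by (simp add: good_def)
    ultimately show ?thesis unfolding \<Phi>_def isclass_def by blast
  qed (use that \<Phi>_def in blast)
  ultimately obtain Z where Z: "Z \<in> U" "\<exists>n\<in>U. ext n = {} \<and> section_cls (ext Z) n = ext X0"
    and Z_step: "\<forall>n\<in>SN. \<exists>m\<in>U. ext m = insert n (ext n) \<and> (\<exists>X\<in>U. \<exists>Y\<in>U. ext X = section_cls (ext Z) n \<and>
           ext Y = section_cls (ext Z) m \<and> \<Phi> X Y)"
    using dc_ax[of \<Phi> X0] X0(1) by blast
  define T where "T = section_cls (ext Z)"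
  have T0: "T (cd {}) = S"
  proof -
    obtain n where n: "n \<in> U" "ext n = {}" "section_cls (ext Z) n = ext X0" using Z by blast
    then have "n = cd {}" by (intro cls_ext) auto
    then show ?thesis using n X0 by (simp add: T_def)
  qed
  have T_suc: "good (T (suc n)) \<and> step (T n) (T (suc n))" if n: "n \<in> SN" "good (T n)" for n
  proof -
    obtain m X Y where m: "m \<in> U" "ext m = insert n (ext n)" "ext X = T n" "ext Y = T m" "\<Phi> X Y"
      using Z_step n(1) unfolding T_def by blast
    then have "m = suc n" using SN_H[OF n(1)] by (intro cls_ext) auto
    then show ?thesis using m n(2) unfolding \<Phi>_def by simp
  qed
  have dfn_T: "dfn U U (\<lambda>e. s e \<in> T (t e))" if "trm U s" "trm U t" for s t
  proof (rule dfn_sub2[where R = "\<lambda>y n. y \<in> T n"])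
    have "dfn U U (\<lambda>e. e 0 \<in> H \<and> (\<exists>g\<in>ext Z. pr g (e (Suc 0)) (e 0)))"
      using Z(1) by (intro dfn_intros) auto
    then show "dfn U U (\<lambda>e. e 0 \<in> T (e (Suc 0)))" by (simp add: T_def section_cls_def)
  qed (use that in auto)
  have T_class: "isclass (T n)" if "n \<in> U" for n
    unfolding T_def by (rule isclass_section[OF Z(1) that])
  have T_H: "T n \<subseteq> H" for n unfolding T_def section_cls_def by blast
  have T_good: "good (T n)" if "n \<in> SN" for n
  proof -
    \<comment> \<open>\<open>T n\<close> is only a section of \<open>Z\<close>. A definable
      statement about it has to quantify over a class \<open>X\<close> with the same
      elements.\<close>
    define P where "P n \<longleftrightarrow> (\<exists>X\<in>U. (\<forall>y\<in>U. y \<in> ext X \<longleftrightarrow> y \<in> T n) \<and> good (ext X))" for n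
    have P: "P n \<longleftrightarrow> good (T n)" if "n \<in> U" for n
    proof -
      have "(\<forall>y\<in>U. y \<in> ext X \<longleftrightarrow> y \<in> T n) \<longleftrightarrow> ext X = T n" for X using T_H ext_H H_U by blast
      then show ?thesis using T_class[OF that] unfolding P_def isclass_def by auto
    qed
    have "P n" using that
    proof (induction rule: SN_induct)
      case dfn
      show ?case unfolding P_def
        by (intro dfn_bex dfn_ball dfn_conj dfn_iff dfn_T dfn_in dfn_sub1[OF dfn_good] trm_var) auto
    next
      case zero
      show ?case using P[of "cd {}"] T0 good_S by simp
    next
      case (suc n)
      then show ?case using P[of n] P[of "suc n"] T_suc SN_H by simp
    qed
    then show ?thesis using P SN_H that by simp
  qed
  have T_step: "step (T n) (T (suc n))" if "n \<in> SN" for n using T_suc T_good that by blast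
  have T_mono: "\<forall>m\<in>ext n. \<forall>y\<in>T m. y \<in> T n" if "n \<in> SN" for n
    using that
  proof (induction rule: SN_induct)
    case dfn
    have "dfn U U (\<lambda>e. \<forall>m\<in>ext (e 0). \<forall>y\<in>H. y \<in> T m \<longrightarrow> y \<in> T (e 0))"
      by (intro dfn_ball_ext dfn_ball dfn_imp dfn_T trm_var) auto
    then show ?case by (rule dfn_cong) (use T_H in blast)
  next
    case (suc n)
    have "T n \<subseteq> T (suc n)" using T_step[OF suc(1)] by (simp add: step_def)
    then show ?case using suc SN_H by auto
  qed simp
  have T_linear: "T m \<subseteq> T n \<or> T n \<subseteq> T m" if "m \<in> SN" "n \<in> SN" for m n
    using SN_linear[OF that(1)] that T_mono by blast
  \<comment> \<open>Later levels add no members to an element of an earlier level. If level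
    \<open>n\<close> is contained in level \<open>m\<close>, then \<open>y\<close> belongs to level
    \<open>m + 1\<close>, and its members there lie in level \<open>m\<close> by
    \<open>step\<close>; the hypothesis for \<open>m\<close> applies to them.\<close>
  have T_init: "\<forall>z\<in>ext y. z \<in> T m \<longrightarrow> z \<in> T n" if n: "n \<in> SN" "y \<in> T n" and m: "m \<in> SN" for n y m
    using m
  proof (induction rule: SN_induct)
    case dfn
    have "y \<in> H" "n \<in> H" using n T_H SN_H by blast+
    then have "y \<in> U" "n \<in> U" by simp_all
    then show ?case by (intro dfn_ball_ext dfn_imp dfn_T trm_var trm_const) auto
  next
    case zero
    then show ?case using SN_zero_least[OF n(1)] T_mono[OF n(1)] by blast
  next
    case (suc m)
    consider "T (suc m) \<subseteq> T n" | "T n \<subseteq> T m"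
      using SN_linear[OF n(1)] SN_suc[OF suc(1)] T_mono suc n SN_H[OF suc(1)] by fastforce
    then show ?case
    proof cases
      case 2
      then have "y \<in> T (suc m)" using n T_step[OF suc(1)] by (auto simp: step_def)
      then have "ext y \<inter> T (suc m) \<subseteq> T m" using T_step[OF suc(1)] by (auto simp: step_def)
      then show ?thesis using suc.IH by blast
    qed blast
  qed
  define K where "K = {y\<in>H. \<exists>n\<in>SN. y \<in> T n}"
  have K: "K = \<Union> (T ` SN)" using T_H by (auto simp: K_def)
  have tr: "ext y \<inter> K \<subseteq> T n" if "n \<in> SN" "y \<in> T n" for n y
    using T_init[OF that] unfolding K by blast
  have code: "\<exists>y\<in>T (suc n). ext y \<inter> K = A" if A: "n \<in> SN" "A \<subseteq> T n" "isclass A" for n A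
  proof -
    obtain X where "X \<in> U" "ext X = A" using A(3) by (auto simp: isclass_def)
    then obtain y where y: "y \<in> T (suc n)" "ext y \<inter> T (suc n) = A"
      using T_step[OF A(1)] A(2) unfolding step_def by blast
    have "ext y \<inter> K \<subseteq> T (suc n)" using tr[OF SN_suc[OF A(1)] y(1)] .
    moreover have "T (suc n) \<subseteq> K" using SN_suc[OF A(1)] unfolding K by blast
    ultimately show ?thesis using y by blast
  qed
  have ext: "x = y" if xy: "x \<in> K" "y \<in> K" "ext x \<inter> K = ext y \<inter> K" for x y
  proof -
    obtain m n where "m \<in> SN" "n \<in> SN" "x \<in> T m" "y \<in> T n" using xy unfolding K by blast
    then obtain k where k: "k \<in> SN" "x \<in> T k" "y \<in> T k" using T_linear by blast
    then have "ext x \<inter> T k = ext y \<inter> T k" using xy(3) unfolding K by blast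
    then show ?thesis using T_good[OF k(1)] k unfolding good_def by blast
  qed
  have "hierarchy E U e0 K (T ` SN)"
  proof
    show "isclass K" unfolding K_def by (intro isclass_Collect dfn_bex dfn_T trm_var) auto
    show "K = \<Union> (T ` SN)" by (rule K)
    show "S \<in> T ` SN" using T0 SN_zero by blast
    show "thin A" if "A \<in> T ` SN" for A using that T_good unfolding good_def by blast
    show "\<exists>T''\<in>T ` SN. A \<subseteq> T'' \<and> B \<subseteq> T''" if AB: "A \<in> T ` SN" "B \<in> T ` SN" for A B
    proof -
      obtain m n where "m \<in> SN" "A = T m" "n \<in> SN" "B = T n" using AB by blast
      then show ?thesis using T_linear[of m n] AB by auto
    qed
    show "ext y \<inter> K \<subseteq> A" if A: "A \<in> T ` SN" "y \<in> A" for A y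
    proof -
      obtain n where "n \<in> SN" "A = T n" using A by blast
      then show ?thesis using tr[of n y] A(2) by simp
    qed
    show "\<exists>T'\<in>T ` SN. \<forall>A. A \<subseteq> B \<longrightarrow> isclass A \<longrightarrow> (\<exists>y\<in>T'. ext y \<inter> K = A)"
      if B: "B \<in> T ` SN" for B
    proof -
      obtain n where n: "n \<in> SN" "B = T n" using B by blast
      then show ?thesis using code[OF n(1)] SN_suc[OF n(1)] by (intro bexI[of _ "T (suc n)"]) auto
    qed
    show "x = y" if "x \<in> K" "y \<in> K" "ext x \<inter> K = ext y \<inter> K" for x y using ext[OF that] .
  qed
  then show ?thesis by blast
qed

end


section \<open>Zermelo set theory in the hierarchy\<close>

context hierarchy
begin

section \<open>Traces and their codes in the hierarchy\<close>

definition tra :: "'a \<Rightarrow> 'a set"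
  where "tra y = {x\<in>K. x \<in> ext y}"

definition bounded :: "'a set \<Rightarrow> bool"
  where "bounded A \<longleftrightarrow> (\<exists>T\<in>\<T>. A \<subseteq> T)"

lemma K_H: "K \<subseteq> H"
  using K_class isclass_H by blast

lemma K_in_H [simp]: "x \<in> K \<Longrightarrow> x \<in> H"
  using K_H by blast

lemma K_dset [simp]: "dset U U K"
  using K_class by simp

lemma S_K [simp]: "x \<in> S \<Longrightarrow> x \<in> K"
  using S_T K_Union by blast

lemma bounded_subset: "bounded B \<Longrightarrow> A \<subseteq> B \<Longrightarrow> bounded A"
  unfolding bounded_def by blast

lemma bounded_tra: "y \<in> K \<Longrightarrow> bounded (tra y)"
  using T_trans K_Union unfolding bounded_def tra_def by blast

lemma bounded_insert:
  assumes "bounded A" "x \<in> K" shows "bounded (insert x A)"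
proof -
  obtain T T' where T: "T \<in> \<T>" "A \<subseteq> T" "T' \<in> \<T>" "x \<in> T'"
    using assms K_Union unfolding bounded_def by blast
  then obtain T'' where "T'' \<in> \<T>" "T \<subseteq> T''" "T' \<subseteq> T''" using T_directed by blast
  then show ?thesis using T unfolding bounded_def by blast
qed

lemma bounded_empty [simp]: "bounded {}"
  using S_T unfolding bounded_def by blast

lemma bounded_S: "bounded S"
  using S_T unfolding bounded_def by blast

lemma tra_eq: "x \<in> K \<Longrightarrow> y \<in> K \<Longrightarrow> tra x = tra y \<Longrightarrow> x = y"
  using K_ext[of x y] by (auto simp: tra_def)

lemma isclass_tra [simp]: "y \<in> K \<Longrightarrow> isclass (tra y)"
  unfolding tra_def using K_class by (intro isclass_Collect dfn_intros) auto

lemma isclass_insert [simp]: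
  assumes "isclass A" "x \<in> H" shows "isclass (insert x A)"
proof -
  have "insert x A = {z\<in>H. z = x \<or> z \<in> A}" using assms isclass_H by auto
  then show ?thesis using assms by (simp, intro isclass_Collect dfn_intros) auto
qed

lemma code:
  assumes "bounded A" "isclass A" "A \<subseteq> K"
  obtains y where "y \<in> K" "tra y = A"
proof -
  obtain T where T: "T \<in> \<T>" "A \<subseteq> T" using assms(1) unfolding bounded_def by blast
  obtain T' where T': "T' \<in> \<T>" "\<forall>A. A \<subseteq> T \<longrightarrow> isclass A \<longrightarrow> (\<exists>y\<in>T'. ext y \<inter> K = A)"
    using T_code[OF T(1)] by (elim bexE)
  then obtain y where "y \<in> T'" "ext y \<inter> K = A" using T(2) assms(2) by blast
  moreover from this have "y \<in> K" using T'(1) K_Union by blast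
  ultimately have "y \<in> K" "ext y \<inter> K = A" by blast+
  then show thesis by (intro that[of y]) (auto simp: tra_def)
qed

lemma code_insert:
  assumes "y \<in> K" "x \<in> K"
  obtains z where "z \<in> K" "tra z = insert x (tra y)"
proof (rule code)
  show "bounded (insert x (tra y))" using assms by (intro bounded_insert bounded_tra)
  show "insert x (tra y) \<subseteq> K" using assms by (auto simp: tra_def)
qed (use assms in auto)

lemma code_empty: obtains y where "y \<in> K" "tra y = {}"
  by (rule code[of "{}"]) (use isset_isclass[of "{}"] in auto)

lemma code_pair:
  assumes "x \<in> K" "y \<in> K"
  obtains z where "z \<in> K" "tra z = {x, y}"
proof -
  obtain o' where "o' \<in> K" "tra o' = {}" using code_empty .
  moreover from this obtain p where "p \<in> K" "tra p = insert y {}" using code_insert assms by metis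
  ultimately show thesis using code_insert assms that by metis
qed

text \<open>\<open>S\<close> is transitive and contained in \<open>K\<close>, so standard sets lose
  no members in the model.\<close>

lemma tra_S: "s \<in> S \<Longrightarrow> tra s = ext s"
  using S_memD by (auto simp: tra_def intro: S_K)

lemma tra_eq_iff:
  "(\<forall>z\<in>K. z \<in> ext y \<longleftrightarrow> z \<in> ext x \<or> z = w) \<longleftrightarrow> tra y = insert w (tra x)" if "w \<in> K"
  using that by (auto simp: tra_def)

section \<open>The axioms verified\<close>

lemma sat_extensionality: "sat K E e Z_extensionality"
  unfolding Z_extensionality_def by (auto simp: E_ext tra_def intro!: tra_eq)

lemma sat_empty: "sat K E e Z_empty"
  unfolding Z_empty_def empty_fm_def by (rule code_empty) (auto simp: E_ext tra_def)

lemma sat_pairing: "sat K E e Z_pairing"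
  unfolding Z_pairing_def upair_fm_def
proof (simp add: E_ext, intro ballI)
  fix x y assume "x \<in> K" "y \<in> K"
  then obtain z where "z \<in> K" "tra z = {x, y}" using code_pair by metis
  then show "\<exists>z\<in>K. \<forall>w\<in>K. (w \<in> ext z) = (w = x \<or> w = y)"
    by (intro bexI[of _ z]) (auto simp: tra_def)
qed

lemma sat_union: "sat K E e Z_union"
  unfolding Z_union_def
proof (simp add: E_ext, intro ballI)
  fix x assume x: "x \<in> K"
  let ?A = "{z\<in>K. \<exists>w\<in>K. w \<in> ext x \<and> z \<in> ext w}"
  obtain T where T: "T \<in> \<T>" "x \<in> T" using x K_Union by blast
  have "?A \<subseteq> T" using T_trans[OF T(1)] T(2) by blast
  then have "bounded ?A" using T(1) unfolding bounded_def by blast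
  moreover have "isclass ?A" using x K_class by (intro isclass_Collect dfn_intros) auto
  ultimately obtain y where "y \<in> K" "tra y = ?A" using code[of ?A] by blast
  then show "\<exists>y\<in>K. \<forall>z\<in>K. (z \<in> ext y) = (\<exists>w\<in>K. w \<in> ext x \<and> z \<in> ext w)"
    by (intro bexI[of _ y]) (auto simp: tra_def)
qed

text \<open>A subset \<open>z\<close> of \<open>x\<close> in the model has a trace inside the level
  \<open>T\<close> of \<open>x\<close>, and one level \<open>T'\<close> contains codes of all
  subclasses of \<open>T\<close>. By extensionality \<open>z\<close> is the code of its own trace,
  so it lies in \<open>T'\<close>; the subsets of \<open>x\<close> are therefore bounded.\<close>

lemma sat_power: "sat K E e Z_power"
  unfolding Z_power_def subset_fm_def
proof (simp add: E_ext, intro ballI)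
  fix x assume x: "x \<in> K"
  let ?A = "{z\<in>K. \<forall>w\<in>K. w \<in> ext z \<longrightarrow> w \<in> ext x}"
  obtain T where T: "T \<in> \<T>" "x \<in> T" using x K_Union by blast
  obtain T' where T': "T' \<in> \<T>" "\<forall>A. A \<subseteq> T \<longrightarrow> isclass A \<longrightarrow> (\<exists>y\<in>T'. ext y \<inter> K = A)"
    using T_code[OF T(1)] by (elim bexE)
  have "?A \<subseteq> T'"
  proof
    fix z assume z: "z \<in> ?A"
    then have "isclass (tra z)" by (intro isclass_tra) blast
    moreover have "tra z \<subseteq> T" using z T_trans[OF T] unfolding tra_def by blast
    ultimately obtain y where y: "y \<in> T'" "ext y \<inter> K = tra z" using T'(2) by blast
    have "y \<in> K" using y(1) T'(1) K_Union by blast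
    moreover have "z \<in> K" using z by blast
    moreover have "ext z \<inter> K = tra z" by (auto simp: tra_def)
    ultimately have "z = y" using y(2) by (intro K_ext) simp_all
    then show "z \<in> T'" using y by simp
  qed
  then have "bounded ?A" using T'(1) unfolding bounded_def by blast
  moreover have "isclass ?A" using x K_class by (intro isclass_Collect dfn_intros) auto
  ultimately obtain y where "y \<in> K" "tra y = ?A" using code[of ?A] by blast
  then show "\<exists>y\<in>K. \<forall>z\<in>K. (z \<in> ext y) = (\<forall>w\<in>K. w \<in> ext z \<longrightarrow> w \<in> ext x)"
    by (intro bexI[of _ y]) (auto simp: tra_def)
qed

lemma S_suc: "s \<in> S \<Longrightarrow> suc s \<in> S"
  by (simp add: suc_def)

lemma sat_inductive: "sat K E e (inductive_fm i) \<longleftrightarrow>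
  (\<exists>z\<in>tra (e i). tra z = {}) \<and> (\<forall>m\<in>tra (e i). \<exists>s\<in>tra (e i). tra s = insert m (tra m))"
proof -
  have "sat K E e (inductive_fm i) \<longleftrightarrow> (\<exists>z\<in>K. z \<in> ext (e i) \<and> (\<forall>w\<in>K. w \<notin> ext z)) \<and>
    (\<forall>m\<in>K. m \<in> ext (e i) \<longrightarrow> (\<exists>s\<in>K. s \<in> ext (e i) \<and> (\<forall>w\<in>K. w \<in> ext s \<longleftrightarrow> w \<in> ext m \<or> w = m)))"
    by (simp only: inductive_fm_def empty_fm_def adjoin_fm_def sem_simps E_ext)
  moreover have "(\<forall>w\<in>K. w \<notin> ext z) \<longleftrightarrow> tra z = {}" for z by (auto simp: tra_def)
  moreover have "(\<exists>z\<in>tra y. Q z) \<longleftrightarrow> (\<exists>z\<in>K. z \<in> ext y \<and> Q z)" for Q y by (auto simp: tra_def)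
  moreover have "(\<forall>z\<in>tra y. Q z) \<longleftrightarrow> (\<forall>z\<in>K. z \<in> ext y \<longrightarrow> Q z)" for Q y by (auto simp: tra_def)
  ultimately show ?thesis by (simp add: tra_eq_iff)
qed

text \<open>The code of \<open>S\<close> itself, rather than of the natural numbers, is the witness
  for infinity. It later also shows that numbers of the model are standard.\<close>

lemma S_inductive:
  assumes i: "tra i = S"
  shows "(\<exists>z\<in>tra i. tra z = {}) \<and> (\<forall>m\<in>tra i. \<exists>s\<in>tra i. tra s = insert m (tra m))"
proof (intro conjI ballI)
  show "\<exists>z\<in>tra i. tra z = {}" using i tra_S[of "cd {}"] by (intro bexI[of _ "cd {}"]) auto
  show "\<exists>s\<in>tra i. tra s = insert m (tra m)" if "m \<in> tra i" for m
    using i that tra_S[of m] tra_S[of "suc m"] S_suc[of m] by (intro bexI[of _ "suc m"]) auto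
qed

lemma sat_infinity: "sat K E e Z_infinity"
proof -
  obtain i where i: "i \<in> K" "tra i = S" using code[OF bounded_S S_class] S_K by blast
  show ?thesis
    by (simp only: Z_infinity_def sem_simps sat_inductive) (rule bexI[OF _ i(1)], rule S_inductive[OF i(2)])
qed

lemma sat_separation:
  assumes "f \<in> envs K" shows "sat K E f (Z_separation p)"
proof -
  have "\<exists>y\<in>K. \<forall>z\<in>K. (z \<in> ext y) = (z \<in> ext x \<and> sat K E (z ## f) p)" if x: "x \<in> K" for x
  proof -
    let ?A = "{z\<in>tra x. sat K E (z ## f) p}"
    have "dfn U U (\<lambda>e. sat K E (\<lambda>i. case_nat (\<lambda>e. e 0) (\<lambda>i e. f i) i e) p)"
    proof (rule dfn_sat)
      show "trm U (case_nat (\<lambda>e. e 0) (\<lambda>i e. f i) i)" for i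
        using assms by (cases i) (auto intro: trm_var trm_const simp: envsD)
    qed simp
    moreover have scons_f: "(\<lambda>i. case_nat (\<lambda>e. e 0) (\<lambda>i e. f i) i e) = e 0 ## f" for e
      by (auto simp: scons_def fun_eq_iff split: nat.splits)
    ultimately have "dfn U U (\<lambda>e. sat K E (e 0 ## f) p)"
      by (elim dfn_cong) (simp only: scons_f)
    then have "isclass ?A" by (rule isclass_Collect[OF isclass_tra[OF x]])
    moreover have "bounded ?A" by (rule bounded_subset[OF bounded_tra[OF x]]) blast
    ultimately obtain y where "y \<in> K" "tra y = ?A" using code[of ?A] by (auto simp: tra_def)
    then show ?thesis by (intro bexI[of _ y]) (auto simp: tra_def)
  qed
  then show ?thesis unfolding Z_separation_def by (simp add: E_ext)
qed

text \<open>(Choice) is applied to the relation between the elements of \<open>x\<close> and their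
  elements, whose domain is thin because it is a subclass of a level. The values of the resulting
  function lie in that level too, by transitivity, and so have a code.\<close>

lemma choice_set:
  assumes x: "x \<in> K" and ne: "\<And>y. y \<in> tra x \<Longrightarrow> tra y \<noteq> {}"
    and disj: "\<And>y z. y \<in> tra x \<Longrightarrow> z \<in> tra x \<Longrightarrow> y \<noteq> z \<Longrightarrow> tra y \<inter> tra z = {}"
  shows "\<exists>c\<in>K. \<forall>y\<in>tra x. \<exists>z. tra y \<inter> tra c = {z}"
proof -
  define R where "R = {g\<in>H. \<exists>y\<in>K. \<exists>z\<in>K. y \<in> ext x \<and> z \<in> ext y \<and> pr g y z}"
  have R: "isclass R" unfolding R_def using x by (intro isclass_Collect dfn_intros) auto
  obtain T where T: "T \<in> \<T>" "x \<in> T" using x K_Union by blast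
  have dom: "dom_cls R = tra x"
  proof (intro equalityI subsetI)
    fix y assume "y \<in> dom_cls R"
    then show "y \<in> tra x" using pr_inject unfolding dom_cls_def R_def tra_def by blast
  next
    fix y assume y: "y \<in> tra x"
    then obtain z where z: "z \<in> K" "z \<in> ext y" using ne by (auto simp: tra_def)
    have yK: "y \<in> K" "y \<in> ext x" using y by (auto simp: tra_def)
    then have "pr (pair y z) y z" "pair y z \<in> H" using z by simp_all
    then have "pair y z \<in> R" unfolding R_def using z yK by blast
    then show "y \<in> dom_cls R"
      unfolding dom_cls_def using \<open>pr (pair y z) y z\<close> yK(1) z(1) K_H by blast
  qed
  have "thin (dom_cls R)" unfolding dom
  proof (rule thin_subset[OF T_thin[OF T(1)] _ isclass_tra[OF x]])
    show "tra x \<subseteq> T" using T_trans[OF T] unfolding tra_def by blast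
  qed
  then obtain F where F: "F \<subseteq> R" "isclass F" "dom_cls F = tra x"
    and fn: "\<And>g h x y z. g \<in> F \<Longrightarrow> h \<in> F \<Longrightarrow> x \<in> H \<Longrightarrow> y \<in> H \<Longrightarrow> z \<in> H \<Longrightarrow> pr g x y \<Longrightarrow> pr h x z \<Longrightarrow> y = z"
    using choice_ax[OF R] unfolding dom by metis
  have inF: "y \<in> tra x \<and> z \<in> tra y" if "g \<in> F" "pr g y z" for g y z
    using that F(1) pr_inject unfolding R_def tra_def by blast
  let ?C = "{z\<in>K. \<exists>y\<in>K. \<exists>g\<in>F. pr g y z}"
  have "?C \<subseteq> T"
  proof
    fix z assume "z \<in> ?C"
    then obtain y where "y \<in> tra x" "z \<in> tra y" using inF by blast
    then show "z \<in> T" using T_trans[OF T(1)] T(2) unfolding tra_def by blast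
  qed
  then have "bounded ?C" using T(1) unfolding bounded_def by blast
  moreover have "isclass ?C" using F K_class by (intro isclass_Collect dfn_intros) auto
  ultimately obtain c where c: "c \<in> K" "tra c = ?C" using code[of ?C] by blast
  have "\<exists>z. tra y \<inter> tra c = {z}" if y: "y \<in> tra x" for y
  proof -
    have "y \<in> dom_cls F" using y F by simp
    then obtain z g where z: "z \<in> H" "g \<in> F" "pr g y z" unfolding dom_cls_def by blast
    then have zy: "z \<in> tra y" using inF by blast
    have "z \<in> tra c" using z zy y c by (auto simp: tra_def)
    moreover have "w = z" if w: "w \<in> tra y" "w \<in> tra c" for w
    proof -
      obtain y' g' where y': "g' \<in> F" "pr g' y' w" using w(2) c by blast
      then have "y' \<in> tra x" "w \<in> tra y'" using inF by blast+
      then have "y' = y" using disj[OF y] w(1) by blast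
      then show ?thesis
        using fn[OF y'(1) z(2), of y w z] y' z y w by (auto simp: tra_def)
    qed
    ultimately have "tra y \<inter> tra c = {z}" using zy by blast
    then show ?thesis by blast
  qed
  then show ?thesis using c by blast
qed

lemma sat_choice: "sat K E e Z_choice"
proof (simp only: Z_choice_def empty_fm_def sem_simps E_ext, intro ballI impI, elim conjE)
  fix x assume x: "x \<in> K"
    and ne: "\<forall>y\<in>K. y \<in> ext x \<longrightarrow> \<not> (\<forall>z\<in>K. z \<notin> ext y)"
    and disj: "\<forall>y\<in>K. y \<in> ext x \<longrightarrow> (\<forall>z\<in>K. z \<in> ext x \<longrightarrow> y \<noteq> z \<longrightarrow> \<not> (\<exists>w\<in>K. w \<in> ext y \<and> w \<in> ext z))"
  have "\<exists>c\<in>K. \<forall>y\<in>tra x. \<exists>z. tra y \<inter> tra c = {z}"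
  proof (rule choice_set[OF x])
    show "tra y \<noteq> {}" if "y \<in> tra x" for y using ne that unfolding tra_def by blast
    fix y z assume yz: "y \<in> tra x" "z \<in> tra x" "y \<noteq> z"
    then have "y \<in> K" "y \<in> ext x" "z \<in> K" "z \<in> ext x" by (simp_all add: tra_def)
    then have "\<not> (\<exists>w\<in>K. w \<in> ext y \<and> w \<in> ext z)" using disj yz(3) by blast
    then show "tra y \<inter> tra z = {}" unfolding tra_def by blast
  qed
  then obtain c where c: "c \<in> K" "\<forall>y\<in>tra x. \<exists>z. tra y \<inter> tra c = {z}" by blast
  have "\<exists>z\<in>K. \<forall>w\<in>K. (w \<in> ext y \<and> w \<in> ext c) = (w = z)" if y: "y \<in> K" "y \<in> ext x" for y
  proof -
    obtain z where "tra y \<inter> tra c = {z}" using c y by (auto simp: tra_def)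
    then show ?thesis by (intro bexI[of _ z]) (auto simp: tra_def)
  qed
  then show "\<exists>c\<in>K. \<forall>y\<in>K. y \<in> ext x \<longrightarrow> (\<exists>z\<in>K. \<forall>w\<in>K. (w \<in> ext y \<and> w \<in> ext c) = (w = z))"
    using c(1) by blast
qed

theorem sat_ZC_minus:
  assumes "e \<in> envs K" "p \<in> ZC_minus" shows "sat K E e p"
  using assms(2) unfolding ZC_minus_def
  by (auto simp: sat_extensionality sat_empty sat_pairing sat_union sat_power sat_infinity sat_choice
      intro: sat_closuresI[OF sat_separation assms(1)])


section \<open>The hereditarily finite sets of the hierarchy\<close>

text \<open>The pair in the sense of the model. It must be distinguished from \<open>pr\<close>,
  since the element with trace \<open>{x}\<close> may have further members outside
  \<open>K\<close>.\<close>

definition kpair :: "'a \<Rightarrow> 'a \<Rightarrow> 'a \<Rightarrow> bool"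
  where "kpair g x y \<longleftrightarrow> (\<exists>a\<in>K. \<exists>b\<in>K. tra a = {x} \<and> tra b = {x, y} \<and> tra g = {a, b})"

definition rel :: "'a \<Rightarrow> ('a \<times> 'a) set"
  where "rel f = {(x, y). x \<in> K \<and> y \<in> K \<and> (\<exists>g\<in>tra f. kpair g x y)}"

definition nat_K :: "'a \<Rightarrow> bool"
  where "nat_K n \<longleftrightarrow> (\<forall>i\<in>K. (\<exists>z\<in>tra i. tra z = {}) \<and>
    (\<forall>m\<in>tra i. \<exists>s\<in>tra i. tra s = insert m (tra m)) \<longrightarrow> n \<in> tra i)"

definition bijection_K :: "'a \<Rightarrow> 'a \<Rightarrow> 'a \<Rightarrow> bool"
  where "bijection_K f n t \<longleftrightarrow> (\<forall>g\<in>tra f. \<exists>x\<in>K. \<exists>y\<in>K. kpair g x y) \<and>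
    single_valued (rel f) \<and> single_valued ((rel f)\<inverse>) \<and> tra n = Domain (rel f) \<and> tra t = Range (rel f)"

definition finite_K :: "'a \<Rightarrow> bool"
  where "finite_K t \<longleftrightarrow> (\<exists>n\<in>K. nat_K n \<and> (\<exists>f\<in>K. bijection_K f n t))"

lemma sat_nat: "e \<in> envs K \<Longrightarrow> sat K E e (nat_fm i) \<longleftrightarrow> nat_K (e i)"
proof -
  assume "e \<in> envs K"
  then have "e i \<in> K" by (rule envsD)
  then show ?thesis
    unfolding nat_fm_def nat_K_def by (simp add: sat_inductive E_ext tra_def)
qed

lemma sat_upair: "e \<in> envs K \<Longrightarrow> sat K E e (upair_fm z x y) \<longleftrightarrow> tra (e z) = {e x, e y}"
  unfolding upair_fm_def by (simp only: sem_simps E_ext) (auto simp: tra_def envsD)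

lemma sat_opair: "e \<in> envs K \<Longrightarrow> sat K E e (opair_fm z x y) \<longleftrightarrow> kpair (e z) (e x) (e y)"
  unfolding opair_fm_def kpair_def by (simp add: sat_upair)

lemma sat_opair_in: "e \<in> envs K \<Longrightarrow> sat K E e (opair_in_fm x y r) \<longleftrightarrow> (e x, e y) \<in> rel (e r)"
  unfolding opair_in_fm_def rel_def by (simp add: sat_opair E_ext) (auto simp: tra_def envsD)

lemma rel_K: "(x, y) \<in> rel f \<Longrightarrow> x \<in> K \<and> y \<in> K"
  by (simp add: rel_def)

lemma sat_bijection:
  assumes e: "e \<in> envs K"
  shows "sat K E e (bijection_fm f n t) \<longleftrightarrow> bijection_K (e f) (e n) (e t)"
proof -
  have "sat K E e (function_fm f) \<longleftrightarrow> (\<forall>g\<in>tra (e f). \<exists>x\<in>K. \<exists>y\<in>K. kpair g x y) \<and> single_valued (rel (e f))"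
  proof -
    have "sat K E e (function_fm f) \<longleftrightarrow> (\<forall>g\<in>K. g \<in> ext (e f) \<longrightarrow> (\<exists>x\<in>K. \<exists>y\<in>K. kpair g x y)) \<and>
        (\<forall>x\<in>K. \<forall>y\<in>K. \<forall>z\<in>K. (x, y) \<in> rel (e f) \<and> (x, z) \<in> rel (e f) \<longrightarrow> y = z)"
      unfolding function_fm_def using e by (simp add: sat_opair sat_opair_in E_ext)
    then show ?thesis
      unfolding single_valued_def tra_def using rel_K by blast
  qed
  moreover have "sat K E e (injective_fm f) \<longleftrightarrow> single_valued ((rel (e f))\<inverse>)"
  proof -
    have "sat K E e (injective_fm f) \<longleftrightarrow>
        (\<forall>x\<in>K. \<forall>y\<in>K. \<forall>z\<in>K. (x, z) \<in> rel (e f) \<and> (y, z) \<in> rel (e f) \<longrightarrow> x = y)"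
      unfolding injective_fm_def using e by (simp add: sat_opair_in)
    then show ?thesis
      unfolding single_valued_def using rel_K by blast
  qed
  moreover have "sat K E e (dom_fm n f) \<longleftrightarrow> tra (e n) = Domain (rel (e f))"
  proof -
    have "sat K E e (dom_fm n f) \<longleftrightarrow> (\<forall>x\<in>K. x \<in> ext (e n) \<longleftrightarrow> (\<exists>y\<in>K. (x, y) \<in> rel (e f)))"
      unfolding dom_fm_def using e by (simp add: sat_opair_in E_ext)
    then show ?thesis unfolding tra_def using rel_K by blast
  qed
  moreover have "sat K E e (range_fm t f) \<longleftrightarrow> tra (e t) = Range (rel (e f))"
  proof -
    have "sat K E e (range_fm t f) \<longleftrightarrow> (\<forall>x\<in>K. x \<in> ext (e t) \<longleftrightarrow> (\<exists>y\<in>K. (y, x) \<in> rel (e f)))"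
      unfolding range_fm_def using e by (simp add: sat_opair_in E_ext)
    then show ?thesis unfolding tra_def using rel_K by blast
  qed
  ultimately show ?thesis unfolding bijection_fm_def bijection_K_def by auto
qed

lemma sat_finite: "e \<in> envs K \<Longrightarrow> sat K E e (finite_fm t) \<longleftrightarrow> finite_K (e t)"
  unfolding finite_fm_def finite_K_def by (simp add: sat_nat sat_bijection)

definition hf_K :: "'a \<Rightarrow> bool"
  where "hf_K x \<longleftrightarrow> (\<exists>t\<in>K. x \<in> tra t \<and> (\<forall>y\<in>tra t. tra y \<subseteq> tra t) \<and>
    (\<forall>a\<in>K. tra a \<subseteq> tra t \<and> tra a \<noteq> {} \<longrightarrow> (\<exists>y\<in>tra a. tra y \<inter> tra a = {})) \<and> finite_K t)"

lemma tra_simps: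
  "(\<exists>z\<in>K. z \<in> ext y \<and> Q z) \<longleftrightarrow> (\<exists>z\<in>tra y. Q z)" "(\<forall>z\<in>K. z \<in> ext y \<longrightarrow> Q z) \<longleftrightarrow> (\<forall>z\<in>tra y. Q z)"
  by (auto simp: tra_def)

lemma sat_subset: "sat K E e (subset_fm x y) \<longleftrightarrow> tra (e x) \<subseteq> tra (e y)"
  unfolding subset_fm_def by (simp only: sem_simps E_ext) (auto simp: tra_def)

lemma sat_hf:
  assumes e: "e \<in> envs K"
  shows "sat K E e (hf_fm x) \<longleftrightarrow> hf_K (e x)"
proof -
  have "sat K E e (transitive_fm t) \<longleftrightarrow> (\<forall>y\<in>tra (e t). tra y \<subseteq> tra (e t))" for e t
    unfolding transitive_fm_def by (simp add: sat_subset E_ext tra_simps)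
  moreover have "sat K E e (wellfounded_fm t) \<longleftrightarrow>
      (\<forall>a\<in>K. tra a \<subseteq> tra (e t) \<and> tra a \<noteq> {} \<longrightarrow> (\<exists>y\<in>tra a. tra y \<inter> tra a = {}))" for e t
  proof -
    have "(\<forall>z\<in>K. \<not> z \<in> ext a) \<longleftrightarrow> tra a = {}" for a by (auto simp: tra_def)
    moreover have "(\<exists>z\<in>tra y. z \<in> ext a) \<longleftrightarrow> tra y \<inter> tra a \<noteq> {}" for y a by (auto simp: tra_def)
    ultimately show ?thesis
      unfolding wellfounded_fm_def empty_fm_def by (simp only: sem_simps sat_subset E_ext tra_simps) simp
  qed
  moreover have "e x \<in> ext t \<longleftrightarrow> e x \<in> tra t" for t using envsD[OF e] by (simp add: tra_def)
  ultimately show ?thesis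
    unfolding hf_fm_def hf_K_def using e by (simp add: sat_finite E_ext)
qed

lemma kpair_inject: "kpair g x y \<Longrightarrow> kpair g x' y' \<Longrightarrow> x = x' \<and> y = y'"
  unfolding kpair_def by (auto simp: doubleton_eq_iff)

lemma kpair_exists:
  assumes "x \<in> K" "y \<in> K"
  obtains g where "g \<in> K" "kpair g x y"
proof -
  obtain a where a: "a \<in> K" "tra a = {x}" using code_pair[OF assms(1,1)] by auto
  obtain b where b: "b \<in> K" "tra b = {x, y}" using code_pair[OF assms] .
  obtain g where "g \<in> K" "tra g = {a, b}" using code_pair[OF a(1) b(1)] .
  then show thesis using a b that unfolding kpair_def by blast
qed

lemma nat_zero: "z \<in> K \<Longrightarrow> tra z = {} \<Longrightarrow> nat_K z"
  unfolding nat_K_def by (metis (no_types, lifting) mem_Collect_eq tra_def tra_eq)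

lemma nat_suc: "n \<in> K \<Longrightarrow> s \<in> K \<Longrightarrow> nat_K n \<Longrightarrow> tra s = insert n (tra n) \<Longrightarrow> nat_K s"
  unfolding nat_K_def
proof (intro ballI impI)
  fix i assume s: "s \<in> K" "tra s = insert n (tra n)"
    and n: "\<forall>i\<in>K. (\<exists>z\<in>tra i. tra z = {}) \<and> (\<forall>m\<in>tra i. \<exists>s\<in>tra i. tra s = insert m (tra m)) \<longrightarrow> n \<in> tra i"
    and i: "i \<in> K" "(\<exists>z\<in>tra i. tra z = {}) \<and> (\<forall>m\<in>tra i. \<exists>s\<in>tra i. tra s = insert m (tra m))"
  then obtain s' where s': "s' \<in> tra i" "tra s' = insert n (tra n)" by blast
  then have "s' \<in> K" by (simp add: tra_def)
  then have "s' = s" using s s' by (intro tra_eq) auto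
  then show "s \<in> tra i" using s' by simp
qed

lemma rel_empty: "tra f = {} \<Longrightarrow> rel f = {}"
  by (simp add: rel_def)

lemma finite_empty: "t \<in> K \<Longrightarrow> tra t = {} \<Longrightarrow> finite_K t"
  unfolding finite_K_def using nat_zero
  by (intro bexI[of _ t] conjI) (auto simp: bijection_K_def rel_empty)

text \<open>The enumeration is extended by the pair of \<open>n\<close> and \<open>b\<close>, where
  \<open>n\<close> is not among its own members by foundation.\<close>

lemma finite_insert:
  assumes t: "t \<in> K" "finite_K t" and b: "b \<in> K" and t': "t' \<in> K" "tra t' = insert b (tra t)"
  shows "finite_K t'"
proof (cases "b \<in> tra t")
  case True
  then have "t' = t" using t t' by (intro tra_eq) auto
  then show ?thesis using t by simp
next
  case False
  obtain n f where n: "n \<in> K" "nat_K n" and f: "f \<in> K" "bijection_K f n t"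
    using t(2) unfolding finite_K_def by blast
  obtain n' where n': "n' \<in> K" "tra n' = insert n (tra n)" using code_insert[OF n(1) n(1)] .
  obtain g where g: "g \<in> K" "kpair g n b" using kpair_exists[OF n(1) b] .
  obtain f' where f': "f' \<in> K" "tra f' = insert g (tra f)" using code_insert[OF f(1) g(1)] .
  have rel: "rel f' = insert (n, b) (rel f)"
  proof -
    have "kpair g x y \<longleftrightarrow> x = n \<and> y = b" for x y using g(2) kpair_inject by blast
    then have "(x, y) \<in> rel f' \<longleftrightarrow> (x, y) = (n, b) \<or> (x, y) \<in> rel f" for x y
      unfolding rel_def f'(2) using n(1) b by simp blast
    then show ?thesis by auto
  qed
  have "n \<notin> tra n" using no_1cycle by (auto simp: tra_def)
  then have fresh: "n \<notin> Domain (rel f)" "b \<notin> Range (rel f)"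
    using f(2) False unfolding bijection_K_def by simp_all
  have "bijection_K f' n' t'"
    unfolding bijection_K_def
  proof (intro conjI)
    show "\<forall>g\<in>tra f'. \<exists>x\<in>K. \<exists>y\<in>K. kpair g x y"
      using f(2) f'(2) g n b unfolding bijection_K_def by auto
    show "single_valued (rel f')" "single_valued ((rel f')\<inverse>)"
      using f(2) fresh unfolding bijection_K_def rel single_valued_def by blast+
    show "tra n' = Domain (rel f')" "tra t' = Range (rel f')"
      using f(2) n' t' unfolding bijection_K_def rel by auto
  qed
  then show ?thesis unfolding finite_K_def using n' f' nat_suc[OF n(1) n'(1) n(2) n'(2)] by blast
qed

lemma S_finite: "s \<in> S \<Longrightarrow> finite_K s"
proof -
  assume s: "s \<in> S"
  \<comment> \<open>Phrased by satisfaction, so that \<open>dfn_sat\<close> makes the induction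
    predicate definable; on \<open>K\<close> it agrees with \<open>finite_K\<close>.\<close>
  define P where "P s \<longleftrightarrow> sat K E (\<lambda>_. s) (finite_fm 0)" for s
  have P: "P s \<longleftrightarrow> finite_K s" if "s \<in> K" for s
    unfolding P_def using that by (subst sat_finite) (auto simp: envs_def)
  have "P s" using s
  proof (induction rule: S_induct)
    case dfn
    show ?case unfolding P_def by (rule dfn_sat) (auto simp: trm_var)
  next
    case empty
    show ?case using P[of "cd {}"] finite_empty[of "cd {}"] tra_S[of "cd {}"] by simp
  next
    case (insert a b)
    have "tra (cd (insert b (ext a))) = insert b (tra a)"
      using insert tra_S[of a] tra_S[of "cd (insert b (ext a))"] by simp
    then show ?case
      using insert P[of a] P[of "cd (insert b (ext a))"] finite_insert[of a b "cd (insert b (ext a))"] by simp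
  qed
  then show ?thesis using P s by simp
qed

text \<open>Some level is a transitive set containing \<open>x\<close>, and (T) provides a standard
  one. A nonempty part of it coded in the model is a subclass of a small set, hence a true set, and
  true foundation applies.\<close>

lemma S_hf:
  assumes x: "x \<in> S"
  shows "hf_K x"
proof -
  obtain c l where c: "c \<in> H" "level_chain c" and l: "l \<in> ext c" "x \<in> ext l"
    using level_cover[of x] x by auto
  have "\<exists>t\<in>S. x \<in> ext t \<and> (\<forall>y\<in>ext t. ext y \<subseteq> ext t)"
  proof (rule transfer_ax)
    show "dfn H S (\<lambda>e. x \<in> ext (e 0) \<and> (\<forall>y\<in>ext (e 0). ext y \<subseteq> ext (e 0)))"
      using x by (intro dfn_intros) auto
    show "l \<in> H" using l ext_H by blast
    show "x \<in> ext l \<and> (\<forall>y\<in>ext l. ext y \<subseteq> ext l)" using l level_trans[OF c l(1)] by blast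
  qed
  then obtain t where t: "t \<in> S" "x \<in> ext t" "\<forall>y\<in>ext t. ext y \<subseteq> ext t" by blast
  have tS: "tra t = ext t" using tra_S[OF t(1)] .
  show ?thesis
    unfolding hf_K_def
  proof (rule bexI[of _ t], intro conjI ballI impI)
    show "x \<in> tra t" using t tS by simp
    show "tra y \<subseteq> tra t" if "y \<in> tra t" for y
      using t(3) that tS unfolding tra_def by blast
    show "finite_K t" using S_finite[OF t(1)] .
    fix a assume a: "a \<in> K" "tra a \<subseteq> tra t \<and> tra a \<noteq> {}"
    then have "isset (tra a)" using small_isset[OF S_small[OF t(1)], of "tra a"] tS by simp
    then obtain m where "m \<in> tra a" "ext m \<inter> tra a = {}" using foundation a by blast
    then show "\<exists>y\<in>tra a. tra y \<inter> tra a = {}" unfolding tra_def by blast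
  qed (use t in simp)
qed

lemma nat_S:
  assumes "nat_K n" shows "n \<in> S"
proof -
  obtain i where i: "i \<in> K" "tra i = S" using code[OF bounded_S S_class] S_K by blast
  have "n \<in> tra i" using assms S_inductive[OF i(2)] i(1) unfolding nat_K_def by (elim ballE mp) auto
  then show ?thesis using i(2) by simp
qed

text \<open>The model's bijection starts from a standard number, which is small. The indices that it
  maps into the trace of \<open>m\<close> form a small set, so their image is a set by
  \<open>isset_image\<close>. A set of standard sets is standard by \<open>S_cd\<close>, and
  \<open>m\<close> is the element of \<open>K\<close> with that trace.\<close>

lemma finite_subset_S:
  assumes t: "finite_K t" and m: "m \<in> K" "tra m \<subseteq> S" "tra m \<subseteq> tra t"
  shows "m \<in> S"
proof -
  obtain n f where n: "n \<in> K" "nat_K n" and f: "f \<in> K" "bijection_K f n t"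
    using t unfolding finite_K_def by blast
  have sv: "y = y'" if "(x, y) \<in> rel f" "(x, y') \<in> rel f" for x y y'
    using f(2) that unfolding bijection_K_def single_valued_def by blast
  define R where "R j z \<longleftrightarrow> sat K E (j ## z ## (\<lambda>_. f)) (opair_in_fm 0 1 2)" for j z
  have R_rel: "R j z \<longleftrightarrow> (j, z) \<in> rel f" if "j \<in> K" "z \<in> K" for j z
    unfolding R_def using that f(1) by (subst sat_opair_in) (auto simp: envs_def scons_def split: nat.splits)
  have R: "dfn U U (\<lambda>e. R (s e) (t e))" if "trm U s" "trm U t" for s t
  proof -
    let ?s = "case_nat s (case_nat t (\<lambda>_ _. f))"
    have "dfn U U (\<lambda>e. sat K E (\<lambda>i. ?s i e) (opair_in_fm 0 1 2))"
      by (rule dfn_sat) (use that f(1) in \<open>auto split: nat.splits intro: trm_const\<close>)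
    moreover have "(\<lambda>i. ?s i e) = s e ## t e ## (\<lambda>_. f)" for e
      by (auto simp: scons_def fun_eq_iff split: nat.splits)
    ultimately show ?thesis unfolding R_def by (simp only:)
  qed
  have n_S: "n \<in> S" by (rule nat_S[OF n(2)])
  let ?d = "{j\<in>ext n. \<exists>z\<in>tra m. R j z}"
  have "isclass ?d" using n_S m(1) by (intro isclass_Collect dfn_intros R) auto
  then have d: "isset ?d" using small_isset[OF S_small[OF n_S], of ?d] by blast
  have d_small: "small ?d" by (rule small_subset[OF S_small[OF n_S]]) blast
  define h where "h j = (THE z. z \<in> tra m \<and> R j z)" for j
  have h: "h j = z" if "z \<in> tra m" "R j z" "j \<in> K" for j z
    unfolding h_def
  proof (rule the_equality)
    show "z \<in> tra m \<and> R j z" using that by simp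
    fix w assume w: "w \<in> tra m \<and> R j w"
    then have "w \<in> K" "z \<in> K" using that by (simp_all add: tra_def)
    then have "(j, w) \<in> rel f" "(j, z) \<in> rel f" using w that R_rel by blast+
    then show "w = z" by (rule sv)
  qed
  have dK: "?d \<subseteq> K" using n_S S_memD S_K by blast
  have "isset (h ` ?d)"
  proof (rule isset_image[OF d_small d])
    show "dfn U U (\<lambda>e. e (Suc 0) \<in> tra m \<and> R (e 0) (e (Suc 0)))"
      using m(1) by (intro dfn_intros R) auto
    fix j assume j: "j \<in> ?d"
    then obtain z where z: "z \<in> tra m" "R j z" by blast
    then show "h j \<in> H" using h j dK by (auto simp: tra_def)
    show "y \<in> tra m \<and> R j y \<longleftrightarrow> y = h j" for y using h z j dK by blast
  qed
  moreover have "h ` ?d = tra m"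
  proof (intro equalityI subsetI)
    fix z assume z: "z \<in> tra m"
    then obtain j where j: "(j, z) \<in> rel f" using m(3) f(2) unfolding bijection_K_def by blast
    then have "j \<in> tra n" using f(2) unfolding bijection_K_def by blast
    then have "j \<in> K" "j \<in> ext n" by (simp_all add: tra_def)
    moreover have "R j z" using j rel_K R_rel by blast
    ultimately show "z \<in> h ` ?d" using h z by (intro image_eqI[of _ _ j]) auto
  qed (use h dK in blast)
  ultimately have u: "isset (tra m)" by simp
  then have "cd (tra m) \<in> S" using m(2) by (rule S_cd)
  moreover from this have "m = cd (tra m)" using m(1) u by (intro tra_eq) (simp_all add: tra_S)
  ultimately show ?thesis by simp
qed

text \<open>The nonstandard elements of \<open>t\<close> form a class, hence are coded in the model,
  and well-foundedness gives a minimal one. All its members are standard, so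
  \<open>finite_subset_S\<close> makes it standard, a contradiction.\<close>

lemma hf_S:
  assumes "hf_K x"
  shows "x \<in> S"
proof (rule ccontr)
  assume x: "x \<notin> S"
  obtain t where t: "t \<in> K" "x \<in> tra t" "\<forall>y\<in>tra t. tra y \<subseteq> tra t" "finite_K t"
    and wf: "\<forall>a\<in>K. tra a \<subseteq> tra t \<and> tra a \<noteq> {} \<longrightarrow> (\<exists>y\<in>tra a. tra y \<inter> tra a = {})"
    using assms unfolding hf_K_def by blast
  let ?B = "{z\<in>tra t. z \<notin> S}"
  have "isclass ?B" by (intro isclass_Collect isclass_tra t dfn_intros) auto
  moreover have "bounded ?B" by (rule bounded_subset[OF bounded_tra[OF t(1)]]) blast
  moreover have "?B \<subseteq> K" by (auto simp: tra_def)
  ultimately obtain a where a: "a \<in> K" "tra a = ?B" using code[of ?B] by blast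
  then have "tra a \<subseteq> tra t" "tra a \<noteq> {}" using x t(2) by blast+
  then obtain m where m: "m \<in> tra a" "tra m \<inter> tra a = {}" using wf a(1) by blast
  have "m \<in> tra t" "m \<notin> S" using m(1) a(2) by blast+
  moreover have "m \<in> K" using m(1) by (simp add: tra_def)
  moreover have "tra m \<subseteq> tra t" using t(3) \<open>m \<in> tra t\<close> by blast
  moreover from this have "tra m \<subseteq> S" using m(2) a(2) by blast
  ultimately show False using finite_subset_S[OF t(4)] by blast
qed

lemma sat_hf_iff: "e \<in> envs K \<Longrightarrow> sat K E e (hf_fm i) \<longleftrightarrow> e i \<in> S"
  using sat_hf S_hf hf_S by blast

end


section \<open>Transfer from the standard sets to all sets\<close>

context ths
begin

text \<open>The Tarski-Vaught test: (T), applied to the negated matrix, moves a counterexample from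
  \<open>H\<close> into \<open>S\<close>.\<close>

lemma S_elementary: "e \<in> envs S \<Longrightarrow> sat S E e p \<longleftrightarrow> sat H E e p"
proof (induction p arbitrary: e)
  case (Imp p q)
  then show ?case by simp
next
  case (Forall p)
  have eq: "sat S E (x ## e) p \<longleftrightarrow> sat H E (x ## e) p" if "x \<in> S" for x
    using Forall.IH[of "x ## e"] Forall.prems that by simp
  have "\<exists>y\<in>S. \<not> sat H E (y ## e) p" if x: "x \<in> H" "\<not> sat H E (x ## e) p" for x
  proof (rule transfer_ax[where P = "\<lambda>y. \<not> sat H E (y ## e) p", OF _ x])
    let ?g = "\<lambda>n. case n of 0 \<Rightarrow> 1 | Suc k \<Rightarrow> 2 * k"
    have "(\<lambda>n. mix e f (?g n)) = f 0 ## e" for f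
      by (auto simp: scons_def mix_def fun_eq_iff split: nat.splits)
    then have "sat H E (f 0 ## e) p \<longleftrightarrow> sat H E (mix e f) (ren ?g p)" for f
      by (simp add: sat_ren)
    then show "dfn H S (\<lambda>f. \<not> sat H E (f 0 ## e) p)"
      by (intro dfn_not) (use Forall.prems in \<open>unfold dfn_def, blast\<close>)
  qed
  then show ?case using eq S_mem_H by (simp, blast)
qed simp_all

end

theorem theorem4:
  fixes \<phi> :: fm
  assumes "sentence \<phi>"
    and "ZC_minus \<turnstile> relativize hf_fm \<phi>"
  shows "THS \<turnstile> relativize set_fm \<phi>"
proof (rule completeness)
  fix W :: "nat set set" and E e
  assume e: "e \<in> envs W" and "\<And>x y. E x y \<Longrightarrow> x \<in> W \<and> y \<in> W" "\<And>q. q \<in> THS \<Longrightarrow> sat W E e q"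
  then interpret ths E W e by unfold_locales
  obtain K \<T> where "hierarchy E W e K \<T>" using hierarchy_exists by blast
  then interpret hierarchy E W e K \<T> .
  \<comment> \<open>An assignment with standard values lies in every structure of the argument at
    once; as the sentence is closed, the result carries over to \<open>e\<close> at the end.\<close>
  let ?f = "\<lambda>_::nat. cd {}"
  have f: "?f \<in> envs S" "?f \<in> envs H" "?f \<in> envs K" by (simp_all add: envs_def)
  have "sat K E ?f (relativize hf_fm \<phi>)"
    by (rule soundness[OF assms(2) f(3) sat_ZC_minus[OF f(3)]])
  moreover have "S \<subseteq> K" using S_K by blast
  then have "sat K E ?f (relativize hf_fm \<phi>) = sat S E ?f \<phi>"
    by (rule sat_relativize[OF _ sat_hf_iff f(1)])
  ultimately have "sat H E ?f \<phi>" using S_elementary[OF f(1)] by simp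
  then have "sat W E ?f (relativize set_fm \<phi>)" using sat_relativize_set[OF f(2)] by simp
  moreover have "fv (relativize set_fm \<phi>) = {}"
  proof -
    have "fv (set_fm 0) \<subseteq> {0}" by (auto simp: set_fm_def Exists_def Neg_def)
    then show ?thesis using fv_relativize assms(1) unfolding sentence_def by blast
  qed
  ultimately show "sat W E e (relativize set_fm \<phi>)"
    using sat_cong[of "relativize set_fm \<phi>" ?f e] by simp
qed

end
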